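(* For each integer $n\ge0$ let $P_n(z)=\sum_{j=0}^n \eta_j f_j(z)$, where $\{\eta_j\}$ are complex-valued i.i.d. standard Gaussian random variables and $\{f_j\}$ are orthogonal polynomials of one of the two types below, and let $$\rho_n(z)=\frac{K_{n}^{(1,1)}(z,z)\,K_{n}(z,z)-\left|K_{n}^{(0,1)}(z,z)\right|^2}{\pi \left(K_{n}(z,z)\right)^2}$$ be the intensity function of $P_n$, where $K_n(z,w)=\sum_{j=0}^{n}f_j(z)\overline{f_j(w)}$, $K_{n}^{(0,1)}(z,w)=\sum_{j=0}^{n} f_j(z)\overline{f_j'(w)}$, $K_{n}^{(1,1)}(z,w)=\sum_{j=0}^{n}f_j'(z)\overline{f_j'(w)}$. 1. Suppose $f_j=p_j$ for all $j$, where $\{p_j\}$ are orthonormal polynomials on the real line with respect to a measure $\mu$, from the Nevai class, i.e. their recurrence coefficients satisfy $a_n\to a$ and $b_n\to b$ as $n\to\infty$ with $a\ge0$ and $b\in\mathbb{R}$. Then $$\lim_{n\rightarrow \infty}\rho_n(z)= \frac{1}{4\pi \left(\operatorname{Im}(z)\right)^2}-\frac{\left|z-b+\sqrt{(z-b)^2-4a^2}\right|^2}{4\pi\left|(z-b)^2-4a^2\right|\left( \operatorname{Im}\left(z+\sqrt{(z-b)^2-4a^2}\right) \right)^2}$$ locally uniformly for all $z\in\mathbb{C}\setminus\operatorname{supp}\mu$, where at points $z\in\mathbb{R}\setminus\operatorname{supp}\mu$ the right-hand side is understood as its continuous extension from $\mathbb{C}\setminus\mathbb{R}$. 2. Suppose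 $f_j=\varphi_j$ for all $j$, where $\{\varphi_j\}$ are orthonormal polynomials on the unit circle from the Nevai class, i.e. their recurrence coefficients satisfy $\alpha_j\to 0$ as $j\to\infty$, and suppose that $\{\alpha_j\}\subset(-1,1)$. Then $$\lim_{n\rightarrow \infty}\rho_n(z)= \frac{1}{\pi(1-|z|^2 )^2}$$ locally uniformly for all $z\in\mathbb{C}\setminus\mathbb{T}$, where $\mathbb{T}=\{|z|=1\}$.
   Context: A complex-valued standard Gaussian random variable here is $\eta=\alpha+i\beta$ with $\alpha,\beta$ independent standard real Gaussians (all independent across $j$). Orthonormal polynomials on the real line (OPRL): $\mu$ is a positive measure with infinite support contained in $\mathbb{R}$ and finite moments; $p_j$ has degree $j$, real coefficients and positive leading coefficient, and $\int p_m p_k\,d\mu=\delta_{mk}$. They satisfy the three-term recurrence $z p_n(z)=a_n p_{n+1}(z)+b_n p_n(z)+a_{n-1}p_{n-1}(z)$, $n\ge1$, with recurrence coefficients $a_n>0$, $b_n\in\mathbb{R}$. Branch of the square root: $\sqrt{(z-b)^2-4a^2}$ is the branch analytic in $\mathbb{C}\setminus[b-2a,b+2a]$ that behaves like $z-b$ as $z\to\infty$. Orthonormal polynomials on the unit circle (OPUC): $\mu$ is a probability Borel measure on $\mathbb{T}$ with infinite support; $\varphi_j$ has degree $j$ and positive leading coefficient, and $\int_{\mathbb{T}}\varphi_m\overline{\varphi_k}\,d\mu=\delta_{mk}$. They satisfy $\varphi_{n+1}(z)=\dfrac{z\varphi_n(z)-\overline{\alpha_n}\,\varphi_n^*(z)}{\sqrt{1-|\alpha_n|^2}}$,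 $n\ge0$, where $\varphi_n^*(z)=z^n\overline{\varphi_n(1/\bar z)}$ and the recurrence coefficients $\alpha_n$ lie in the open unit disk. When all $\alpha_n\in(-1,1)$ the $\varphi_n$ have real coefficients. "Locally uniformly" on an open set means uniformly on its compact subsets. Since $f_0$ is a nonzero constant, $K_n(z,z)>0$ and $\rho_n$ is continuous on $\mathbb{C}$. The function $\rho_n$ is the density, with respect to area measure, of the expected number of zeros of $P_n$. *)

theory Defs
  imports
    "HOL-Probability.Probability"
    "HOL-Complex_Analysis.Complex_Analysis"
    "HOL-Computational_Algebra.Polynomial"
begin

text \<open>Real and imaginary parts form one independent family, so a coefficient has
  \<open>E \<bar>\<eta> j\<bar>\<^sup>2 = 2\<close>.\<close>

definition iid_std_complex_gaussian :: "'w measure \<Rightarrow> (nat \<Rightarrow> 'w \<Rightarrow> complex) \<Rightarrow> bool" where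
  "iid_std_complex_gaussian \<Omega> \<eta> \<longleftrightarrow>
     prob_space \<Omega> \<and>
     prob_space.indep_vars \<Omega> (\<lambda>_. borel)
       (\<lambda>(j, im) \<omega>. if im then Im (\<eta> j \<omega>) else Re (\<eta> j \<omega>)) (UNIV :: (nat \<times> bool) set) \<and>
     (\<forall>j. distributed \<Omega> lborel (\<lambda>\<omega>. Re (\<eta> j \<omega>)) std_normal_density \<and>
          distributed \<Omega> lborel (\<lambda>\<omega>. Im (\<eta> j \<omega>)) std_normal_density)"

definition random_poly :: "(nat \<Rightarrow> 'w \<Rightarrow> complex) \<Rightarrow> (nat \<Rightarrow> complex poly) \<Rightarrow> nat \<Rightarrow> 'w \<Rightarrow> complex poly"
  where "random_poly \<eta> f n \<omega> = (\<Sum>j\<le>n. smult (\<eta> j \<omega>) (f j))"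

definition K00 :: "(nat \<Rightarrow> complex poly) \<Rightarrow> nat \<Rightarrow> complex \<Rightarrow> complex \<Rightarrow> complex" where
  "K00 f n z w = (\<Sum>j\<le>n. poly (f j) z * cnj (poly (f j) w))"

definition K01 :: "(nat \<Rightarrow> complex poly) \<Rightarrow> nat \<Rightarrow> complex \<Rightarrow> complex \<Rightarrow> complex" where
  "K01 f n z w = (\<Sum>j\<le>n. poly (f j) z * cnj (poly (pderiv (f j)) w))"

definition K11 :: "(nat \<Rightarrow> complex poly) \<Rightarrow> nat \<Rightarrow> complex \<Rightarrow> complex \<Rightarrow> complex" where
  "K11 f n z w = (\<Sum>j\<le>n. poly (pderiv (f j)) z * cnj (poly (pderiv (f j)) w))"

text \<open>\<open>K00\<close> and \<open>K11\<close> are real on the diagonal, so taking \<open>Re\<close> there loses nothing.\<close>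

definition intensity :: "(nat \<Rightarrow> complex poly) \<Rightarrow> nat \<Rightarrow> complex \<Rightarrow> real" where
  "intensity f n z =
     (Re (K11 f n z z) * Re (K00 f n z z) - (cmod (K01 f n z z))\<^sup>2) / (pi * (Re (K00 f n z z))\<^sup>2)"

definition topological_support :: "'a::topological_space measure \<Rightarrow> 'a set" where
  "topological_support M = {x. \<forall>U. open U \<and> x \<in> U \<longrightarrow> emeasure M U > 0}"

definition locally_uniform_limit ::
  "complex set \<Rightarrow> (nat \<Rightarrow> complex \<Rightarrow> real) \<Rightarrow> (complex \<Rightarrow> real) \<Rightarrow> bool" where
  "locally_uniform_limit D F L \<longleftrightarrow> (\<forall>C. compact C \<and> C \<subseteq> D \<longrightarrow> uniform_limit C F L sequentially)"

definition OPRL :: "real measure \<Rightarrow> (nat \<Rightarrow> real poly) \<Rightarrow> bool" where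
  "OPRL \<mu> p \<longleftrightarrow>
     sets \<mu> = sets borel \<and> infinite (topological_support \<mu>) \<and>
     (\<forall>k. integrable \<mu> (\<lambda>x. x ^ k)) \<and>
     (\<forall>j. degree (p j) = j \<and> lead_coeff (p j) > 0) \<and>
     (\<forall>m k. (\<integral>x. poly (p m) x * poly (p k) x \<partial>\<mu>) = (if m = k then 1 else 0))"

text \<open>As only \<open>n \<ge> 1\<close> is required, \<open>b 0\<close> stays unconstrained.\<close>

definition OPRL_recurrence :: "(nat \<Rightarrow> real poly) \<Rightarrow> (nat \<Rightarrow> real) \<Rightarrow> (nat \<Rightarrow> real) \<Rightarrow> bool" where
  "OPRL_recurrence p a b \<longleftrightarrow>
     (\<forall>n. a n > 0) \<and>
     (\<forall>n\<ge>1. [:0, 1:] * p n = smult (a n) (p (n + 1)) + smult (b n) (p n) + smult (a (n - 1)) (p (n - 1)))"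

definition OPUC :: "complex measure \<Rightarrow> (nat \<Rightarrow> complex poly) \<Rightarrow> bool" where
  "OPUC \<mu> \<phi> \<longleftrightarrow>
     sets \<mu> = sets borel \<and> prob_space \<mu> \<and> emeasure \<mu> (- sphere 0 1) = 0 \<and>
     infinite (topological_support \<mu>) \<and>
     (\<forall>j. degree (\<phi> j) = j \<and> (\<exists>c>0. lead_coeff (\<phi> j) = complex_of_real c)) \<and>
     (\<forall>m k. (\<integral>z. poly (\<phi> m) z * cnj (poly (\<phi> k) z) \<partial>\<mu>) = (if m = k then 1 else 0))"

text \<open>The value at \<open>z = 0\<close> of \<open>z\<^sup>n cnj (\<phi> (1 / cnj z))\<close> is meant by continuity, so the
  recurrence, an identity between polynomials, is stated for \<open>z \<noteq> 0\<close> only.\<close>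

definition OPUC_recurrence :: "(nat \<Rightarrow> complex poly) \<Rightarrow> (nat \<Rightarrow> complex) \<Rightarrow> bool" where
  "OPUC_recurrence \<phi> \<alpha> \<longleftrightarrow>
     (\<forall>n. cmod (\<alpha> n) < 1) \<and>
     (\<forall>n z. z \<noteq> 0 \<longrightarrow>
        poly (\<phi> (n + 1)) z =
          (z * poly (\<phi> n) z - cnj (\<alpha> n) * (z ^ n * cnj (poly (\<phi> n) (1 / cnj z))))
            / of_real (sqrt (1 - (cmod (\<alpha> n))\<^sup>2)))"

definition sqrt_branch :: "real \<Rightarrow> real \<Rightarrow> (complex \<Rightarrow> complex) \<Rightarrow> bool" where
  "sqrt_branch a b S \<longleftrightarrow>
     S holomorphic_on (- closed_segment (of_real (b - 2 * a)) (of_real (b + 2 * a))) \<and>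
     (\<forall>z. z \<notin> closed_segment (of_real (b - 2 * a)) (of_real (b + 2 * a)) \<longrightarrow>
        (S z)\<^sup>2 = (z - of_real b)\<^sup>2 - 4 * (of_real a)\<^sup>2) \<and>
     S \<sim>[at_infinity] (\<lambda>z. z - of_real b)"

definition OPRL_limit_density :: "real \<Rightarrow> real \<Rightarrow> (complex \<Rightarrow> complex) \<Rightarrow> complex \<Rightarrow> real" where
  "OPRL_limit_density a b S z =
     1 / (4 * pi * (Im z)\<^sup>2)
     - (cmod (z - of_real b + S z))\<^sup>2
       / (4 * pi * cmod ((z - of_real b)\<^sup>2 - 4 * (of_real a)\<^sup>2) * (Im (z + S z))\<^sup>2)"

lemma sqrt_branch_exists:
  assumes "a \<ge> 0"
  shows "\<exists>S. sqrt_branch a b S"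
proof -
  define seg where "seg = closed_segment (complex_of_real (b - 2 * a)) (of_real (b + 2 * a))"
  define S where
    "S = (\<lambda>z. (z - of_real b) * csqrt (1 - 4 * (of_real a)\<^sup>2 / (z - complex_of_real b)\<^sup>2))"
  have mem_seg: "z \<in> seg" if "z - of_real b = of_real t" "\<bar>t\<bar> \<le> 2 * a" for z t
  proof -
    have "z = of_real (b + t)"
      using that(1) by (simp add: algebra_simps)
    moreover have "b + t \<in> closed_segment (b - 2 * a) (b + 2 * a)"
      using that(2) assms by (auto simp: closed_segment_eq_real_ivl)
    ultimately show ?thesis
      unfolding seg_def by (simp only: closed_segment_of_real) (rule imageI)
  qed
  have off: "z - of_real b \<noteq> 0" "1 - 4 * (of_real a)\<^sup>2 / (z - complex_of_real b)\<^sup>2 \<notin> \<real>\<^sub>\<le>\<^sub>0"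
    if "z \<notin> seg" for z
  proof -
    show nz: "z - of_real b \<noteq> 0"
      using mem_seg[of z 0] that assms by auto
    show "1 - 4 * (of_real a)\<^sup>2 / (z - complex_of_real b)\<^sup>2 \<notin> \<real>\<^sub>\<le>\<^sub>0"
    proof
      assume "1 - 4 * (of_real a)\<^sup>2 / (z - complex_of_real b)\<^sup>2 \<in> \<real>\<^sub>\<le>\<^sub>0"
      then obtain r where r: "r \<le> 0" "1 - 4 * (of_real a)\<^sup>2 / (z - complex_of_real b)\<^sup>2 = of_real r"
        by (auto elim!: nonpos_Reals_cases)
      have "4 * (of_real a)\<^sup>2 = (1 - complex_of_real r) * (z - of_real b)\<^sup>2"
        using r(2) nz by (simp add: field_simps)
      moreover have r1: "1 - complex_of_real r \<noteq> 0"
        using r(1) by (metis of_real_1 of_real_eq_iff diff_gt_0_iff_gt eq_iff_diff_eq_0 not_le zero_less_one)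
      ultimately have "(z - of_real b)\<^sup>2 = of_real (4 * a\<^sup>2 / (1 - r))"
        by (simp add: field_simps)
      also have "\<dots> = (of_real (2 * a / sqrt (1 - r)))\<^sup>2"
        using r(1) by (simp flip: of_real_power add: power_divide power_mult_distrib)
      finally have "z - of_real b = of_real (2 * a / sqrt (1 - r)) \<or>
                    z - of_real b = of_real (- (2 * a / sqrt (1 - r)))"
        by (simp add: power2_eq_iff)
      moreover have "2 * a / sqrt (1 - r) \<le> 2 * a" "2 * a / sqrt (1 - r) \<ge> 0"
        using r(1) assms by (simp_all add: divide_le_eq mult_le_cancel_left1)
      ultimately show False
        using mem_seg that assms by (smt (verit))
    qed
  qed
  have "S holomorphic_on (- seg)"
    unfolding S_def by (intro holomorphic_intros) (use off in auto)
  moreover have "(S z)\<^sup>2 = (z - of_real b)\<^sup>2 - 4 * (of_real a)\<^sup>2" if "z \<notin> seg" for z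
    using off(1)[OF that] unfolding S_def power_mult_distrib power2_csqrt right_diff_distrib by simp
  moreover have "S \<sim>[at_infinity] (\<lambda>z. z - of_real b)"
  proof (rule asymp_equivI')
    have "poly ([:- complex_of_real b, 1:] ^ 2) = (\<lambda>z. (z - of_real b)\<^sup>2)"
      by (simp add: fun_eq_iff)
    hence lim: "filterlim (\<lambda>z. (z - complex_of_real b)\<^sup>2) at_infinity at_infinity"
      using filterlim_poly_at_infinity[of "[:- complex_of_real b, 1:] ^ 2"]
      by (simp add: degree_power_eq)
    have "((\<lambda>z. 4 * (of_real a)\<^sup>2 / (z - complex_of_real b)\<^sup>2) \<longlongrightarrow> 0) at_infinity"
      by (rule tendsto_divide_0[OF tendsto_const lim])
    hence "((\<lambda>z. 1 - 4 * (of_real a)\<^sup>2 / (z - complex_of_real b)\<^sup>2) \<longlongrightarrow> 1) at_infinity"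
      using tendsto_diff[OF tendsto_const] by fastforce
    hence "((\<lambda>z. csqrt (1 - 4 * (of_real a)\<^sup>2 / (z - complex_of_real b)\<^sup>2)) \<longlongrightarrow> csqrt 1) at_infinity"
      by (intro isCont_tendsto_compose[OF continuous_at_csqrt]) auto
    moreover have "\<forall>\<^sub>F z in at_infinity.
        csqrt (1 - 4 * (of_real a)\<^sup>2 / (z - complex_of_real b)\<^sup>2) = S z / (z - of_real b)"
      unfolding S_def by (rule eventually_mono[OF eventually_not_equal_at_infinity[of "of_real b"]]) auto
    ultimately show "((\<lambda>z. S z / (z - of_real b)) \<longlongrightarrow> 1) at_infinity"
      by (simp add: tendsto_cong)
  qed
  ultimately show ?thesis
    unfolding sqrt_branch_def seg_def by blast
qed

end

theory Submission
  imports Defs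
begin

text \<open>The intensity is \<open>1 / \<pi>\<close> times the mixed derivative of \<open>log K(z, z)\<close>, so the
  Christoffel--Darboux formulas express it through the ratios \<open>R = a\<^sub>n p\<^sub>n\<^sub>+\<^sub>1 / p\<^sub>n\<close> and
  \<open>\<phi>\<^sub>n / \<phi>\<^sub>n\<^sup>*\<close>: it equals \<open>1 / (4 \<pi> (Im z)\<^sup>2) - \<bar>R'\<bar>\<^sup>2 / (4 \<pi> (Im R)\<^sup>2)\<close> off the real line,
  and \<open>1 / (\<pi> (1 - \<bar>z\<bar>\<^sup>2)\<^sup>2) - \<bar>s'\<bar>\<^sup>2 / (\<pi> (1 - \<bar>s\<bar>\<^sup>2)\<^sup>2)\<close> off the unit circle, where \<open>s\<close> is the ratio
  inside the disk and its inverse outside. The three-term and Szego recurrences make these ratios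
  orbits of asymptotically autonomous Moebius contractions, which gives their limits.

  On the real line off the support the orthogonal polynomials may vanish and the formula degenerates.
  There, boundedness below of multiplication by \<open>x - z\<close> on \<open>L\<^sup>2(\<mu>)\<close> shows that the kernel vectors
  \<open>(p\<^sub>0(z), \<dots>, p\<^sub>n(z))\<close> turn slowly with \<open>z\<close>, uniformly in \<open>n\<close>. By Cauchy's estimates the intensities are
  then locally equi-Lipschitz, and convergence at nonreal points extends locally uniformly across
  the real line.\<close>

section \<open>Recurrences and vector-valued Cauchy estimates\<close>

text \<open>Multiplying all polynomials by one nonvanishing holomorphic function h adds the harmonic
  term log |h|^2 to log K(z, z), so the intensity does not change. This freedom makes bounds uniform
  in n possible, although K(z, z) itself need not stay bounded. The normalization by z |-> K(z, x)
  is under control as long as the kernel vectors at z and x stay away from a right angle. In gaps of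
  the support p_n may vanish and R may have poles, so the angle estimate never divides by p_n: it
  uses the pair (p_n, p_{n+1}), whose squared length dominates a fixed multiple of K_n(z, z).

  On the line the Lipschitz bound covers nonreal points too, so pointwise limits of R and R'
  suffice; the recursion for R' comes from differentiating the three-term recurrence, with no
  exchange of limit and derivative. Both terms of the limit density blow up at the real axis, so its
  continuous extension is found as the limit of the intensities instead of by expanding the formula.
  On the circle the contraction is uniform on compact sets, and Cauchy's estimate then supplies the
  derivative.\<close>

lemma uniform_contraction:
  fixes y :: "nat \<Rightarrow> 'a \<Rightarrow> real"
  assumes q: "0 \<le> q" "q < 1"
    and e: "e \<longlonglongrightarrow> 0"
    and step: "\<forall>\<^sub>F n in sequentially. \<forall>z\<in>C. y (Suc n) z \<le> q * y n z + e n"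
    and nonneg: "\<And>n z. z \<in> C \<Longrightarrow> 0 \<le> y n z"
    and bdd: "\<And>n. \<exists>B. \<forall>z\<in>C. y n z \<le> B"
  shows "uniform_limit C y (\<lambda>_. 0) sequentially"
proof (rule uniform_limitI)
  fix \<epsilon> :: real assume \<epsilon>: "0 < \<epsilon>"
  \<comment> \<open>The threshold makes \<epsilon> / 2 the fixed point of x |-> q x + \<epsilon> / 2
    * (1 - q), so iterating from \<open>N\<close> leaves \<epsilon> / 2 plus the transient q^k
    B.\<close>
  have "\<forall>\<^sub>F n in sequentially. \<bar>e n\<bar> < \<epsilon> / 2 * (1 - q)"
    using tendstoD[OF e, of "\<epsilon> / 2 * (1 - q)"] \<epsilon> q by simp
  with step have "\<forall>\<^sub>F n in sequentially.
      \<forall>z\<in>C. y (Suc n) z \<le> q * y n z + \<epsilon> / 2 * (1 - q)"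
    by eventually_elim (force simp: abs_less_iff)
  then obtain N where N: "\<And>n z. n \<ge> N \<Longrightarrow> z \<in> C \<Longrightarrow> y (Suc n) z \<le> q * y n z + \<epsilon> / 2 * (1 - q)"
    unfolding eventually_sequentially by blast
  obtain B where B: "\<And>z. z \<in> C \<Longrightarrow> y N z \<le> B"
    using bdd by blast
  have bound: "y (N + k) z \<le> q ^ k * B + \<epsilon> / 2" if z: "z \<in> C" for k z
  proof (induction k)
    case 0
    then show ?case using B[OF z] \<epsilon> by simp
  next
    case (Suc k)
    have "y (N + Suc k) z \<le> q * y (N + k) z + \<epsilon> / 2 * (1 - q)"
      using N[of "N + k" z] z by simp
    also have "\<dots> \<le> q * (q ^ k * B + \<epsilon> / 2) + \<epsilon> / 2 * (1 - q)"
      using Suc q by (simp add: mult_left_mono)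
    also have "\<dots> = q ^ Suc k * B + \<epsilon> / 2"
      by (simp add: field_simps)
    finally show ?case .
  qed
  have "(\<lambda>k. q ^ k * B) \<longlonglongrightarrow> 0 * B"
    using q by (intro tendsto_intros LIMSEQ_power_zero) auto
  hence "\<forall>\<^sub>F k in sequentially. dist (q ^ k * B) 0 < \<epsilon> / 2"
    using \<epsilon> by (intro tendstoD) auto
  then obtain K where K: "\<And>k. k \<ge> K \<Longrightarrow> \<bar>q ^ k * B\<bar> < \<epsilon> / 2"
    unfolding eventually_sequentially by (auto simp: dist_real_def)
  show "\<forall>\<^sub>F n in sequentially. \<forall>z\<in>C. dist (y n z) 0 < \<epsilon>"
    unfolding eventually_sequentially
  proof (intro exI[of _ "N + K"] allI impI ballI)
    fix n z assume n: "n \<ge> N + K" and z: "z \<in> C"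
    have "y n z \<le> q ^ (n - N) * B + \<epsilon> / 2"
      using bound[OF z, of "n - N"] n by simp
    moreover have nK: "K \<le> n - N"
      using n by simp
    ultimately show "dist (y n z) 0 < \<epsilon>"
      using K[OF nK] nonneg[OF z, of n] by (simp add: dist_real_def abs_less_iff)
  qed
qed

text \<open>The candidate limit is the fixed point of the limiting affine map. The distance to it
  contracts eventually by any factor strictly between \<open>cmod c0\<close> and 1, for which the
  midpoint \<open>q\<close> is taken, up to an error tending to 0.\<close>

lemma linear_recurrence_tendsto:
  fixes x c d :: "nat \<Rightarrow> complex"
  assumes step: "\<forall>\<^sub>F n in sequentially. x (Suc n) = c n * x n + d n"
    and c: "c \<longlonglongrightarrow> c0" and d: "d \<longlonglongrightarrow> d0" and c0: "cmod c0 < 1"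
  shows "x \<longlonglongrightarrow> d0 / (1 - c0)"
proof -
  define l where "l = d0 / (1 - c0)"
  have "1 - c0 \<noteq> 0"
    using c0 by auto
  hence l: "l = c0 * l + d0"
    unfolding l_def by (simp add: field_simps)
  define q where "q = (1 + cmod c0) / 2"
  have q: "0 \<le> q" "q < 1" "cmod c0 < q"
    using c0 unfolding q_def by (auto intro: add_nonneg_nonneg)
  have "\<forall>\<^sub>F n in sequentially. cmod (c n) < q"
    using order_tendstoD(2)[OF tendsto_norm[OF c] q(3)] .
  with step have "\<forall>\<^sub>F n in sequentially.
      \<forall>z\<in>{()}. cmod (x (Suc n) - l) \<le> q * cmod (x n - l) + cmod (c n * l + d n - l)"
  proof eventually_elim
    case (elim n)
    have "x (Suc n) - l = c n * (x n - l) + (c n * l + d n - l)"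
      using elim(1) by (simp add: algebra_simps)
    hence "cmod (x (Suc n) - l) \<le> cmod (c n) * cmod (x n - l) + cmod (c n * l + d n - l)"
      by (metis norm_mult norm_triangle_ineq)
    also have "\<dots> \<le> q * cmod (x n - l) + cmod (c n * l + d n - l)"
      using elim(2) by (simp add: mult_right_mono)
    finally show ?case by simp
  qed
  moreover have "(\<lambda>n. cmod (c n * l + d n - l)) \<longlonglongrightarrow> cmod (c0 * l + d0 - l)"
    by (intro tendsto_intros c d)
  hence "(\<lambda>n. cmod (c n * l + d n - l)) \<longlonglongrightarrow> 0"
    using l by simp
  \<comment> \<open>The pointwise statement is the uniform one over a one-point set.\<close>
  ultimately have "uniform_limit {()} (\<lambda>n _. cmod (x n - l)) (\<lambda>_. 0) sequentially"
    using q by (intro uniform_contraction) auto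
  hence "(\<lambda>n. cmod (x n - l)) \<longlonglongrightarrow> 0"
    by (rule tendsto_uniform_limitI) simp
  thus ?thesis
    unfolding l_def[symmetric] using LIM_zero_cancel tendsto_norm_zero_iff by blast
qed

lemma L2_set_norm_power2: "(L2_set (\<lambda>j. norm (g j)) I)\<^sup>2 = (\<Sum>j\<in>I. (norm (g j))\<^sup>2)"
  unfolding L2_set_def by (simp add: sum_nonneg)

lemma norm_sum_mult_le_L2_set:
  fixes g k :: "'a \<Rightarrow> complex"
  shows "cmod (\<Sum>j\<in>I. g j * k j) \<le> L2_set (\<lambda>j. cmod (g j)) I * L2_set (\<lambda>j. cmod (k j)) I"
proof -
  have "cmod (\<Sum>j\<in>I. g j * k j) \<le> (\<Sum>j\<in>I. \<bar>cmod (g j)\<bar> * \<bar>cmod (k j)\<bar>)"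
    by (rule order_trans[OF norm_sum]) (simp add: norm_mult)
  also have "\<dots> \<le> L2_set (\<lambda>j. cmod (g j)) I * L2_set (\<lambda>j. cmod (k j)) I"
    by (rule L2_set_mult_ineq)
  finally show ?thesis .
qed

lemma sum_cnj_self: "(\<Sum>j\<in>I. cnj (g j) * g j) = of_real ((L2_set (\<lambda>j. cmod (g j)) I)\<^sup>2)"
  by (simp add: L2_set_norm_power2 complex_norm_square mult.commute del: of_real_power)

lemma norm_deriv_le_ball:
  assumes "h holomorphic_on ball x r" "\<And>w. w \<in> ball x r \<Longrightarrow> cmod (h w) \<le> B"
    and "0 < s" "cball z s \<subseteq> ball x r"
  shows "cmod (deriv h z) \<le> B / s"
proof -
  have "cmod ((deriv ^^ 1) h z) \<le> fact 1 * B / s ^ 1"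
  proof (rule Cauchy_inequality)
    show "h holomorphic_on ball z s"
      by (rule holomorphic_on_subset[OF assms(1)]) (use assms(4) in force)
    show "continuous_on (cball z s) h"
      using holomorphic_on_imp_continuous_on[OF assms(1)] continuous_on_subset assms(4) by blast
    show "cmod (h w) \<le> B" if "cmod (z - w) = s" for w
      using that assms(4) by (intro assms(2)) (auto simp: dist_norm)
  qed fact
  thus ?thesis by simp
qed

lemma cball_subset_ball_half:
  fixes x :: "'a::metric_space"
  assumes "z \<in> ball x (r / 2)"
  shows "cball z (r / 2) \<subseteq> ball x r"
proof
  fix w assume "w \<in> cball z (r / 2)"
  thus "w \<in> ball x r"
    using assms dist_triangle[of x w z] by auto
qed

text \<open>Pairing the family with the conjugates of its derivatives at \<open>z\<close> reduces the
  vector-valued Cauchy estimate to the scalar one.\<close>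

lemma L2_set_deriv_le:
  assumes hol: "\<And>j. j \<in> I \<Longrightarrow> g j holomorphic_on ball x r"
    and bd: "\<And>w. w \<in> ball x r \<Longrightarrow> L2_set (\<lambda>j. cmod (g j w)) I \<le> M"
    and r: "0 < r" and z: "z \<in> ball x (r / 2)"
  shows "L2_set (\<lambda>j. cmod (deriv (g j) z)) I \<le> 2 * M / r"
proof -
  define X where "X = L2_set (\<lambda>j. cmod (deriv (g j) z)) I"
  define h where "h = (\<lambda>w. \<Sum>j\<in>I. cnj (deriv (g j) z) * g j w)"
  have X0: "X \<ge> 0"
    unfolding X_def by simp
  have zx: "z \<in> ball x r"
    using z r by auto
  have "h holomorphic_on ball x r"
    unfolding h_def by (intro holomorphic_intros hol)
  moreover have "cmod (h w) \<le> X * M" if "w \<in> ball x r" for w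
  proof -
    have "cmod (h w) \<le> L2_set (\<lambda>j. cmod (cnj (deriv (g j) z))) I * L2_set (\<lambda>j. cmod (g j w)) I"
      unfolding h_def by (rule norm_sum_mult_le_L2_set)
    also have "\<dots> \<le> X * M"
      unfolding X_def using bd[OF that] by (simp add: mult_left_mono)
    finally show ?thesis .
  qed
  ultimately have "cmod (deriv h z) \<le> X * M / (r / 2)"
    using r cball_subset_ball_half[OF z] by (intro norm_deriv_le_ball) auto
  moreover have "(h has_field_derivative (\<Sum>j\<in>I. cnj (deriv (g j) z) * deriv (g j) z)) (at z)"
    unfolding h_def
    by (intro DERIV_sum DERIV_cmult holomorphic_derivI[OF hol] zx) auto
  hence "deriv h z = of_real (X\<^sup>2)"
    unfolding sum_cnj_self X_def by (rule DERIV_imp_deriv)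
  ultimately have "X\<^sup>2 \<le> X * M / (r / 2)"
    by (simp del: of_real_power)
  hence "X * X \<le> X * (2 * M / r)"
    by (simp add: power2_eq_square algebra_simps)
  moreover have "0 \<le> M"
    using bd[OF zx] by (meson L2_set_nonneg order_trans)
  ultimately have "X \<le> 2 * M / r"
    using X0 r mult_left_le_imp_le[of X X "2 * M / r"] by (cases "X = 0") (simp, linarith)
  thus ?thesis unfolding X_def .
qed

text \<open>A mean value inequality for vectors, again by duality: pairing with the fixed vector of
  conjugated differences gives a scalar function whose increment from \<open>z\<close> to
  \<open>y\<close> is exactly X^2, while its derivative is at most X times the bound on the
  derivative vector.\<close>

lemma L2_set_diff_le:
  assumes hol: "\<And>j. j \<in> I \<Longrightarrow> g j holomorphic_on ball x r"
    and bd: "\<And>w. w \<in> ball x r \<Longrightarrow> L2_set (\<lambda>j. cmod (g j w)) I \<le> M"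
    and r: "0 < r" and z: "z \<in> ball x (r / 2)" and y: "y \<in> ball x (r / 2)"
  shows "L2_set (\<lambda>j. cmod (g j y - g j z)) I \<le> 2 * M / r * cmod (y - z)"
proof -
  define X where "X = L2_set (\<lambda>j. cmod (g j y - g j z)) I"
  define h where "h = (\<lambda>w. \<Sum>j\<in>I. cnj (g j y - g j z) * g j w)"
  define h' where "h' = (\<lambda>w. \<Sum>j\<in>I. cnj (g j y - g j z) * deriv (g j) w)"
  have X0: "X \<ge> 0"
    unfolding X_def by simp
  have "cmod (h y - h z) \<le> X * (2 * M / r) * cmod (y - z)"
  proof (rule field_differentiable_bound[of "ball x (r / 2)" h h'])
    fix w assume w: "w \<in> ball x (r / 2)"
    hence wx: "w \<in> ball x r"
      using r by auto
    show "(h has_field_derivative h' w) (at w within ball x (r / 2))"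
      unfolding h_def h'_def
      by (intro has_field_derivative_at_within[OF DERIV_sum] DERIV_cmult holomorphic_derivI[OF hol] wx) auto
    have "cmod (h' w) \<le> L2_set (\<lambda>j. cmod (cnj (g j y - g j z))) I * L2_set (\<lambda>j. cmod (deriv (g j) w)) I"
      unfolding h'_def by (rule norm_sum_mult_le_L2_set)
    also have "\<dots> \<le> X * (2 * M / r)"
      unfolding X_def complex_mod_cnj by (intro mult_left_mono L2_set_deriv_le[OF hol bd r w]) auto
    finally show "cmod (h' w) \<le> X * (2 * M / r)" .
  qed (use y z in auto)
  moreover have "h y - h z = (\<Sum>j\<in>I. cnj (g j y - g j z) * (g j y - g j z))"
    unfolding h_def right_diff_distrib sum_subtractf by simp
  hence "h y - h z = of_real (X\<^sup>2)"
    unfolding sum_cnj_self X_def .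
  ultimately have "X\<^sup>2 \<le> X * (2 * M / r) * cmod (y - z)"
    by (simp del: of_real_power)
  hence "X * X \<le> X * (2 * M / r * cmod (y - z))"
    by (simp add: power2_eq_square algebra_simps)
  moreover have "x \<in> ball x r"
    using r by simp
  hence "0 \<le> M"
    using bd by (meson L2_set_nonneg order_trans)
  ultimately have "X \<le> 2 * M / r * cmod (y - z)"
    using X0 r mult_left_le_imp_le[of X X "2 * M / r * cmod (y - z)"] by (cases "X = 0") (simp, linarith)
  thus ?thesis unfolding X_def .
qed

lemma norm_hermitian_sum_diff_le:
  fixes g k :: "nat \<Rightarrow> complex \<Rightarrow> complex"
  assumes g: "L2_set (\<lambda>j. cmod (g j y - g j z)) I \<le> L * d" "L2_set (\<lambda>j. cmod (g j z)) I \<le> A"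
    and k: "L2_set (\<lambda>j. cmod (k j y - k j z)) I \<le> L' * d" "L2_set (\<lambda>j. cmod (k j y)) I \<le> B"
    and nonneg: "0 \<le> A" "0 \<le> B" "0 \<le> L * d" "0 \<le> L' * d"
  shows "cmod ((\<Sum>j\<in>I. g j y * cnj (k j y)) - (\<Sum>j\<in>I. g j z * cnj (k j z))) \<le> (L * B + A * L') * d"
proof -
  have "(\<Sum>j\<in>I. g j y * cnj (k j y)) - (\<Sum>j\<in>I. g j z * cnj (k j z)) =
        (\<Sum>j\<in>I. (g j y - g j z) * cnj (k j y)) + (\<Sum>j\<in>I. g j z * cnj (k j y - k j z))"
    by (simp add: sum_subtractf algebra_simps)
  also have "cmod \<dots> \<le> cmod (\<Sum>j\<in>I. (g j y - g j z) * cnj (k j y)) + cmod (\<Sum>j\<in>I. g j z * cnj (k j y - k j z))"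
    by (rule norm_triangle_ineq)
  also have "\<dots> \<le> (L * d) * B + A * (L' * d)"
    by (intro add_mono order_trans[OF norm_sum_mult_le_L2_set] mult_mono)
       (use assms in \<open>auto simp flip: complex_cnj_diff simp del: complex_cnj_diff\<close>)
  also have "\<dots> = (L * B + A * L') * d"
    by (simp add: algebra_simps)
  finally show ?thesis .
qed

lemma norm_mult_diff_le:
  fixes u v :: "'a::real_normed_algebra"
  assumes "norm u \<le> A" "norm v' \<le> B" "norm (u - u') \<le> L" "norm (v - v') \<le> L'"
  shows "norm (u * v - u' * v') \<le> A * L' + L * B"
proof -
  have "u * v - u' * v' = u * (v - v') + (u - u') * v'"
    by (simp add: algebra_simps)
  also have "norm \<dots> \<le> norm u * norm (v - v') + norm (u - u') * norm v'"
    by (meson norm_triangle_ineq norm_mult_ineq add_mono order_trans)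
  also have "\<dots> \<le> A * L' + L * B"
    by (intro add_mono mult_mono) (use assms in \<open>auto intro: order_trans[OF norm_ge_zero]\<close>)
  finally show ?thesis .
qed

section \<open>Kernels and intensities\<close>

lemma K00_diag: "K00 f n z z = of_real (\<Sum>j\<le>n. (cmod (poly (f j) z))\<^sup>2)"
  unfolding K00_def of_real_sum complex_norm_square ..

lemma K11_diag: "K11 f n z z = of_real (\<Sum>j\<le>n. (cmod (poly (pderiv (f j)) z))\<^sup>2)"
  unfolding K11_def of_real_sum complex_norm_square ..

lemma of_real_Re_K00: "of_real (Re (K00 f n z z)) = K00 f n z z"
  and of_real_Re_K11: "of_real (Re (K11 f n z z)) = K11 f n z z"
  by (simp_all add: K00_diag K11_diag)

lemma K00_cnj: "cnj (K00 f n z w) = K00 f n w z"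
  unfolding K00_def by (simp add: mult.commute)

text \<open>Differentiating the Christoffel--Darboux type formula \<open>CD\<close> in \<open>z\<close> and in \<open>cnj w\<close>, then
  setting \<open>w = z\<close>, is the computation of the mixed derivative of \<open>log K(z, w)\<close> cleared of denominators;
  the factor of \<open>D\<^sup>2\<close> is the Gram determinant in the numerator of the intensity.\<close>

lemma gram_determinant_of_CD:
  fixes A B C E :: "complex poly" and z :: complex
  assumes CD: "\<And>z w. (d0 + d1 * z + d2 * cnj w + d3 * z * cnj w) * K00 f n z w =
                 poly A z * cnj (poly C w) - poly B z * cnj (poly E w)"
  defines "D \<equiv> d0 + d1 * z + d2 * cnj z + d3 * z * cnj z"
  shows "D\<^sup>2 * (K11 f n z z * K00 f n z z - of_real ((cmod (K01 f n z z))\<^sup>2))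
           + (K00 f n z z)\<^sup>2 * (D * d3 - (d1 + d3 * cnj z) * (d2 + d3 * z)) =
         poly (pderiv A * B - A * pderiv B) z * cnj (poly (C * pderiv E - pderiv C * E) z)"
proof -
  define K10 where "K10 = (\<lambda>z w. \<Sum>j\<le>n. poly (pderiv (f j)) z * cnj (poly (f j) w))"
  have dK00: "((\<lambda>z. K00 f n z w) has_field_derivative K10 z w) (at z)" for z w
    unfolding K00_def K10_def by (intro DERIV_sum DERIV_cmult_right poly_DERIV)
  have dK01: "((\<lambda>z. K01 f n z w) has_field_derivative K11 f n z w) (at z)" for z w
    unfolding K01_def K11_def by (intro DERIV_sum DERIV_cmult_right poly_DERIV)
  have dz: "(d1 + d3 * cnj w) * K00 f n z w + (d0 + d1 * z + d2 * cnj w + d3 * z * cnj w) * K10 z w =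
      poly (pderiv A) z * cnj (poly C w) - poly (pderiv B) z * cnj (poly E w)" for z w
  proof (rule DERIV_unique)
    show "((\<lambda>z. (d0 + d1 * z + d2 * cnj w + d3 * z * cnj w) * K00 f n z w) has_field_derivative
       (d1 + d3 * cnj w) * K00 f n z w + (d0 + d1 * z + d2 * cnj w + d3 * z * cnj w) * K10 z w) (at z)"
      by (auto intro!: derivative_eq_intros dK00 simp: algebra_simps)
    show "((\<lambda>z. (d0 + d1 * z + d2 * cnj w + d3 * z * cnj w) * K00 f n z w) has_field_derivative
       poly (pderiv A) z * cnj (poly C w) - poly (pderiv B) z * cnj (poly E w)) (at z)"
      unfolding CD by (intro DERIV_diff DERIV_cmult_right poly_DERIV)
  qed
  \<comment> \<open>The formula is antiholomorphic in w. Conjugating it and exchanging z and w turns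
    differentiation in \<open>cnj w\<close> into an ordinary complex derivative, which is conjugated
    back in \<open>dw\<close>.\<close>
  have CD': "(cnj d0 + cnj d2 * z + cnj d1 * cnj w + cnj d3 * z * cnj w) * K00 f n z w =
      poly C z * cnj (poly A w) - poly E z * cnj (poly B w)" for z w
    using arg_cong[OF CD[of w z], of cnj] by (simp add: K00_cnj algebra_simps)
  have dw_cnj: "(cnj d2 + cnj d3 * cnj w) * K00 f n z w
      + (cnj d0 + cnj d2 * z + cnj d1 * cnj w + cnj d3 * z * cnj w) * K10 z w =
      poly (pderiv C) z * cnj (poly A w) - poly (pderiv E) z * cnj (poly B w)" for z w
  proof (rule DERIV_unique)
    show "((\<lambda>z. (cnj d0 + cnj d2 * z + cnj d1 * cnj w + cnj d3 * z * cnj w) * K00 f n z w)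
       has_field_derivative (cnj d2 + cnj d3 * cnj w) * K00 f n z w
      + (cnj d0 + cnj d2 * z + cnj d1 * cnj w + cnj d3 * z * cnj w) * K10 z w) (at z)"
      by (auto intro!: derivative_eq_intros dK00 simp: algebra_simps)
    show "((\<lambda>z. (cnj d0 + cnj d2 * z + cnj d1 * cnj w + cnj d3 * z * cnj w) * K00 f n z w)
       has_field_derivative
       poly (pderiv C) z * cnj (poly A w) - poly (pderiv E) z * cnj (poly B w)) (at z)"
      unfolding CD' by (intro DERIV_diff DERIV_cmult_right poly_DERIV)
  qed
  have K10_cnj: "cnj (K10 w z) = K01 f n z w" for z w
    unfolding K10_def K01_def by (simp add: mult.commute)
  have dw: "(d2 + d3 * z) * K00 f n z w + (d0 + d1 * z + d2 * cnj w + d3 * z * cnj w) * K01 f n z w =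
      poly A z * cnj (poly (pderiv C) w) - poly B z * cnj (poly (pderiv E) w)" for z w
    using arg_cong[OF dw_cnj[of z w], of cnj] by (simp add: K00_cnj K10_cnj algebra_simps)
  have dzdw: "d3 * K00 f n z w + (d2 + d3 * z) * K10 z w + (d1 + d3 * cnj w) * K01 f n z w
      + (d0 + d1 * z + d2 * cnj w + d3 * z * cnj w) * K11 f n z w =
      poly (pderiv A) z * cnj (poly (pderiv C) w) - poly (pderiv B) z * cnj (poly (pderiv E) w)" for z w
  proof (rule DERIV_unique)
    show "((\<lambda>z. (d2 + d3 * z) * K00 f n z w + (d0 + d1 * z + d2 * cnj w + d3 * z * cnj w) * K01 f n z w)
       has_field_derivative
       d3 * K00 f n z w + (d2 + d3 * z) * K10 z w + (d1 + d3 * cnj w) * K01 f n z w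
      + (d0 + d1 * z + d2 * cnj w + d3 * z * cnj w) * K11 f n z w) (at z)"
      by (auto intro!: derivative_eq_intros dK00 dK01 simp: algebra_simps)
    show "((\<lambda>z. (d2 + d3 * z) * K00 f n z w + (d0 + d1 * z + d2 * cnj w + d3 * z * cnj w) * K01 f n z w)
       has_field_derivative
       poly (pderiv A) z * cnj (poly (pderiv C) w) - poly (pderiv B) z * cnj (poly (pderiv E) w)) (at z)"
      unfolding dw by (intro DERIV_diff DERIV_cmult_right poly_DERIV)
  qed
  have K10_K01: "of_real ((cmod (K01 f n z z))\<^sup>2) = K01 f n z z * K10 z z"
    using complex_norm_square[of "K01 f n z z"] K10_cnj[of z z] by (metis complex_cnj_cnj of_real_power)
  \<comment> \<open>With H = D K this is H^2 times the identity "mixed derivative of log H = that of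
    log D plus that of log K". Evaluating the same expression for H = A cnj C - B cnj E leaves a
    product of two Wronskians.\<close>
  have "D\<^sup>2 * (K11 f n z z * K00 f n z z - K01 f n z z * K10 z z)
          + (K00 f n z z)\<^sup>2 * (D * d3 - (d1 + d3 * cnj z) * (d2 + d3 * z)) =
        (D * K00 f n z z) * (d3 * K00 f n z z + (d2 + d3 * z) * K10 z z
            + (d1 + d3 * cnj z) * K01 f n z z + D * K11 f n z z)
        - ((d1 + d3 * cnj z) * K00 f n z z + D * K10 z z) * ((d2 + d3 * z) * K00 f n z z + D * K01 f n z z)"
    by (simp add: power2_eq_square algebra_simps)
  also have "\<dots> = poly (pderiv A * B - A * pderiv B) z * cnj (poly (C * pderiv E - pderiv C * E) z)"
    unfolding D_def CD dz dw dzdw by (simp add: algebra_simps)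
  finally show ?thesis
    unfolding K10_K01 .
qed

text \<open>With h' read as the derivative of h, the product rule gives (h q)' = h' q + h q'. The
  term h' q is parallel to h q, so it drops out of the Gram determinant of h q and (h q)'; what
  remains scales by |h|^4.\<close>

lemma gram_determinant_scaling:
  fixes h h' :: complex and q q' :: "'a \<Rightarrow> complex" and I :: "'a set"
  defines "N \<equiv> \<Sum>j\<in>I. (cmod (q j))\<^sup>2" and "Q \<equiv> \<Sum>j\<in>I. (cmod (q' j))\<^sup>2"
    and "T \<equiv> \<Sum>j\<in>I. q j * cnj (q' j)"
  shows "(\<Sum>j\<in>I. (cmod (h' * q j + h * q' j))\<^sup>2) * (\<Sum>j\<in>I. (cmod (h * q j))\<^sup>2)
           - (cmod (\<Sum>j\<in>I. h * q j * cnj (h' * q j + h * q' j)))\<^sup>2 =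
         ((cmod h)\<^sup>2)\<^sup>2 * (Q * N - (cmod T)\<^sup>2)" (is "?lhs = ?rhs")
proof -
  have N: "complex_of_real N = (\<Sum>j\<in>I. q j * cnj (q j))"
    and Q: "complex_of_real Q = (\<Sum>j\<in>I. q' j * cnj (q' j))"
    unfolding N_def Q_def of_real_sum complex_norm_square by simp_all
  have T: "cnj T = (\<Sum>j\<in>I. q' j * cnj (q j))"
    unfolding T_def by (simp add: mult.commute)
  have K11: "complex_of_real (\<Sum>j\<in>I. (cmod (h' * q j + h * q' j))\<^sup>2) =
      h' * cnj h' * N + h * cnj h * Q + h' * cnj h * T + h * cnj h' * cnj T"
    unfolding T N Q of_real_sum complex_norm_square unfolding T_def
    by (simp add: sum_distrib_left sum.distrib algebra_simps)
  have K00: "complex_of_real (\<Sum>j\<in>I. (cmod (h * q j))\<^sup>2) = h * cnj h * N"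
    unfolding N of_real_sum complex_norm_square by (simp add: sum_distrib_left algebra_simps)
  have K01: "(\<Sum>j\<in>I. h * q j * cnj (h' * q j + h * q' j)) = h * cnj h' * N + h * cnj h * T"
    unfolding N T_def by (simp add: sum_distrib_left sum.distrib algebra_simps)
  have "complex_of_real ?lhs = complex_of_real ?rhs"
    unfolding of_real_diff of_real_mult K11 K00 K01 complex_norm_square of_real_power[of _ 2]
    by (simp add: power2_eq_square algebra_simps complex_norm_square[unfolded power2_eq_square of_real_mult])
  thus ?thesis
    unfolding of_real_eq_iff .
qed

lemma L2_set_norm_le_iff:
  "0 \<le> M \<Longrightarrow> L2_set (\<lambda>j. norm (g j)) I \<le> M \<longleftrightarrow> (\<Sum>j\<in>I. (norm (g j))\<^sup>2) \<le> M\<^sup>2"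
  unfolding L2_set_norm_power2[symmetric] by (simp add: power2_le_iff_abs_le)

lemma Re_K00: "Re (K00 f n z z) = (L2_set (\<lambda>j. cmod (poly (f j) z)) {..n})\<^sup>2"
  by (simp add: K00_diag L2_set_norm_power2)

lemma norm_K00_le: "(cmod (K00 f n z w))\<^sup>2 \<le> Re (K00 f n z z) * Re (K00 f n w w)"
proof -
  have "cmod (K00 f n z w) \<le> L2_set (\<lambda>j. cmod (poly (f j) z)) {..n} * L2_set (\<lambda>j. cmod (poly (f j) w)) {..n}"
    unfolding K00_def using norm_sum_mult_le_L2_set[of "\<lambda>j. poly (f j) z" "\<lambda>j. cnj (poly (f j) w)"] by simp
  hence "(cmod (K00 f n z w))\<^sup>2 \<le> (L2_set (\<lambda>j. cmod (poly (f j) z)) {..n} * L2_set (\<lambda>j. cmod (poly (f j) w)) {..n})\<^sup>2"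
    by (rule power_mono) simp
  thus ?thesis
    by (simp add: Re_K00 power_mult_distrib)
qed

text \<open>Dividing the polynomials by the holomorphic function
  \<open>K(\<cdot>, x) / sqrt (K(x, x))\<close> leaves the intensity unchanged, and the hypothesis makes the
  resulting vector of holomorphic functions bounded above and below independently of \<open>n\<close>.\<close>

lemma intensity_lipschitz:
  fixes x :: complex and r c :: real
  assumes r: "0 < r" and c: "0 < c"
  shows "\<exists>M. \<forall>f n. (\<forall>z\<in>ball x r. Re (K00 f n z z) > 0 \<and>
             c * Re (K00 f n x x) * Re (K00 f n z z) \<le> (cmod (K00 f n z x))\<^sup>2) \<longrightarrow>
           (\<forall>y\<in>ball x (r / 4). \<forall>z\<in>ball x (r / 4).
              \<bar>intensity f n y - intensity f n z\<bar> \<le> M * dist y z)"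
proof -
  \<comment> \<open>\<open>M\<close>, \<open>M1\<close> and \<open>M2\<close> are the bounds for the
    normalized vector, for its derivative, and for the Lipschitz constant of that derivative. Each
    application of Cauchy's estimate halves the radius, from r to r / 2 to r / 4. \<open>LN\<close>,
    \<open>LT\<close> and \<open>LQ\<close> are the resulting Lipschitz constants of the three
    Hermitian sums.\<close>
  define M where "M = sqrt (1 / c)"
  define M1 where "M1 = 2 * M / r"
  define M2 where "M2 = 2 * M1 / (r / 2)"
  define LN where "LN = M1 * M + M * M1"
  define LT where "LT = M1 * M1 + M * M2"
  define LQ where "LQ = M2 * M1 + M1 * M2"
  define R where "R = M1 * M1 * LN + LQ * 1 + (M1 * M * (M1 * M * LN + LT * 1) + (M1 * M * LN + LT * 1) * (M1 * M))"
  have M: "M > 0" "M1 > 0" "M2 > 0"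
    using r c by (simp_all add: M_def M1_def M2_def)
  have main: "\<bar>intensity f n y - intensity f n z\<bar> \<le> R / pi * dist y z"
    if hyp: "\<And>z. z \<in> ball x r \<Longrightarrow> Re (K00 f n z z) > 0 \<and>
             c * Re (K00 f n x x) * Re (K00 f n z z) \<le> (cmod (K00 f n z x))\<^sup>2"
      and y: "y \<in> ball x (r / 4)" and z: "z \<in> ball x (r / 4)" for f n y z
  proof -
    define k where "k = Re (K00 f n x x)"
    have k: "k > 0"
      unfolding k_def using hyp[of x] r by simp
    define h where "h = (\<lambda>w. K00 f n w x / of_real (sqrt k))"
    have h_hol: "h holomorphic_on A" for A
      unfolding h_def K00_def by (intro holomorphic_intros) (use k in auto)
    have norm_h: "(cmod (h w))\<^sup>2 = (cmod (K00 f n w x))\<^sup>2 / k" for w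
      using k by (simp add: h_def norm_divide power_divide)
    \<comment> \<open>The hypothesis bounds |h|^2 from below and Cauchy-Schwarz from above, so the
      squared length of the normalized vector \<open>q\<close> lies between 1 and 1 / c.\<close>
    have h_ge: "c * Re (K00 f n w w) \<le> (cmod (h w))\<^sup>2" if "w \<in> ball x r" for w
      using hyp[OF that] k unfolding norm_h k_def[symmetric] by (simp add: field_simps)
    have h_le: "(cmod (h w))\<^sup>2 \<le> Re (K00 f n w w)" for w
      using norm_K00_le[of f n w x] k unfolding norm_h k_def[symmetric] by (simp add: field_simps)
    have h_nz: "h w \<noteq> 0" if "w \<in> ball x r" for w
    proof
      assume "h w = 0"
      hence "c * Re (K00 f n w w) \<le> 0"
        using h_ge[OF that] by simp
      thus False
        using hyp[OF that] c by (simp add: mult_le_0_iff)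
    qed
    define q where "q = (\<lambda>j w. poly (f j) w / h w)"
    have q_hol: "q j holomorphic_on ball x r" for j
      unfolding q_def by (intro holomorphic_intros h_hol) (use h_nz in auto)
    have N_eq: "(\<Sum>j\<le>n. (cmod (q j w))\<^sup>2) = Re (K00 f n w w) / (cmod (h w))\<^sup>2" for w
      by (simp add: q_def K00_diag norm_divide power_divide sum_divide_distrib)
    have N_ge: "1 \<le> (\<Sum>j\<le>n. (cmod (q j w))\<^sup>2)" if "w \<in> ball x r" for w
      unfolding N_eq using h_le[of w] h_nz[OF that] by (simp add: le_divide_eq)
    have q_bd: "L2_set (\<lambda>j. cmod (q j w)) {..n} \<le> M" if "w \<in> ball x r" for w
    proof -
      have "Re (K00 f n w w) / (cmod (h w))\<^sup>2 \<le> M\<^sup>2"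
        using h_ge[OF that] h_nz[OF that] c by (simp add: M_def field_simps)
      thus ?thesis
        using M by (simp add: L2_set_norm_le_iff N_eq)
    qed
    have q'_bd: "L2_set (\<lambda>j. cmod (deriv (q j) w)) {..n} \<le> M1" if "w \<in> ball x (r / 2)" for w
      unfolding M1_def by (rule L2_set_deriv_le[OF q_hol q_bd r that])
    have q'_hol: "deriv (q j) holomorphic_on ball x (r / 2)" for j
      by (intro holomorphic_deriv holomorphic_on_subset[OF q_hol]) (use r in auto)
    have yz: "y \<in> ball x r" "z \<in> ball x r" "y \<in> ball x (r / 2)" "z \<in> ball x (r / 2)"
      using y z r by auto
    have q_lip: "L2_set (\<lambda>j. cmod (q j y - q j z)) {..n} \<le> M1 * cmod (y - z)"
      unfolding M1_def by (rule L2_set_diff_le[OF q_hol q_bd r yz(4,3)])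
    have q'_lip: "L2_set (\<lambda>j. cmod (deriv (q j) y - deriv (q j) z)) {..n} \<le> M2 * cmod (y - z)"
      unfolding M2_def by (rule L2_set_diff_le[OF q'_hol q'_bd]) (use r y z in auto)
    define N where "N = (\<lambda>w. \<Sum>j\<le>n. (cmod (q j w))\<^sup>2)"
    define Q where "Q = (\<lambda>w. \<Sum>j\<le>n. (cmod (deriv (q j) w))\<^sup>2)"
    define T where "T = (\<lambda>w. \<Sum>j\<le>n. q j w * cnj (deriv (q j) w))"
    \<comment> \<open>In this form the intensity is built from sums and products of bounded
      Lipschitz functions, because \<open>N\<close> is at least 1.\<close>
    have rho: "intensity f n w = (Q w / N w - (cmod (T w / of_real (N w)))\<^sup>2) / pi" if "w \<in> ball x r" for w
    proof -
      have fq: "poly (f j) w = h w * q j w" for j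
        using h_nz[OF that] by (simp add: q_def)
      have fq': "poly (pderiv (f j)) w = deriv h w * q j w + h w * deriv (q j) w" for j
      proof (rule DERIV_unique[OF poly_DERIV])
        have "((\<lambda>w. h w * q j w) has_field_derivative h w * deriv (q j) w + deriv h w * q j w) (at w)"
          by (intro DERIV_mult' holomorphic_derivI[OF h_hol open_ball that] holomorphic_derivI[OF q_hol open_ball that])
        hence "((\<lambda>w. h w * q j w) has_field_derivative deriv h w * q j w + h w * deriv (q j) w) (at w)"
          by (simp add: add.commute)
        thus "(poly (f j) has_field_derivative deriv h w * q j w + h w * deriv (q j) w) (at w)"
          by (rule has_field_derivative_transform_within_open[OF _ open_ball that])
             (use h_nz in \<open>simp add: q_def\<close>)
      qed
      have K00w: "Re (K00 f n w w) = (\<Sum>j\<le>n. (cmod (h w * q j w))\<^sup>2)"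
        by (simp add: K00_diag fq)
      have K11w: "Re (K11 f n w w) = (\<Sum>j\<le>n. (cmod (deriv h w * q j w + h w * deriv (q j) w))\<^sup>2)"
        by (simp add: K11_diag fq')
      have K01w: "K01 f n w w = (\<Sum>j\<le>n. h w * q j w * cnj (deriv h w * q j w + h w * deriv (q j) w))"
        by (simp add: K01_def fq fq')
      have K00w': "Re (K00 f n w w) = (cmod (h w))\<^sup>2 * N w"
        unfolding N_def N_eq using h_nz[OF that] by simp
      have gram: "Re (K11 f n w w) * Re (K00 f n w w) - (cmod (K01 f n w w))\<^sup>2 =
          ((cmod (h w))\<^sup>2)\<^sup>2 * (Q w * N w - (cmod (T w))\<^sup>2)"
        unfolding K00w K11w K01w gram_determinant_scaling N_def Q_def T_def ..
      have "N w \<ge> 1" "(cmod (h w))\<^sup>2 \<noteq> 0"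
        using N_ge[OF that] h_nz[OF that] by (simp_all add: N_def)
      thus ?thesis
        unfolding intensity_def gram unfolding K00w'
        by (simp add: norm_divide power_mult_distrib power_divide) (simp add: power2_eq_square field_simps)
    qed
    define d where "d = cmod (y - z)"
    have sum_sq: "complex_of_real (\<Sum>j\<le>n. (cmod (g j))\<^sup>2) = (\<Sum>j\<le>n. g j * cnj (g j))" for g
      unfolding of_real_sum complex_norm_square by simp
    have d0: "d \<ge> 0" "M1 * d \<ge> 0" "M2 * d \<ge> 0"
      using M by (auto simp: d_def)
    have N_lip: "\<bar>N y - N z\<bar> \<le> LN * d"
    proof -
      have "cmod (of_real (N y) - of_real (N z)) \<le> LN * d"
        unfolding N_def LN_def sum_sq
        by (rule norm_hermitian_sum_diff_le) (use q_lip q_bd yz M d0 in \<open>auto simp: d_def\<close>)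
      thus ?thesis by (metis norm_of_real of_real_diff)
    qed
    have Q_lip: "\<bar>Q y - Q z\<bar> \<le> LQ * d"
    proof -
      have "cmod (of_real (Q y) - of_real (Q z)) \<le> LQ * d"
        unfolding Q_def LQ_def sum_sq
        by (rule norm_hermitian_sum_diff_le) (use q'_lip q'_bd yz M d0 in \<open>auto simp: d_def\<close>)
      thus ?thesis by (metis norm_of_real of_real_diff)
    qed
    have T_lip: "cmod (T y - T z) \<le> LT * d"
      unfolding T_def LT_def
      by (rule norm_hermitian_sum_diff_le) (use q_lip q_bd q'_lip q'_bd yz M d0 in \<open>auto simp: d_def\<close>)
    have N1: "N y \<ge> 1" "N z \<ge> 1"
      using N_ge yz unfolding N_def by auto
    have inv_lip: "\<bar>1 / N y - 1 / N z\<bar> \<le> LN * d"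
    proof -
      have "\<bar>1 / N y - 1 / N z\<bar> = \<bar>N y - N z\<bar> / (N y * N z)"
        using N1 by (simp add: divide_simps abs_mult abs_minus_commute)
      also have "\<dots> \<le> \<bar>N y - N z\<bar> / 1"
        using N1 mult_mono[of 1 "N y" 1 "N z"] by (intro divide_left_mono) auto
      finally show ?thesis using N_lip by simp
    qed
    have inv_le: "1 / N y \<le> 1" "1 / N z \<le> 1"
      using N1 by auto
    have Qb: "Q w \<le> M1 * M1" if "w \<in> ball x (r / 2)" for w
      using q'_bd[OF that] M unfolding Q_def by (simp add: L2_set_norm_le_iff power2_eq_square)
    have Q0: "Q w \<ge> 0" for w
      unfolding Q_def by (simp add: sum_nonneg)
    have Tb: "cmod (T w) \<le> M1 * M" if "w \<in> ball x (r / 2)" "w \<in> ball x r" for w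
    proof -
      have "cmod (T w) \<le> L2_set (\<lambda>j. cmod (q j w)) {..n} * L2_set (\<lambda>j. cmod (cnj (deriv (q j) w))) {..n}"
        unfolding T_def by (rule norm_sum_mult_le_L2_set)
      also have "\<dots> \<le> M * M1"
        using q_bd[OF that(2)] q'_bd[OF that(1)] M by (intro mult_mono) auto
      finally show ?thesis by (simp add: mult.commute)
    qed
    have QN: "\<bar>Q y / N y - Q z / N z\<bar> \<le> (M1 * M1 * LN + LQ * 1) * d"
      using norm_mult_diff_le[of "Q y" "M1 * M1" "1 / N z" 1 "Q z" "LQ * d" "1 / N y" "LN * d"]
        Qb[OF yz(3)] Q0[of y] inv_le(2) N1 Q_lip inv_lip by (simp add: algebra_simps)
    define U where "U = (\<lambda>w. T w * of_real (1 / N w))"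
    have Ub: "cmod (U w) \<le> M1 * M" if "w \<in> ball x (r / 2)" "w \<in> ball x r" "N w \<ge> 1" for w
    proof -
      have "cmod (U w) = cmod (T w) / N w"
        using that(3) by (simp add: U_def norm_divide)
      also have "\<dots> \<le> cmod (T w) / 1"
        using that(3) by (intro divide_left_mono) auto
      finally have "cmod (U w) \<le> cmod (T w)"
        by simp
      thus ?thesis using Tb[OF that(1,2)] by simp
    qed
    have "cmod (of_real (1 / N y) - of_real (1 / N z) :: complex) \<le> LN * d"
      using inv_lip unfolding of_real_diff[symmetric] norm_of_real .
    moreover have "cmod (of_real (1 / N z)) \<le> 1"
      using inv_le(2) N1 unfolding norm_of_real by simp
    ultimately have U_lip: "cmod (U y - U z) \<le> (M1 * M * LN + LT * 1) * d"
      using norm_mult_diff_le[of "T y" "M1 * M" "of_real (1 / N z)" 1 "T z" "LT * d" "of_real (1 / N y)" "LN * d"]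
        Tb[OF yz(3,1)] T_lip
      unfolding U_def by (simp add: algebra_simps)
    have "\<bar>cmod (U y) - cmod (U z)\<bar> \<le> (M1 * M * LN + LT * 1) * d"
      using norm_triangle_ineq3[of "U y" "U z"] U_lip by linarith
    hence "norm (cmod (U y) * cmod (U y) - cmod (U z) * cmod (U z)) \<le>
        M1 * M * ((M1 * M * LN + LT * 1) * d) + ((M1 * M * LN + LT * 1) * d) * (M1 * M)"
      using Ub[OF yz(3,1) N1(1)] Ub[OF yz(4,2) N1(2)] by (intro norm_mult_diff_le) auto
    hence UU: "\<bar>(cmod (U y))\<^sup>2 - (cmod (U z))\<^sup>2\<bar> \<le>
        (M1 * M * (M1 * M * LN + LT * 1) + (M1 * M * LN + LT * 1) * (M1 * M)) * d"
      by (simp add: power2_eq_square algebra_simps)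
    have U_eq: "U w = T w / of_real (N w)" for w
      by (simp add: U_def)
    have "intensity f n y - intensity f n z =
        ((Q y / N y - Q z / N z) - ((cmod (U y))\<^sup>2 - (cmod (U z))\<^sup>2)) / pi"
      unfolding rho[OF yz(1)] rho[OF yz(2)] U_eq by (simp add: field_simps)
    also have "\<bar>\<dots>\<bar> \<le> R * d / pi"
    proof -
      have "\<bar>(Q y / N y - Q z / N z) - ((cmod (U y))\<^sup>2 - (cmod (U z))\<^sup>2)\<bar> \<le> R * d"
        using QN UU unfolding R_def distrib_right by linarith
      thus ?thesis
        by (simp add: divide_right_mono)
    qed
    finally show ?thesis
      by (simp add: d_def dist_norm)
  qed
  show ?thesis
    using main by blast
qed

text \<open>The e/3 argument of Ascoli's theorem: equicontinuity carries the Cauchy property from a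
  dense set to every point, and compactness makes the convergence uniform. The limit is constructed
  here, and its continuity identifies it as the continuous extension of \<open>L0\<close>.\<close>

lemma locally_uniform_limit_of_equilipschitz:
  fixes F :: "nat \<Rightarrow> complex \<Rightarrow> real" and U T :: "complex set"
  assumes lip: "\<And>x. x \<in> U \<Longrightarrow> \<exists>r>0. \<exists>M. ball x r \<subseteq> U \<and>
      (\<forall>\<^sub>F n in sequentially. \<forall>y\<in>ball x r. \<forall>z\<in>ball x r. \<bar>F n y - F n z\<bar> \<le> M * dist y z)"
    and dense: "\<And>x r. 0 < r \<Longrightarrow> \<exists>z\<in>ball x r. z \<in> T"
    and lim: "\<And>z. z \<in> T \<Longrightarrow> z \<in> U \<Longrightarrow> (\<lambda>n. F n z) \<longlonglongrightarrow> L0 z"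
  shows "\<exists>L. continuous_on U L \<and> (\<forall>z\<in>T \<inter> U. L z = L0 z) \<and> locally_uniform_limit U F L"
proof -
  have conv: "convergent (\<lambda>n. F n x)" if x: "x \<in> U" for x
  proof -
    obtain r M where r: "0 < r" "ball x r \<subseteq> U"
      and M: "\<forall>\<^sub>F n in sequentially. \<forall>y\<in>ball x r. \<forall>z\<in>ball x r. \<bar>F n y - F n z\<bar> \<le> M * dist y z"
      using lip[OF x] by blast
    have "Cauchy (\<lambda>n. F n x)"
    proof (rule metric_CauchyI)
      fix e :: real assume e: "0 < e"
      \<comment> \<open>Nothing fixes the sign of \<open>M\<close>; the summand 1 keeps the
        denominator positive and makes the later inequality strict.\<close>
      define s where "s = min r (e / (3 * (\<bar>M\<bar> + 1)))"
      have s: "0 < s" "s \<le> r" "s \<le> e / (3 * (\<bar>M\<bar> + 1))"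
        using r e by (auto simp: s_def)
      obtain z where z: "z \<in> ball x s" "z \<in> T"
        using dense[OF s(1)] by blast
      have zr: "z \<in> ball x r"
        using z s by auto
      hence "Cauchy (\<lambda>n. F n z)"
        using LIMSEQ_imp_Cauchy[OF lim[OF z(2)]] r(2) by blast
      then obtain N where N: "\<And>m n. m \<ge> N \<Longrightarrow> n \<ge> N \<Longrightarrow> dist (F m z) (F n z) < e / 3"
        using metric_CauchyD[of _ "e / 3"] e by (metis zero_less_divide_iff zero_less_numeral)
      obtain N' where N': "\<And>n. n \<ge> N' \<Longrightarrow> \<bar>F n x - F n z\<bar> \<le> M * dist x z"
        using M zr r(1) unfolding eventually_sequentially by (meson centre_in_ball)
      have "M * dist x z \<le> (\<bar>M\<bar> + 1) * dist x z"
        by (intro mult_right_mono) auto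
      also have "\<dots> < (\<bar>M\<bar> + 1) * (e / (3 * (\<bar>M\<bar> + 1)))"
        using z(1) s(3) by (intro mult_strict_left_mono) auto
      also have "\<dots> = e / 3"
        by (simp add: field_simps)
      finally have Md: "M * dist x z < e / 3" .
      have "dist (F m x) (F n x) < e" if mn: "m \<ge> max N N'" "n \<ge> max N N'" for m n
      proof -
        have "\<bar>F m z - F n z\<bar> < e / 3" "\<bar>F m x - F m z\<bar> \<le> M * dist x z" "\<bar>F n x - F n z\<bar> \<le> M * dist x z"
          using N[of m n] N'[of m] N'[of n] mn by (simp_all add: dist_real_def)
        thus ?thesis
          using Md unfolding dist_real_def by linarith
      qed
      thus "\<exists>K. \<forall>m\<ge>K. \<forall>n\<ge>K. dist (F m x) (F n x) < e"
        by blast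
    qed
    thus ?thesis by (rule Cauchy_convergent)
  qed
  define L where "L = (\<lambda>x. lim (\<lambda>n. F n x))"
  have L: "(\<lambda>n. F n x) \<longlonglongrightarrow> L x" if "x \<in> U" for x
    using conv[OF that] by (simp add: L_def convergent_LIMSEQ_iff)
  have lip_L: "\<exists>r>0. \<exists>M\<ge>0. ball x r \<subseteq> U \<and>
      (\<forall>\<^sub>F n in sequentially. \<forall>y\<in>ball x r. \<forall>z\<in>ball x r. \<bar>F n y - F n z\<bar> \<le> M * dist y z) \<and>
      (\<forall>y\<in>ball x r. \<forall>z\<in>ball x r. \<bar>L y - L z\<bar> \<le> M * dist y z)" if x: "x \<in> U" for x
  proof -
    obtain r M where r: "0 < r" "ball x r \<subseteq> U"
      and M: "\<forall>\<^sub>F n in sequentially. \<forall>y\<in>ball x r. \<forall>z\<in>ball x r. \<bar>F n y - F n z\<bar> \<le> M * dist y z"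
      using lip[OF x] by blast
    have Mle: "M * dist y z \<le> \<bar>M\<bar> * dist y z" for y z :: complex
      by (intro mult_right_mono) auto
    have M': "\<forall>\<^sub>F n in sequentially. \<forall>y\<in>ball x r. \<forall>z\<in>ball x r. \<bar>F n y - F n z\<bar> \<le> \<bar>M\<bar> * dist y z"
      using M
    proof eventually_elim
      case (elim n)
      thus ?case
        by (auto intro!: order_trans[OF _ Mle])
    qed
    have "\<bar>L y - L z\<bar> \<le> \<bar>M\<bar> * dist y z" if "y \<in> ball x r" "z \<in> ball x r" for y z
    proof (rule tendsto_upperbound)
      show "(\<lambda>n. \<bar>F n y - F n z\<bar>) \<longlonglongrightarrow> \<bar>L y - L z\<bar>"
        using that r by (intro tendsto_intros L) auto
      show "\<forall>\<^sub>F n in sequentially. \<bar>F n y - F n z\<bar> \<le> \<bar>M\<bar> * dist y z"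
        using M' by eventually_elim (use that in auto)
    qed auto
    thus ?thesis
      using r M' by (intro exI[of _ r] conjI exI[of _ "\<bar>M\<bar>"]) auto
  qed
  have loc: "\<exists>s>0. \<forall>\<^sub>F n in sequentially. \<forall>y\<in>ball x s. dist (F n y) (L y) < e"
    if x: "x \<in> U" and e: "0 < e" for x e
  proof -
    obtain r M where r: "0 < r" and M0: "M \<ge> 0"
      and M: "\<forall>\<^sub>F n in sequentially. \<forall>y\<in>ball x r. \<forall>z\<in>ball x r. \<bar>F n y - F n z\<bar> \<le> M * dist y z"
      and lipL: "\<And>y z. y \<in> ball x r \<Longrightarrow> z \<in> ball x r \<Longrightarrow> \<bar>L y - L z\<bar> \<le> M * dist y z"
      using lip_L[OF x] by blast
    define s where "s = min r (e / (3 * (M + 1)))"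
    have s: "0 < s" "s \<le> r" "s \<le> e / (3 * (M + 1))"
      using r e M0 by (auto simp: s_def)
    have "\<forall>\<^sub>F n in sequentially. dist (F n x) (L x) < e / 3"
      using L[OF x] e by (intro tendstoD) auto
    with M have "\<forall>\<^sub>F n in sequentially. \<forall>y\<in>ball x s. dist (F n y) (L y) < e"
    proof eventually_elim
      case (elim n)
      show ?case
      proof
        fix y assume y: "y \<in> ball x s"
        have "M * dist x y \<le> M * s"
          using y M0 by (intro mult_left_mono) auto
        also have "\<dots> \<le> M * (e / (3 * (M + 1)))"
          using s M0 by (intro mult_left_mono) auto
        also have "\<dots> \<le> e / 3"
          using M0 e by (simp add: field_simps)
        finally have Md: "M * dist x y \<le> e / 3" .
        have "\<bar>F n x - F n y\<bar> \<le> M * dist x y" "\<bar>L x - L y\<bar> \<le> M * dist x y"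
          using elim(1) lipL y s r by auto
        thus "dist (F n y) (L y) < e"
          using elim(2) Md unfolding dist_real_def by linarith
      qed
    qed
    thus ?thesis using s(1) by blast
  qed
  have "continuous_on U L"
  proof (rule continuous_on_eq_continuous_at[THEN iffD2, rule_format])
    show "open U"
      unfolding open_contains_ball using lip by blast
    fix x assume x: "x \<in> U"
    obtain r M where r: "0 < r" "M \<ge> 0"
      and M: "\<And>y z. y \<in> ball x r \<Longrightarrow> z \<in> ball x r \<Longrightarrow> \<bar>L y - L z\<bar> \<le> M * dist y z"
      using lip_L[OF x] by blast
    have "M-lipschitz_on (ball x r) L"
      using M r by (intro lipschitz_onI) (auto simp: dist_real_def)
    hence "continuous_on (ball x r) L"
      by (rule lipschitz_on_continuous_on)
    thus "continuous (at x) L"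
      using r(1) by (simp add: continuous_on_eq_continuous_at)
  qed
  moreover have "L z = L0 z" if "z \<in> T \<inter> U" for z
    using lim[of z] L[of z] that by (auto intro: LIMSEQ_unique)
  moreover have "locally_uniform_limit U F L"
    unfolding locally_uniform_limit_def
  proof (intro allI impI, elim conjE)
    fix C assume C: "compact C" "C \<subseteq> U"
    show "uniform_limit C F L sequentially"
    proof (rule uniform_limitI)
      fix e :: real assume e: "0 < e"
      have "\<forall>x\<in>C. \<exists>s. 0 < s \<and> (\<forall>\<^sub>F n in sequentially. \<forall>y\<in>ball x s. dist (F n y) (L y) < e)"
        using loc[OF _ e] C(2) by blast
      from bchoice[OF this] obtain s where s: "\<And>x. x \<in> C \<Longrightarrow> 0 < s x"
        "\<And>x. x \<in> C \<Longrightarrow> \<forall>\<^sub>F n in sequentially. \<forall>y\<in>ball x (s x). dist (F n y) (L y) < e"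
        by blast
      have "C \<subseteq> (\<Union>x\<in>C. ball x (s x))"
        using s(1) by force
      then obtain C' where C': "C' \<subseteq> C" "finite C'" "C \<subseteq> (\<Union>x\<in>C'. ball x (s x))"
        using compactE_image[OF C(1), of C "\<lambda>x. ball x (s x)"] by auto
      have "\<forall>\<^sub>F n in sequentially. \<forall>x\<in>C'. \<forall>y\<in>ball x (s x). dist (F n y) (L y) < e"
        using C' s(2) by (intro eventually_ball_finite) auto
      thus "\<forall>\<^sub>F n in sequentially. \<forall>y\<in>C. dist (F n y) (L y) < e"
        by eventually_elim (use C'(3) in blast)
    qed
  qed
  ultimately show ?thesis by blast
qed

section \<open>Orthogonal polynomials on the unit circle\<close>

text \<open>For s = B / A the Wronskian divided by A^2 is -s', so the expression is (|s'| / (1 -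
  |s|^2))^2. Since s tends to 0 uniformly on a closed neighbourhood of \<open>C\<close>, Cauchy's
  estimate forces s' to tend to 0 uniformly on \<open>C\<close>.\<close>

lemma uniform_limit_wronskian:
  fixes A B :: "nat \<Rightarrow> complex poly"
  assumes U: "open U"
    and A_nz: "\<And>n z. z \<in> U \<Longrightarrow> poly (A n) z \<noteq> 0"
    and lim: "\<And>C. compact C \<Longrightarrow> C \<subseteq> U \<Longrightarrow>
        uniform_limit C (\<lambda>n z. cmod (poly (B n) z / poly (A n) z)) (\<lambda>_. 0) sequentially"
    and C: "compact C" "C \<subseteq> U"
  shows "uniform_limit C (\<lambda>n z. (cmod (poly (pderiv (A n) * B n - A n * pderiv (B n)) z)
            / ((cmod (poly (A n) z))\<^sup>2 - (cmod (poly (B n) z))\<^sup>2))\<^sup>2) (\<lambda>_. 0) sequentially"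
proof (cases "C = {}")
  case False
  obtain d where d: "d > 0" "(\<Union>x\<in>C. cball x d) \<subseteq> U"
    using compact_subset_open_imp_cball_epsilon_subset[OF C(1) U C(2)] by blast
  \<comment> \<open>This neighbourhood makes room for Cauchy circles of radius \<open>d\<close>. It
    is compact as the Minkowski sum of \<open>C\<close> and a closed ball.\<close>
  define C' where "C' = (\<Union>x\<in>C. cball x d)"
  have C': "compact C'" "C' \<subseteq> U" "C \<subseteq> C'"
  proof -
    have "C' = {x + y |x y. x \<in> C \<and> y \<in> cball 0 d}"
      unfolding C'_def by (force simp: dist_norm norm_minus_commute intro: exI[of _ "_ - _"])
    thus "compact C'"
      using compact_sums[OF C(1) compact_cball[of 0 d]] by simp
    show "C' \<subseteq> U" "C \<subseteq> C'"
      using d unfolding C'_def by auto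
  qed
  define s where "s = (\<lambda>n z. poly (B n) z / poly (A n) z)"
  have s_deriv: "(s n has_field_derivative
      - poly (pderiv (A n) * B n - A n * pderiv (B n)) z / (poly (A n) z)\<^sup>2) (at z)" if "z \<in> U" for n z
    unfolding s_def using A_nz[OF that, of n]
    by (auto intro!: derivative_eq_intros simp: power2_eq_square algebra_simps)
  show ?thesis
  proof (rule uniform_limitI)
    fix e :: real assume e: "0 < e"
    \<comment> \<open>Since \<open>m\<close> is at most 1, the quotient is at most 1 as well, so the
      bound m / 2 for it also bounds its square. In \<delta>, the value 1 / 2 keeps the denominator
      away from 0 and d * m / 4 yields |s'| \<le> m / 4.\<close>
    define m where "m = min 1 e"
    have m: "0 < m" "m \<le> 1" "m \<le> e"
      using e by (auto simp: m_def)
    define \<delta> where "\<delta> = min (1 / 2) (d * m / 4)"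
    have \<delta>: "\<delta> > 0" "\<delta> \<le> 1 / 2" "\<delta> / d \<le> m / 4"
      using d m by (auto simp: \<delta>_def field_simps min_def)
    have "\<forall>\<^sub>F n in sequentially. \<forall>z\<in>C'. cmod (s n z) < \<delta>"
      using uniform_limitD[OF lim[OF C'(1,2)] \<delta>(1)] by (simp add: s_def)
    thus "\<forall>\<^sub>F n in sequentially. \<forall>z\<in>C. dist ((cmod (poly (pderiv (A n) * B n - A n * pderiv (B n)) z)
            / ((cmod (poly (A n) z))\<^sup>2 - (cmod (poly (B n) z))\<^sup>2))\<^sup>2) 0 < e"
    proof eventually_elim
      case (elim n)
      show ?case
      proof
        fix z assume z: "z \<in> C"
        have zU: "z \<in> U"
          using z C by blast
        have sub: "cball z d \<subseteq> C'"
          using z by (auto simp: C'_def)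
        have "cmod (deriv (s n) z) \<le> \<delta> / d"
        proof -
          have "s n holomorphic_on U"
            using s_deriv U by (auto simp: holomorphic_on_open)
          hence hol: "s n holomorphic_on ball z d" and cont: "continuous_on (cball z d) (s n)"
            using sub C'(2) ball_subset_cball[of z d]
            by (meson holomorphic_on_subset order_trans, meson holomorphic_on_subset holomorphic_on_imp_continuous_on order_trans)
          have "cmod ((deriv ^^ 1) (s n) z) \<le> fact 1 * \<delta> / d ^ 1"
          proof (rule Cauchy_inequality[OF hol cont d(1)])
            fix w assume "cmod (z - w) = d"
            hence "w \<in> C'"
              using sub by (auto simp: dist_norm)
            thus "cmod (s n w) \<le> \<delta>"
              using elim by force
          qed
          thus ?thesis by simp
        qed
        hence *: "cmod (poly (pderiv (A n) * B n - A n * pderiv (B n)) z) / (cmod (poly (A n) z))\<^sup>2 \<le> m / 4"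
          using \<delta>(3) unfolding DERIV_imp_deriv[OF s_deriv[OF zU]] norm_divide norm_minus_cancel norm_power
          by (rule order_trans)
        define W where "W = cmod (poly (pderiv (A n) * B n - A n * pderiv (B n)) z)"
        define a where "a = (cmod (poly (A n) z))\<^sup>2"
        define b where "b = (cmod (poly (B n) z))\<^sup>2"
        have a: "a > 0"
          using A_nz[OF zU, of n] by (simp add: a_def)
        have "cmod (s n z) \<le> 1 / 2"
          using elim z C'(3) \<delta>(2) by force
        hence "(cmod (s n z))\<^sup>2 \<le> (1 / 2)\<^sup>2"
          by (rule power_mono) simp
        hence "b / a \<le> 1 / 4"
          by (simp add: s_def a_def b_def norm_divide power_divide)
        hence ab: "a / 2 \<le> a - b"
          using a by (simp add: field_simps)
        have W: "W \<le> m / 4 * a"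
          using * a unfolding W_def[symmetric] a_def[symmetric] by (simp add: field_simps)
        have "W / (a - b) \<le> W / (a / 2)"
          using ab a by (intro divide_left_mono) (auto simp: W_def)
        also have "\<dots> \<le> m / 2"
          using W a by (simp add: field_simps)
        finally have X: "W / (a - b) \<le> m / 2" .
        have X1: "W / (a - b) \<le> 1"
          using X m by linarith
        have X0: "0 \<le> W / (a - b)"
          using ab a by (simp add: W_def)
        have "(W / (a - b))\<^sup>2 \<le> (m / 2) * 1"
          unfolding power2_eq_square using X X0 X1 m by (intro mult_mono) auto
        also have "\<dots> < e"
          using m by simp
        finally show "dist ((cmod (poly (pderiv (A n) * B n - A n * pderiv (B n)) z)
            / ((cmod (poly (A n) z))\<^sup>2 - (cmod (poly (B n) z))\<^sup>2))\<^sup>2) 0 < e"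
          unfolding W_def[symmetric] a_def[symmetric] b_def[symmetric] by simp
      qed
    qed
  qed
qed (simp add: uniform_limit_iff)

text \<open>Two polynomials agreeing at infinitely many points coincide. This extends the Szego
  recurrence, which is assumed only for nonzero arguments, to the origin.\<close>

lemma poly_eqI_nonzero:
  fixes p q :: "complex poly"
  assumes "\<And>z. z \<noteq> 0 \<Longrightarrow> poly p z = poly q z"
  shows "p = q"
proof (rule ccontr)
  assume "p \<noteq> q"
  hence "finite {z. poly (p - q) z = 0}"
    by (intro poly_roots_finite) simp
  moreover have "- {0} \<subseteq> {z. poly (p - q) z = 0}"
    using assms by auto
  ultimately have "finite (- {0 :: complex})"
    by (rule rev_finite_subset)
  thus False
    by (simp add: infinite_UNIV_char_0)
qed

text \<open>The equation is x / y = (q - b p) / (p - a q) with denominators cleared, so that p - a q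
  need not be shown nonzero. Both the inner and the outer Szego ratio have this shape.\<close>

lemma norm_ratio_le:
  fixes x y p q a b :: complex
  assumes eq: "x * (p - a * q) = (q - b * p) * y"
    and "cmod x \<le> cmod y" "y \<noteq> 0" "cmod q \<le> cmod p" "p \<noteq> 0"
  shows "cmod (x / y) \<le> cmod (q / p) + (cmod a + cmod b)"
proof -
  have "x * p = q * y - b * p * y + a * q * x"
    using eq by (simp add: algebra_simps)
  hence "cmod x * cmod p \<le> cmod (q * y) + cmod (b * p * y) + cmod (a * q * x)"
    using norm_triangle_ineq[of "q * y - b * p * y" "a * q * x"] norm_triangle_ineq4[of "q * y" "b * p * y"]
    by (simp flip: norm_mult)
  also have "\<dots> \<le> cmod q * cmod y + cmod b * cmod p * cmod y + cmod a * cmod p * cmod y"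
    unfolding norm_mult by (intro add_mono mult_mono order_refl) (use assms in auto)
  finally show ?thesis
    using assms by (simp add: norm_divide field_simps)
qed

section \<open>The Szego recurrence, its Christoffel-Darboux formula and the ratio
  asymptotics\<close>

locale szego_recurrence =
  fixes f :: "nat \<Rightarrow> complex poly" and \<alpha> :: "nat \<Rightarrow> complex"
  assumes rec: "OPUC_recurrence f \<alpha>"
    and deg: "degree (f j) = j"
    and f0_real: "cnj (coeff (f 0) 0) = coeff (f 0) 0" and f0_nz: "f 0 \<noteq> 0"
begin

text \<open>The reversed polynomial \<open>\<phi>\<^sub>n\<^sup>*\<close>. Reversing the conjugated
  coefficients also gives its value at the origin; the assumption \<open>deg\<close> ensures that
  the reversal takes place at degree n.\<close>

definition g :: "nat \<Rightarrow> complex poly" where "g n = reflect_poly (map_poly cnj (f n))"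

definition s :: "nat \<Rightarrow> real" where "s n = sqrt (1 - (cmod (\<alpha> n))\<^sup>2)"

lemma poly_g: "z \<noteq> 0 \<Longrightarrow> poly (g n) z = z ^ n * cnj (poly (f n) (1 / cnj z))"
  unfolding g_def by (simp add: poly_reflect_poly_nz degree_map_poly deg inverse_eq_divide)

lemma alpha_less_1: "cmod (\<alpha> n) < 1"
  using rec by (simp add: OPUC_recurrence_def)

lemma s_pos: "s n > 0"
  using alpha_less_1[of n] by (simp add: s_def abs_square_less_1)

lemma s_square: "complex_of_real (s n) * of_real (s n) = 1 - \<alpha> n * cnj (\<alpha> n)"
proof -
  have "s n * s n = 1 - (cmod (\<alpha> n))\<^sup>2"
    using alpha_less_1[of n] by (simp add: s_def abs_square_le_1 less_imp_le)
  hence "complex_of_real (s n * s n) = of_real (1 - (cmod (\<alpha> n))\<^sup>2)"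
    by simp
  thus ?thesis
    by (simp only: of_real_mult of_real_diff of_real_1 complex_norm_square)
qed

lemma f_Suc: "s n * poly (f (Suc n)) z = z * poly (f n) z - cnj (\<alpha> n) * poly (g n) z"
proof -
  have "smult (s n) (f (Suc n)) = [:0, 1:] * f n - smult (cnj (\<alpha> n)) (g n)"
  proof (rule poly_eqI_nonzero)
    fix z :: complex assume "z \<noteq> 0"
    thus "poly (smult (s n) (f (Suc n))) z = poly ([:0, 1:] * f n - smult (cnj (\<alpha> n)) (g n)) z"
      using rec s_pos[of n] unfolding OPUC_recurrence_def by (simp add: poly_g s_def)
  qed
  from arg_cong[OF this, of "\<lambda>p. poly p z"] show ?thesis by simp
qed

text \<open>Obtained from \<open>f_Suc\<close> by substituting 1 / cnj z, conjugating and
  multiplying by z^(n+1).\<close>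

lemma g_Suc: "s n * poly (g (Suc n)) z = poly (g n) z - \<alpha> n * z * poly (f n) z"
proof -
  have "smult (s n) (g (Suc n)) = g n - smult (\<alpha> n) ([:0, 1:] * f n)"
  proof (rule poly_eqI_nonzero)
    fix z :: complex assume z: "z \<noteq> 0"
    have "s n * cnj (poly (f (Suc n)) (1 / cnj z)) =
        1 / z * cnj (poly (f n) (1 / cnj z)) - \<alpha> n * cnj (poly (g n) (1 / cnj z))"
      using arg_cong[OF f_Suc[of n "1 / cnj z"], of cnj] by simp
    also have "cnj (poly (g n) (1 / cnj z)) = (1 / z) ^ n * poly (f n) z"
      using z by (subst poly_g) auto
    finally show "poly (smult (s n) (g (Suc n))) z = poly (g n - smult (\<alpha> n) ([:0, 1:] * f n)) z"
      using z by (simp add: poly_g field_simps power_divide)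
  qed
  from arg_cong[OF this, of "\<lambda>p. poly p z"] show ?thesis by (simp add: mult.assoc)
qed

text \<open>The Szego step is pseudo-unitary: it turns the Hermitian form of g g - (z f)(z f) into
  that of g g - f f at the next index, the factor 1 - |\<alpha>|^2 cancelling against
  \<open>s_square\<close>. The sum stops before n, so that the induction starts from an empty
  sum.\<close>

lemma CD_aux:
  "(1 - z * cnj w) * (\<Sum>j<n. poly (f j) z * cnj (poly (f j) w)) =
     poly (g n) z * cnj (poly (g n) w) - poly (f n) z * cnj (poly (f n) w)"
proof (induction n)
  case 0
  obtain c where c: "f 0 = [:c:]"
    using deg[of 0] degree_eq_zeroE by blast
  have "cnj c = c"
    using f0_real c by simp
  thus ?case
    by (simp add: g_def c map_poly_pCons)
next
  case (Suc n)
  let ?F = "\<lambda>z. poly (f n) z" and ?G = "\<lambda>z. poly (g n) z"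
  have "of_real (s n) * of_real (s n) * (poly (g (Suc n)) z * cnj (poly (g (Suc n)) w)
          - poly (f (Suc n)) z * cnj (poly (f (Suc n)) w)) =
        (s n * poly (g (Suc n)) z) * cnj (s n * poly (g (Suc n)) w)
          - (s n * poly (f (Suc n)) z) * cnj (s n * poly (f (Suc n)) w)"
    by (simp add: algebra_simps)
  also have "\<dots> = (1 - \<alpha> n * cnj (\<alpha> n)) * (?G z * cnj (?G w) - z * cnj w * (?F z * cnj (?F w)))"
    unfolding f_Suc g_Suc by (simp add: algebra_simps)
  also have "\<dots> = of_real (s n) * of_real (s n) * (?G z * cnj (?G w) - z * cnj w * (?F z * cnj (?F w)))"
    unfolding s_square ..
  finally have "poly (g (Suc n)) z * cnj (poly (g (Suc n)) w)
          - poly (f (Suc n)) z * cnj (poly (f (Suc n)) w) =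
      ?G z * cnj (?G w) - z * cnj w * (?F z * cnj (?F w))"
    using s_pos[of n] by simp
  also have "\<dots> = (?G z * cnj (?G w) - ?F z * cnj (?F w)) + (1 - z * cnj w) * (?F z * cnj (?F w))"
    by (simp add: algebra_simps)
  also have "\<dots> = (1 - z * cnj w) * (\<Sum>j<Suc n. poly (f j) z * cnj (poly (f j) w))"
    by (simp flip: Suc.IH add: algebra_simps)
  finally show ?case by simp
qed

text \<open>The zero coefficients are kept so that the prefactor matches the general bilinear one of
  \<open>gram_determinant_of_CD\<close>, with \<open>d0\<close> = 1 and \<open>d3\<close> =
  -1.\<close>

lemma CD:
  "(1 + 0 * z + 0 * cnj w + (- 1) * z * cnj w) * K00 f n z w =
     poly (g (Suc n)) z * cnj (poly (g (Suc n)) w) - poly (f (Suc n)) z * cnj (poly (f (Suc n)) w)"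
  using CD_aux[of z w "Suc n"] by (simp add: K00_def lessThan_Suc_atMost)

lemma norm_diff_aux:
  "(1 - (cmod z)\<^sup>2) * (\<Sum>j<n. (cmod (poly (f j) z))\<^sup>2) = (cmod (poly (g n) z))\<^sup>2 - (cmod (poly (f n) z))\<^sup>2"
proof -
  have "complex_of_real ((1 - (cmod z)\<^sup>2) * (\<Sum>j<n. (cmod (poly (f j) z))\<^sup>2)) =
      of_real ((cmod (poly (g n) z))\<^sup>2 - (cmod (poly (f n) z))\<^sup>2)"
    unfolding of_real_mult of_real_diff of_real_sum complex_norm_square of_real_1
    by (rule CD_aux)
  thus ?thesis unfolding of_real_eq_iff .
qed

lemma norm_diff:
  "(1 - (cmod z)\<^sup>2) * Re (K00 f n z z) = (cmod (poly (g (Suc n)) z))\<^sup>2 - (cmod (poly (f (Suc n)) z))\<^sup>2"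
  using norm_diff_aux[of z "Suc n"] by (simp add: K00_diag lessThan_Suc_atMost)

lemma K00_pos: "Re (K00 f n z z) > 0"
proof -
  obtain c where c: "f 0 = [:c:]"
    using deg[of 0] degree_eq_zeroE by blast
  have "0 < (cmod (poly (f 0) z))\<^sup>2"
    using f0_nz c by auto
  also have "\<dots> \<le> (\<Sum>j\<le>n. (cmod (poly (f j) z))\<^sup>2)"
    by (rule member_le_sum) auto
  finally show ?thesis by (simp add: K00_diag)
qed

lemma intensity_eq:
  assumes z: "cmod z \<noteq> 1"
  shows "intensity f n z = 1 / (pi * (1 - (cmod z)\<^sup>2)\<^sup>2)
      - (cmod (poly (pderiv (g (Suc n)) * f (Suc n) - g (Suc n) * pderiv (f (Suc n))) z)
         / ((cmod (poly (g (Suc n)) z))\<^sup>2 - (cmod (poly (f (Suc n)) z))\<^sup>2))\<^sup>2 / pi"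
proof -
  define W where "W = poly (pderiv (g (Suc n)) * f (Suc n) - g (Suc n) * pderiv (f (Suc n))) z"
  define k where "k = Re (K00 f n z z)"
  define G where "G = Re (K11 f n z z) * Re (K00 f n z z) - (cmod (K01 f n z z))\<^sup>2"
  define D where "D = 1 - (cmod z)\<^sup>2"
  have D0: "D \<noteq> 0"
  proof
    assume "D = 0"
    hence "(cmod z)\<^sup>2 = 1\<^sup>2"
      by (simp add: D_def)
    hence "cmod z = 1"
      unfolding power2_eq_iff using norm_ge_zero[of z] by linarith
    thus False
      using z by simp
  qed
  have k0: "k > 0" unfolding k_def by (rule K00_pos)
  have D: "complex_of_real D = 1 + 0 * z + 0 * cnj z + (- 1) * z * cnj z"
    unfolding D_def of_real_diff complex_norm_square by simp
  \<comment> \<open>The correction term of the Gram identity, D d3 - (d1 + d3 cnj z)(d2 + d3 z) = -D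
    - |z|^2 = -1. It produces the leading term 1 / (pi D^2); the Wronskian produces the rest,
    because D K equals |g|^2 - |f|^2 by \<open>norm_diff\<close>.\<close>
  have D1: "complex_of_real D * - 1 - (0 + - 1 * cnj z) * (0 + - 1 * z) = - 1"
    unfolding D by simp
  have W': "poly (g (Suc n) * pderiv (f (Suc n)) - pderiv (g (Suc n)) * f (Suc n)) z = - W"
    by (simp add: W_def)
  have "complex_of_real (D\<^sup>2 * G + k\<^sup>2 * (- 1)) = complex_of_real (- (cmod W)\<^sup>2)"
    using gram_determinant_of_CD[OF CD[where n = n], of z]
    unfolding D[symmetric] D1 W_def[symmetric] W' unfolding G_def k_def
      of_real_add of_real_diff of_real_mult of_real_minus of_real_1 of_real_Re_K00 of_real_Re_K11
      complex_norm_square unfolding of_real_power of_real_Re_K00 by simp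
  hence "D\<^sup>2 * G = k\<^sup>2 - (cmod W)\<^sup>2"
    unfolding of_real_eq_iff by simp
  hence G: "G = (k\<^sup>2 - (cmod W)\<^sup>2) / D\<^sup>2"
    using D0 by (simp add: field_simps)
  show ?thesis
    unfolding intensity_def G_def[symmetric] W_def[symmetric] norm_diff[symmetric]
    unfolding D_def[symmetric] k_def[symmetric] G
    using D0 k0 by (simp add: field_simps)
qed

text \<open>On the diagonal the Christoffel-Darboux formula gives |g|^2 - |f|^2 the sign of 1 -
  |z|^2. A zero of g would force a zero of f and a vanishing sum of squares, against positivity of
  the kernel; at n = 0 that sum is empty and f_0 itself gives the contradiction.\<close>

lemma norm_le_inside:
  assumes "cmod z < 1" shows "cmod (poly (f n) z) \<le> cmod (poly (g n) z)" "poly (g n) z \<noteq> 0"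
proof -
  have z2: "(cmod z)\<^sup>2 < 1"
    using assms by (simp add: abs_square_less_1)
  hence "0 \<le> (1 - (cmod z)\<^sup>2) * (\<Sum>j<n. (cmod (poly (f j) z))\<^sup>2)"
    by (simp add: sum_nonneg)
  thus le: "cmod (poly (f n) z) \<le> cmod (poly (g n) z)"
    unfolding norm_diff_aux by (simp add: power2_le_iff_abs_le)
  show "poly (g n) z \<noteq> 0"
  proof
    assume "poly (g n) z = 0"
    hence *: "(1 - (cmod z)\<^sup>2) * (\<Sum>j<n. (cmod (poly (f j) z))\<^sup>2) = 0" and f: "poly (f n) z = 0"
      unfolding norm_diff_aux using le by auto
    show False
    proof (cases n)
      case 0
      thus False
        using f K00_pos[of 0 z] by (simp add: K00_def)
    next
      case (Suc m)
      thus False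
        using * z2 K00_pos[of m z] by (simp add: K00_diag lessThan_Suc_atMost)
    qed
  qed
qed

lemma norm_le_outside:
  assumes "cmod z > 1" shows "cmod (poly (g n) z) \<le> cmod (poly (f n) z)" "poly (f n) z \<noteq> 0"
proof -
  have z2: "(cmod z)\<^sup>2 > 1"
    using assms by (simp add: one_less_power)
  hence "(1 - (cmod z)\<^sup>2) * (\<Sum>j<n. (cmod (poly (f j) z))\<^sup>2) \<le> 0"
    by (intro mult_nonpos_nonneg) (auto simp: sum_nonneg)
  thus le: "cmod (poly (g n) z) \<le> cmod (poly (f n) z)"
    unfolding norm_diff_aux by (simp add: power2_le_iff_abs_le)
  show "poly (f n) z \<noteq> 0"
  proof
    assume "poly (f n) z = 0"
    hence *: "(1 - (cmod z)\<^sup>2) * (\<Sum>j<n. (cmod (poly (f j) z))\<^sup>2) = 0"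
      unfolding norm_diff_aux using le by auto
    show False
    proof (cases n)
      case 0
      thus False
        using \<open>poly (f n) z = 0\<close> K00_pos[of 0 z] by (simp add: K00_def)
    next
      case (Suc m)
      thus False
        using * z2 K00_pos[of m z] by (simp add: K00_diag lessThan_Suc_atMost)
    qed
  qed
qed

text \<open>The ratio s = f / g follows the Moebius recursion s |-> (z s - cnj \<alpha>) / (1 -
  \<alpha> z s). Its modulus shrinks by the largest |z| on \<open>C\<close>, up to an error of at
  most 2 |\<alpha>|.\<close>

lemma ratio_limit_inside:
  assumes \<alpha>: "\<alpha> \<longlonglongrightarrow> 0" and C: "compact C" "C \<subseteq> ball 0 1"
  shows "uniform_limit C (\<lambda>n z. cmod (poly (f (Suc n)) z / poly (g (Suc n)) z)) (\<lambda>_. 0) sequentially"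
proof (cases "C = {}")
  case False
  obtain z0 where z0: "z0 \<in> C" "\<And>z. z \<in> C \<Longrightarrow> cmod z \<le> cmod z0"
    using continuous_attains_sup[OF C(1) False continuous_on_norm_id] by auto
  show ?thesis
  proof (rule uniform_contraction)
    show "0 \<le> cmod z0" "cmod z0 < 1"
      using z0 C by auto
    show "(\<lambda>n. 2 * cmod (\<alpha> (Suc n))) \<longlonglongrightarrow> 0"
      using tendsto_mult_right_zero[OF tendsto_norm_zero[OF LIMSEQ_Suc[OF \<alpha>]]] by simp
    show "\<exists>B. \<forall>z\<in>C. cmod (poly (f (Suc n)) z / poly (g (Suc n)) z) \<le> B" for n
      using norm_le_inside C by (intro exI[of _ 1]) (auto simp: norm_divide divide_le_eq)
    show "\<forall>\<^sub>F n in sequentially. \<forall>z\<in>C. cmod (poly (f (Suc (Suc n))) z / poly (g (Suc (Suc n))) z)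
        \<le> cmod z0 * cmod (poly (f (Suc n)) z / poly (g (Suc n)) z) + 2 * cmod (\<alpha> (Suc n))"
    proof (intro always_eventually allI ballI)
      fix n z assume z: "z \<in> C"
      hence z1: "cmod z < 1"
        using C by auto
      define m where "m = Suc n"
      have "(s m * poly (f (Suc m)) z) * (poly (g m) z - \<alpha> m * z * poly (f m) z) =
          (z * poly (f m) z - cnj (\<alpha> m) * poly (g m) z) * (s m * poly (g (Suc m)) z)"
        unfolding f_Suc g_Suc by simp
      hence "poly (f (Suc m)) z * (poly (g m) z - \<alpha> m * z * poly (f m) z) =
          (z * poly (f m) z - cnj (\<alpha> m) * poly (g m) z) * poly (g (Suc m)) z"
        using s_pos[of m] by (simp add: mult.assoc)
      hence "cmod (poly (f (Suc m)) z / poly (g (Suc m)) z)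
          \<le> cmod (z * poly (f m) z / poly (g m) z) + (cmod (\<alpha> m) + cmod (cnj (\<alpha> m)))"
        using norm_le_inside[OF z1, of m] norm_le_inside[OF z1, of "Suc m"] z1
          mult_mono[of "cmod z" 1 "cmod (poly (f m) z)" "cmod (poly (g m) z)"]
        by (intro norm_ratio_le) (auto simp: norm_mult mult.assoc)
      also have "cmod (z * poly (f m) z / poly (g m) z) \<le> cmod z0 * cmod (poly (f m) z / poly (g m) z)"
        using z0(2)[OF z] by (simp add: norm_divide norm_mult divide_right_mono mult_right_mono)
      finally show "cmod (poly (f (Suc (Suc n))) z / poly (g (Suc (Suc n))) z)
        \<le> cmod z0 * cmod (poly (f (Suc n)) z / poly (g (Suc n)) z) + 2 * cmod (\<alpha> (Suc n))"
        unfolding m_def by simp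
    qed
  qed auto
qed (simp add: uniform_limit_iff)

lemma ratio_limit_outside:
  assumes \<alpha>: "\<alpha> \<longlonglongrightarrow> 0" and C: "compact C" "C \<subseteq> - cball 0 1"
  shows "uniform_limit C (\<lambda>n z. cmod (poly (g (Suc n)) z / poly (f (Suc n)) z)) (\<lambda>_. 0) sequentially"
proof (cases "C = {}")
  case False
  obtain z0 where z0: "z0 \<in> C" "\<And>z. z \<in> C \<Longrightarrow> cmod z0 \<le> cmod z"
    using continuous_attains_inf[OF C(1) False continuous_on_norm_id] by auto
  have z01: "cmod z0 > 1"
    using z0(1) C by auto
  show ?thesis
  proof (rule uniform_contraction)
    show "0 \<le> 1 / cmod z0" "1 / cmod z0 < 1"
      using z01 by (auto simp: divide_less_eq)
    show "(\<lambda>n. 2 * cmod (\<alpha> (Suc n))) \<longlonglongrightarrow> 0"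
      using tendsto_mult_right_zero[OF tendsto_norm_zero[OF LIMSEQ_Suc[OF \<alpha>]]] by simp
    show "\<exists>B. \<forall>z\<in>C. cmod (poly (g (Suc n)) z / poly (f (Suc n)) z) \<le> B" for n
      using norm_le_outside C by (intro exI[of _ 1]) (auto simp: norm_divide divide_le_eq subset_iff)
    show "\<forall>\<^sub>F n in sequentially. \<forall>z\<in>C. cmod (poly (g (Suc (Suc n))) z / poly (f (Suc (Suc n))) z)
        \<le> 1 / cmod z0 * cmod (poly (g (Suc n)) z / poly (f (Suc n)) z) + 2 * cmod (\<alpha> (Suc n))"
    proof (intro always_eventually allI ballI)
      fix n z assume z: "z \<in> C"
      hence z1: "cmod z > 1"
        using C by auto
      define m where "m = Suc n"
      have "(s m * poly (g (Suc m)) z) * (z * poly (f m) z - cnj (\<alpha> m) * poly (g m) z) =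
          (poly (g m) z - \<alpha> m * z * poly (f m) z) * (s m * poly (f (Suc m)) z)"
        unfolding f_Suc g_Suc by simp
      hence "poly (g (Suc m)) z * (z * poly (f m) z - cnj (\<alpha> m) * poly (g m) z) =
          (poly (g m) z - \<alpha> m * z * poly (f m) z) * poly (f (Suc m)) z"
        using s_pos[of m] by (simp add: mult.assoc)
      hence "cmod (poly (g (Suc m)) z / poly (f (Suc m)) z)
          \<le> cmod (poly (g m) z / (z * poly (f m) z)) + (cmod (cnj (\<alpha> m)) + cmod (\<alpha> m))"
        using norm_le_outside[OF z1, of m] norm_le_outside[OF z1, of "Suc m"] z1
          mult_mono[of 1 "cmod z" "cmod (poly (g m) z)" "cmod (poly (f m) z)"]
        by (intro norm_ratio_le) (auto simp: norm_mult mult.assoc)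
      also have "cmod (poly (g m) z / (z * poly (f m) z)) = 1 / cmod z * cmod (poly (g m) z / poly (f m) z)"
        by (simp add: norm_divide norm_mult)
      also have "\<dots> \<le> 1 / cmod z0 * cmod (poly (g m) z / poly (f m) z)"
        using z0(2)[OF z] z01 z1 less_trans[OF zero_less_one z01] less_trans[OF zero_less_one z1]
        by (intro mult_right_mono divide_left_mono mult_pos_pos) auto
      finally show "cmod (poly (g (Suc (Suc n))) z / poly (f (Suc (Suc n))) z)
        \<le> 1 / cmod z0 * cmod (poly (g (Suc n)) z / poly (f (Suc n)) z) + 2 * cmod (\<alpha> (Suc n))"
        unfolding m_def by simp
    qed
  qed auto
qed (simp add: uniform_limit_iff)

lemma intensity_limit:
  assumes \<alpha>: "\<alpha> \<longlonglongrightarrow> 0"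
  shows "locally_uniform_limit (- sphere 0 1) (intensity f) (\<lambda>z. 1 / (pi * (1 - (cmod z)\<^sup>2)\<^sup>2))"
  unfolding locally_uniform_limit_def
proof (intro allI impI, elim conjE)
  fix C :: "complex set" assume C: "compact C" "C \<subseteq> - sphere 0 1"
  define X where "X = (\<lambda>n z. (cmod (poly (pderiv (g (Suc n)) * f (Suc n) - g (Suc n) * pderiv (f (Suc n))) z)
         / ((cmod (poly (g (Suc n)) z))\<^sup>2 - (cmod (poly (f (Suc n)) z))\<^sup>2))\<^sup>2)"
  \<comment> \<open>As \<open>C\<close> avoids the circle, cutting it with the closed disk and with
    the complement of the open disk gives compact sets inside the two open components.\<close>
  have C12: "compact (C \<inter> cball 0 1)" "C \<inter> cball 0 1 \<subseteq> ball 0 1"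
    "compact (C \<inter> (- ball 0 1))" "C \<inter> (- ball 0 1) \<subseteq> - cball 0 1"
    using C by (auto intro!: compact_Int_closed simp: subset_iff less_le)
  have in_lim: "uniform_limit (C \<inter> cball 0 1) X (\<lambda>_. 0) sequentially"
    unfolding X_def
    by (rule uniform_limit_wronskian[OF open_ball _ ratio_limit_inside[OF \<alpha>] C12(1,2)])
       (use norm_le_inside in auto)
  have "uniform_limit (C \<inter> (- ball 0 1)) (\<lambda>n z. (cmod (poly (pderiv (f (Suc n)) * g (Suc n) - f (Suc n) * pderiv (g (Suc n))) z)
         / ((cmod (poly (f (Suc n)) z))\<^sup>2 - (cmod (poly (g (Suc n)) z))\<^sup>2))\<^sup>2) (\<lambda>_. 0) sequentially"
    by (rule uniform_limit_wronskian[OF _ _ ratio_limit_outside[OF \<alpha>] C12(3,4)])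
       (use norm_le_outside in auto)
  \<comment> \<open>Exchanging f and g changes the sign of both the Wronskian and the denominator;
    the square does not notice.\<close>
  also have "(\<lambda>n z. (cmod (poly (pderiv (f (Suc n)) * g (Suc n) - f (Suc n) * pderiv (g (Suc n))) z)
         / ((cmod (poly (f (Suc n)) z))\<^sup>2 - (cmod (poly (g (Suc n)) z))\<^sup>2))\<^sup>2) = X"
    unfolding X_def by (intro ext) (simp add: power_divide power2_commute norm_minus_commute algebra_simps)
  finally have "uniform_limit (C \<inter> cball 0 1 \<union> C \<inter> (- ball 0 1)) X (\<lambda>_. 0) sequentially"
    using in_lim by (intro uniform_limit_on_Un)
  moreover have "C \<inter> cball 0 1 \<union> C \<inter> (- ball 0 1) = C"
    by auto
  ultimately have X: "uniform_limit C X (\<lambda>_. 0) sequentially"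
    by simp
  show "uniform_limit C (intensity f) (\<lambda>z. 1 / (pi * (1 - (cmod z)\<^sup>2)\<^sup>2)) sequentially"
  proof (rule uniform_limitI)
    fix e :: real assume e: "0 < e"
    have "\<forall>\<^sub>F n in sequentially. \<forall>z\<in>C. dist (X n z) 0 < e * pi"
      using e by (intro uniform_limitD[OF X]) auto
    thus "\<forall>\<^sub>F n in sequentially. \<forall>z\<in>C. dist (intensity f n z) (1 / (pi * (1 - (cmod z)\<^sup>2)\<^sup>2)) < e"
    proof eventually_elim
      case (elim n)
      show ?case
      proof
        fix z assume z: "z \<in> C"
        hence "cmod z \<noteq> 1"
          using C by auto
        hence eq: "intensity f n z = 1 / (pi * (1 - (cmod z)\<^sup>2)\<^sup>2) - X n z / pi"
          unfolding X_def by (rule intensity_eq)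
        show "dist (intensity f n z) (1 / (pi * (1 - (cmod z)\<^sup>2)\<^sup>2)) < e"
          using elim z unfolding eq by (simp add: dist_real_def divide_less_eq)
      qed
    qed
  qed
qed

end

lemma OPUC_intensity_limit:
  assumes "OPUC \<mu> f" "OPUC_recurrence f \<alpha>" "\<alpha> \<longlonglongrightarrow> 0"
  shows "locally_uniform_limit (- sphere 0 1) (intensity f) (\<lambda>z. 1 / (pi * (1 - (cmod z)\<^sup>2)\<^sup>2))"
proof -
  have deg: "degree (f j) = j" and lead: "\<exists>c>0. lead_coeff (f j) = complex_of_real c" for j
    using assms(1) unfolding OPUC_def by blast+
  obtain c where c: "c > 0" "lead_coeff (f 0) = complex_of_real c"
    using lead by blast
  interpret szego_recurrence f \<alpha>
    by unfold_locales (use assms(2) deg c in auto)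
  show ?thesis
    by (rule intensity_limit[OF assms(3)])
qed

section \<open>Orthogonal polynomials on the real line\<close>

text \<open>The halves \<Phi> and \<Psi> of z - b + S z and z - b - S z have product a^2. If their
  moduli agree they are conjugate, so z - b = 2 Re \<Phi> lies in [-2a, 2a]. Hence the difference of
  moduli never vanishes on the connected complement of the segment, and the behaviour of the branch
  at infinity makes it positive.\<close>

lemma sqrt_branch_dominant:
  assumes S: "sqrt_branch a b S" and a: "a \<ge> 0"
    and z: "z \<notin> closed_segment (complex_of_real (b - 2 * a)) (of_real (b + 2 * a))"
  shows "cmod (z - of_real b - S z) < cmod (z - of_real b + S z)"
proof (rule ccontr)
  define seg where "seg = closed_segment (complex_of_real (b - 2 * a)) (of_real (b + 2 * a))"
  define h where "h = (\<lambda>z. cmod (z - of_real b + S z) - cmod (z - of_real b - S z))"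
  have seg: "bounded seg" "convex seg"
    unfolding seg_def by (rule compact_imp_bounded[OF compact_segment], rule convex_closed_segment)
  have cont: "continuous_on (- seg) h"
    unfolding h_def using S
    by (intro continuous_intros) (auto simp: sqrt_branch_def seg_def holomorphic_on_imp_continuous_on)
  have nz: "h x \<noteq> 0" if x: "x \<notin> seg" for x
  proof
    assume "h x = 0"
    define \<Phi> \<Psi> where "\<Phi> = (x - of_real b + S x) / 2" and "\<Psi> = (x - of_real b - S x) / 2"
    have norm_eq: "cmod \<Psi> = cmod \<Phi>"
      using \<open>h x = 0\<close> by (simp add: h_def \<Phi>_def \<Psi>_def norm_divide)
    have "(S x)\<^sup>2 = (x - of_real b)\<^sup>2 - 4 * (of_real a)\<^sup>2"
      using S x by (auto simp: sqrt_branch_def seg_def)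
    hence prod: "\<Phi> * \<Psi> = of_real (a\<^sup>2)"
      unfolding \<Phi>_def \<Psi>_def by (simp add: power2_eq_square algebra_simps)
    have "cmod \<Phi> * cmod \<Psi> = a\<^sup>2"
      using arg_cong[OF prod, of cmod] by (simp add: norm_mult norm_power)
    hence \<Phi>_a: "cmod \<Phi> = a"
      using a unfolding norm_eq by (simp add: power2_eq_square power2_eq_iff_nonneg flip: power2_eq_square)
    have "\<Phi> * \<Psi> = \<Phi> * cnj \<Phi>"
      using prod complex_norm_square[of \<Phi>] \<Phi>_a by simp
    \<comment> \<open>Cancellation of \<Phi> is possible unless \<Phi> = 0, and then
      \<open>norm_eq\<close> gives \<Psi> = 0 too.\<close>
    hence "\<Psi> = cnj \<Phi>"
      using norm_eq by auto
    moreover have "x - of_real b = \<Phi> + \<Psi>"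
      by (simp add: \<Phi>_def \<Psi>_def field_simps)
    ultimately have "x = of_real (b + 2 * Re \<Phi>)"
      by (simp add: complex_eq_iff)
    moreover have "b + 2 * Re \<Phi> \<in> closed_segment (b - 2 * a) (b + 2 * a)"
      using abs_Re_le_cmod[of \<Phi>] \<Phi>_a a by (auto simp: closed_segment_eq_real_ivl)
    ultimately have "x \<in> seg"
      unfolding seg_def by (simp only: closed_segment_of_real) (rule imageI)
    thus False using x by simp
  qed
  have "\<exists>w. w \<notin> seg \<and> h w > 0"
  proof -
    have ne: "\<forall>\<^sub>F z in at_infinity. z - complex_of_real b \<noteq> 0"
      by (rule eventually_mono[OF eventually_not_equal_at_infinity[of "of_real b"]]) auto
    have "((\<lambda>z. S z / (z - of_real b)) \<longlongrightarrow> 1) at_infinity"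
      by (rule asymp_equivD_strong) (use S ne in \<open>auto simp: sqrt_branch_def elim: eventually_mono\<close>)
    hence "\<forall>\<^sub>F z in at_infinity. dist (S z / (z - of_real b)) 1 < 1"
      by (rule tendstoD) simp
    moreover have "\<forall>\<^sub>F z in at_infinity. z \<notin> seg"
    proof -
      obtain B where "\<And>x. x \<in> seg \<Longrightarrow> norm x \<le> B"
        using seg(1) unfolding bounded_iff by blast
      thus ?thesis
        unfolding eventually_at_infinity by (intro exI[of _ "B + 1"]) force
    qed
    ultimately have "\<forall>\<^sub>F z in at_infinity. z \<notin> seg \<and> h z > 0"
      using ne
    proof eventually_elim
      case (elim z)
      define t where "t = S z / (z - of_real b)"
      have S_t: "S z = (z - of_real b) * t"
        using elim(3) by (simp add: t_def)
      have t: "cmod (t - 1) < 1"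
        using elim(1) by (simp add: t_def dist_norm)
      have "2 = cmod ((1 + t) - (t - 1))"
        by simp
      also have "\<dots> \<le> cmod (1 + t) + cmod (t - 1)"
        by (rule norm_triangle_ineq4)
      finally have "cmod (1 - t) < cmod (1 + t)"
        using t by (simp add: norm_minus_commute)
      hence "cmod (z - of_real b) * cmod (1 - t) < cmod (z - of_real b) * cmod (1 + t)"
        using elim(3) by (intro mult_strict_left_mono) auto
      thus ?case
        using elim(2) by (simp add: h_def S_t algebra_simps flip: norm_mult)
    qed
    thus ?thesis
      using eventually_happens trivial_limit_at_infinity by blast
  qed
  then obtain w where w: "w \<notin> seg" "h w > 0" by blast
  assume "\<not> ?thesis"
  hence "h z \<le> 0"
    by (simp add: h_def)
  moreover have "connected (h ` (- seg))"
    by (intro connected_continuous_image[OF cont] connected_complement_bounded_convex)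
       (use seg in auto)
  ultimately have "0 \<in> h ` (- seg)"
    using connectedD_interval[of "h ` (- seg)" "h z" "h w" 0] w z by (simp add: seg_def)
  thus False
    using nz by auto
qed

text \<open>The transformation \<open>w \<mapsto> (w - \<Phi>) / (w - \<Psi>)\<close> sends the limiting recursion
  \<open>w \<mapsto> z - b - a\<^sup>2 / w\<close> to multiplication by \<open>\<Psi> / \<Phi>\<close>, which has modulus less than 1.\<close>

lemma continued_fraction_tendsto:
  fixes R :: "nat \<Rightarrow> complex" and a b :: "nat \<Rightarrow> real"
  assumes rec: "\<And>n. R (Suc n) = z - of_real (b (Suc n)) - (of_real (a n))\<^sup>2 / R n"
    and R: "\<And>n. Im (R n) * Im z > 0" "\<And>n. \<bar>Im z\<bar> \<le> \<bar>Im (R n)\<bar>"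
    and lim: "a \<longlonglongrightarrow> a0" "b \<longlonglongrightarrow> b0"
    and sum: "\<Phi> + \<Psi> = z - of_real b0" and prod: "\<Phi> * \<Psi> = of_real (a0\<^sup>2)"
    and dom: "cmod \<Psi> < cmod \<Phi>"
  shows "R \<longlonglongrightarrow> \<Phi>"
proof -
  define t where "t = a0\<^sup>2 / (cmod \<Phi>)\<^sup>2"
  have \<Phi>0: "\<Phi> \<noteq> 0"
    using dom by auto
  have "cmod \<Phi> * cmod \<Psi> = a0\<^sup>2"
    using arg_cong[OF prod, of cmod] by (simp add: norm_mult norm_power)
  hence "t = cmod \<Psi> / cmod \<Phi>"
    using \<Phi>0 by (simp add: t_def power2_eq_square field_simps)
  hence t: "0 \<le> t" "t < 1"
    using dom \<Phi>0 by (auto simp: divide_less_eq)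
  \<comment> \<open>The product \<Phi> \<Psi> is real and nonnegative. Consequently Im \<Psi> is 0
    or opposite in sign to Im z, whereas every R has the sign of Im z.\<close>
  have "\<Psi> = of_real t * cnj \<Phi>"
  proof -
    have "\<Phi> * (of_real t * cnj \<Phi>) = of_real t * (\<Phi> * cnj \<Phi>)"
      by simp
    also have "\<dots> = of_real (t * (cmod \<Phi>)\<^sup>2)"
      unfolding of_real_mult complex_norm_square ..
    also have "t * (cmod \<Phi>)\<^sup>2 = a0\<^sup>2"
      using \<Phi>0 by (simp add: t_def)
    finally have "\<Phi> * (of_real t * cnj \<Phi>) = \<Phi> * \<Psi>"
      using prod by simp
    thus ?thesis using \<Phi>0 by simp
  qed
  hence Im\<Psi>: "Im \<Psi> = - t * Im \<Phi>"
    by simp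
  have Imz: "Im z = (1 - t) * Im \<Phi>"
    using arg_cong[OF sum, of Im] Im\<Psi> by (simp add: algebra_simps)
  have "0 \<le> t * (1 - t) * (Im \<Phi>)\<^sup>2"
    using t by simp
  hence Im\<Psi>z: "Im \<Psi> * Im z \<le> 0"
    unfolding Im\<Psi> Imz by (simp add: power2_eq_square algebra_simps)
  have y0: "Im z \<noteq> 0"
    using R(1)[of 0] by auto
  define y where "y = \<bar>Im z\<bar>"
  have y: "y > 0"
    using y0 by (simp add: y_def)
  have R_ge: "cmod (R n) \<ge> y" for n
    using R(2)[of n] abs_Im_le_cmod[of "R n"] by (simp add: y_def)
  have R0: "R n \<noteq> 0" for n
    using R_ge[of n] y by auto
  define v where "v = (\<lambda>n. R n - \<Psi>)"
  define u where "u = (\<lambda>n. R n - \<Phi>)"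
  define \<epsilon> where "\<epsilon> = (\<lambda>n. (of_real b0 - of_real (b (Suc n))) + ((of_real a0)\<^sup>2 - (of_real (a n))\<^sup>2) / R n)"
  \<comment> \<open>The orbit stays at distance at least |Im z| from \<Psi>, the pole of the Moebius
    coordinate, so the coordinate is defined with denominators bounded below.\<close>
  have v_ge: "cmod (v n) \<ge> y" for n
  proof -
    have "\<bar>Im (R n) - Im \<Psi>\<bar> \<ge> \<bar>Im (R n)\<bar>"
    proof (cases "Im z > 0")
      case True
      hence "Im (R n) > 0" "Im \<Psi> \<le> 0"
        using R(1)[of n] Im\<Psi>z by (auto simp: zero_less_mult_iff mult_le_0_iff)
      thus ?thesis by simp
    next
      case False
      hence "Im (R n) < 0" "Im \<Psi> \<ge> 0"
        using R(1)[of n] Im\<Psi>z y0 by (auto simp: zero_less_mult_iff mult_le_0_iff)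
      thus ?thesis by simp
    qed
    thus ?thesis
      using R(2)[of n] abs_Im_le_cmod[of "v n"] by (simp add: y_def v_def)
  qed
  have v0: "v n \<noteq> 0" for n
    using v_ge[of n] y by auto
  have \<epsilon>: "\<epsilon> \<longlonglongrightarrow> 0"
  proof -
    have A: "(\<lambda>n. (complex_of_real a0)\<^sup>2 - (of_real (a n))\<^sup>2) \<longlonglongrightarrow> (of_real a0)\<^sup>2 - (of_real a0)\<^sup>2"
      by (intro tendsto_intros lim)
    have "(\<lambda>n. ((complex_of_real a0)\<^sup>2 - (of_real (a n))\<^sup>2) / R n) \<longlonglongrightarrow> 0"
    proof (rule Lim_null_comparison)
      show "\<forall>\<^sub>F n in sequentially. cmod (((complex_of_real a0)\<^sup>2 - (of_real (a n))\<^sup>2) / R n)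
          \<le> cmod ((of_real a0)\<^sup>2 - (of_real (a n))\<^sup>2) / y"
        unfolding norm_divide using R_ge y by (intro always_eventually allI divide_left_mono) (auto simp: R0)
      show "(\<lambda>n. cmod ((complex_of_real a0)\<^sup>2 - (of_real (a n))\<^sup>2) / y) \<longlonglongrightarrow> 0"
        using tendsto_divide[OF tendsto_norm[OF A] tendsto_const[of y]] y by simp
    qed
    moreover have "(\<lambda>n. complex_of_real b0 - of_real (b (Suc n))) \<longlonglongrightarrow> of_real b0 - of_real b0"
      by (intro tendsto_intros LIMSEQ_Suc[OF lim(2)])
    ultimately show ?thesis
      unfolding \<epsilon>_def using tendsto_add by fastforce
  qed
  have prod': "(of_real a0)\<^sup>2 = \<Phi> * \<Psi>"
    using prod by simp
  have R_eq: "R (Suc n) = \<Phi> + \<Psi> - \<Phi> * \<Psi> / R n + \<epsilon> n" for n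
    unfolding rec \<epsilon>_def sum prod'[symmetric] by (simp add: diff_divide_distrib)
  have u_rec: "u (Suc n) = \<epsilon> n + \<Psi> / R n * u n" and v_rec: "v (Suc n) = \<epsilon> n + \<Phi> / R n * v n" for n
    unfolding u_def v_def R_eq using R0[of n] by (simp_all add: field_simps)
  define M where "M = (\<lambda>n. u n / v n)"
  have small: "\<forall>\<^sub>F n in sequentially. cmod (\<epsilon> n) < y / 2"
    using tendstoD[OF \<epsilon>, of "y / 2"] y by simp
  \<comment> \<open>The defect from exact multiplication by \<Psi> / \<Phi>. Numerator
    \<open>u\<close> and denominator \<open>v\<close> receive the same error \<epsilon>, so with V =
    \<open>v (Suc n)\<close> it equals \<epsilon> (\<Phi> - \<Psi>) / (V (V - \<epsilon>)).\<close>
  define \<delta> where "\<delta> = (\<lambda>n. M (Suc n) - \<Psi> / \<Phi> * M n)"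
  have \<delta>: "\<delta> \<longlonglongrightarrow> 0"
  proof (rule Lim_null_comparison)
    show "(\<lambda>n. cmod (\<epsilon> n) * (cmod (\<Phi> - \<Psi>) / (y * (y / 2)))) \<longlonglongrightarrow> 0"
      by (intro tendsto_mult_left_zero tendsto_norm_zero \<epsilon>)
    show "\<forall>\<^sub>F n in sequentially. cmod (\<delta> n) \<le> cmod (\<epsilon> n) * (cmod (\<Phi> - \<Psi>) / (y * (y / 2)))"
      using small
    proof eventually_elim
      case (elim n)
      define V where "V = v (Suc n)"
      have V: "V \<noteq> 0" "cmod V \<ge> y"
        using v0 v_ge by (auto simp: V_def)
      have V\<epsilon>: "cmod (V - \<epsilon> n) \<ge> y / 2"
        using norm_triangle_ineq2[of V "\<epsilon> n"] V elim by linarith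
      hence V\<epsilon>0: "V - \<epsilon> n \<noteq> 0"
        using y by auto
      have "\<Phi> / R n * v n = V - \<epsilon> n" "\<Psi> / R n * u n = u (Suc n) - \<epsilon> n"
        unfolding V_def u_rec v_rec by simp_all
      hence "\<Psi> / \<Phi> * M n = (u (Suc n) - \<epsilon> n) / (V - \<epsilon> n)"
        using R0[of n] \<Phi>0 v0[of n] unfolding M_def by (simp flip: \<open>\<Phi> / R n * v n = V - \<epsilon> n\<close> \<open>\<Psi> / R n * u n = _\<close>)
      hence "\<delta> n = u (Suc n) / V - (u (Suc n) - \<epsilon> n) / (V - \<epsilon> n)"
        by (simp add: \<delta>_def M_def V_def)
      also have "\<dots> = \<epsilon> n * (V - u (Suc n)) / (V * (V - \<epsilon> n))"
        using V V\<epsilon>0 by (simp add: divide_simps) (simp add: algebra_simps)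
      also have "V - u (Suc n) = \<Phi> - \<Psi>"
        by (simp add: V_def u_def v_def)
      finally have "cmod (\<delta> n) = cmod (\<epsilon> n) * (cmod (\<Phi> - \<Psi>) / (cmod V * cmod (V - \<epsilon> n)))"
        by (simp add: norm_mult norm_divide)
      also have "\<dots> \<le> cmod (\<epsilon> n) * (cmod (\<Phi> - \<Psi>) / (y * (y / 2)))"
        using V V\<epsilon> V\<epsilon>0 y by (intro mult_left_mono divide_left_mono mult_mono) auto
      finally show ?case .
    qed
  qed
  have "M \<longlonglongrightarrow> 0 / (1 - \<Psi> / \<Phi>)"
  proof (rule linear_recurrence_tendsto)
    show "\<forall>\<^sub>F n in sequentially. M (Suc n) = \<Psi> / \<Phi> * M n + \<delta> n"
      by (simp add: \<delta>_def)
    show "cmod (\<Psi> / \<Phi>) < 1"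
      using dom \<Phi>0 by (simp add: norm_divide divide_less_eq)
  qed (use \<delta> in auto)
  hence M: "M \<longlonglongrightarrow> 0" by simp
  \<comment> \<open>Inverting the Moebius coordinate: \<open>M n\<close> = 0 corresponds to
    \<open>R n\<close> = \<Phi>.\<close>
  have "(\<lambda>n. M n * (\<Phi> - \<Psi>) / (1 - M n)) \<longlonglongrightarrow> 0 * (\<Phi> - \<Psi>) / (1 - 0)"
    by (intro tendsto_intros M) auto
  moreover have "M n * (\<Phi> - \<Psi>) / (1 - M n) = u n" for n
  proof -
    have "1 - M n = (\<Phi> - \<Psi>) / v n"
      using v0[of n] by (simp add: M_def u_def v_def field_simps)
    moreover have "\<Phi> \<noteq> \<Psi>"
      using dom by auto
    ultimately show ?thesis
      using v0[of n] by (simp add: M_def)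
  qed
  ultimately have "(\<lambda>n. R n - \<Phi>) \<longlonglongrightarrow> 0"
    by (simp add: u_def)
  thus ?thesis
    by (rule LIM_zero_cancel)
qed

text \<open>The hypothesis on \<open>R'\<close> is the continued fraction recursion differentiated
  in z. It is affine in \<open>R'\<close>, and its multiplier tends to a0^2 / \<Phi>^2 = \<Psi> /
  \<Phi>, of modulus less than 1.\<close>

lemma continued_fraction_deriv_tendsto:
  fixes R R' :: "nat \<Rightarrow> complex" and a :: "nat \<Rightarrow> real"
  assumes rec: "\<And>n. R' (Suc n) = 1 + (of_real (a n))\<^sup>2 * R' n / (R n)\<^sup>2"
    and lim: "a \<longlonglongrightarrow> a0" "R \<longlonglongrightarrow> \<Phi>"
    and prod: "\<Phi> * \<Psi> = of_real (a0\<^sup>2)" and dom: "cmod \<Psi> < cmod \<Phi>"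
  shows "R' \<longlonglongrightarrow> \<Phi> / (\<Phi> - \<Psi>)"
proof -
  have \<Phi>0: "\<Phi> \<noteq> 0" "\<Phi> \<noteq> \<Psi>"
    using dom by auto
  have "R' \<longlonglongrightarrow> 1 / (1 - \<Psi> / \<Phi>)"
  proof (rule linear_recurrence_tendsto)
    show "\<forall>\<^sub>F n in sequentially. R' (Suc n) = (of_real (a n))\<^sup>2 / (R n)\<^sup>2 * R' n + 1"
      by (simp add: rec)
    have "(\<lambda>n. (of_real (a n))\<^sup>2 / (R n)\<^sup>2) \<longlonglongrightarrow> (of_real a0)\<^sup>2 / \<Phi>\<^sup>2"
      by (intro tendsto_intros lim) (use \<Phi>0 in auto)
    also have "(of_real a0)\<^sup>2 / \<Phi>\<^sup>2 = \<Psi> / \<Phi>"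
      using prod \<Phi>0 by (simp add: power2_eq_square field_simps)
    finally show "(\<lambda>n. (of_real (a n))\<^sup>2 / (R n)\<^sup>2) \<longlonglongrightarrow> \<Psi> / \<Phi>" .
    show "cmod (\<Psi> / \<Phi>) < 1"
      using dom \<Phi>0 by (simp add: norm_divide divide_less_eq)
  qed auto
  also have "1 / (1 - \<Psi> / \<Phi>) = \<Phi> / (\<Phi> - \<Psi>)"
    using \<Phi>0 by (simp add: field_simps)
  finally show ?thesis .
qed

text \<open>The complement of the support is a union of open null sets; by the Lindelof property
  countably many of them suffice.\<close>

lemma AE_topological_support:
  fixes M :: "'a::second_countable_topology measure"
  assumes "sets M = sets borel"
  shows "AE x in M. x \<in> topological_support M"
proof -
  define F where "F = {U :: 'a set. open U \<and> emeasure M U = 0}"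
  obtain F' where F': "F' \<subseteq> F" "countable F'" "\<Union>F' = \<Union>F"
    using Lindelof[of F] unfolding F_def by blast
  have "U \<in> null_sets M" if "U \<in> F" for U
    using that assms by (auto simp: F_def null_sets_def)
  hence "(\<Union>U\<in>F'. U) \<in> null_sets M"
    using F' by (intro null_sets_UN') auto
  moreover have "{x \<in> space M. x \<notin> topological_support M} \<subseteq> (\<Union>U\<in>F'. U)"
    using F'(3) unfolding topological_support_def F_def by (auto simp: not_gr_zero)
  ultimately show ?thesis
    by (rule AE_I')
qed

lemma closed_topological_support: "closed (topological_support M)"
proof -
  have "- topological_support M = \<Union>{U. open U \<and> \<not> emeasure M U > 0}"
    unfolding topological_support_def by blast
  hence "open (- topological_support M)"
    by (simp only:) (rule open_Union, blast)
  thus ?thesis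
    by (simp add: closed_def)
qed

section \<open>Real polynomials at complex arguments, and Hermitian inequalities\<close>

lemma poly_of_real_poly:
  "poly (map_poly complex_of_real q) (of_real x) = of_real (poly q x)"
  by (simp add: poly_altdef degree_map_poly coeff_map_poly)

lemma poly_of_real_poly_cnj:
  "poly (map_poly complex_of_real q) (cnj z) = cnj (poly (map_poly complex_of_real q) z)"
  by (rule poly_cnj_real[symmetric]) (simp add: coeff_map_poly)

lemma map_poly_of_real_add:
  "map_poly complex_of_real (p + q) = map_poly of_real p + map_poly of_real q"
  by (rule poly_eqI) (simp add: coeff_map_poly)

lemma map_poly_of_real_smult:
  "map_poly complex_of_real (smult c q) = smult (of_real c) (map_poly of_real q)"
  by (rule poly_eqI) (simp add: coeff_map_poly)

text \<open>Here \<open>l\<close> is the least squares coefficient of u along v. The residual is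
  given by Lagrange's identity through the 2 by 2 determinant, and Cauchy-Schwarz bounds
  \<open>l\<close>.\<close>

lemma lagrange_identity_complex:
  fixes u1 u2 v1 v2 :: complex
  assumes pos: "(cmod v1)\<^sup>2 + (cmod v2)\<^sup>2 > 0"
  defines "l \<equiv> (u1 * cnj v1 + u2 * cnj v2) / of_real ((cmod v1)\<^sup>2 + (cmod v2)\<^sup>2)"
  shows "(cmod (u1 - l * v1))\<^sup>2 + (cmod (u2 - l * v2))\<^sup>2 =
           (cmod (u1 * v2 - u2 * v1))\<^sup>2 / ((cmod v1)\<^sup>2 + (cmod v2)\<^sup>2)" (is ?eq)
    and "(cmod l)\<^sup>2 \<le> ((cmod u1)\<^sup>2 + (cmod u2)\<^sup>2) / ((cmod v1)\<^sup>2 + (cmod v2)\<^sup>2)" (is ?le)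
proof -
  define P where "P = (cmod v1)\<^sup>2 + (cmod v2)\<^sup>2"
  have P: "P > 0"
    using pos unfolding P_def .
  have PC: "complex_of_real P = v1 * cnj v1 + v2 * cnj v2"
    unfolding P_def of_real_add complex_norm_square ..
  have P0: "complex_of_real P \<noteq> 0"
    using P by simp
  have l_eq: "l * of_real P = u1 * cnj v1 + u2 * cnj v2"
    using P0 unfolding l_def P_def[symmetric] by simp
  define d where "d = u1 * v2 - u2 * v1"
  have "(u1 - l * v1) * of_real P = u1 * of_real P - (l * of_real P) * v1"
    by (simp add: algebra_simps)
  also have "\<dots> = cnj v2 * d"
    unfolding l_eq unfolding PC d_def by (simp add: algebra_simps)
  finally have 1: "u1 - l * v1 = cnj v2 * d / of_real P"
    using P0 by (simp add: field_simps)
  have "(u2 - l * v2) * of_real P = u2 * of_real P - (l * of_real P) * v2"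
    by (simp add: algebra_simps)
  also have "\<dots> = - cnj v1 * d"
    unfolding l_eq unfolding PC d_def by (simp add: algebra_simps)
  finally have 2: "u2 - l * v2 = - cnj v1 * d / of_real P"
    using P0 by (simp add: field_simps)
  have "(cmod (u1 - l * v1))\<^sup>2 + (cmod (u2 - l * v2))\<^sup>2 =
      (cmod d)\<^sup>2 * ((cmod v1)\<^sup>2 + (cmod v2)\<^sup>2) / P\<^sup>2"
    unfolding 1 2 by (simp add: norm_divide norm_mult power_divide power_mult_distrib algebra_simps add_divide_distrib)
  also have "\<dots> = (cmod d)\<^sup>2 * P / P\<^sup>2"
    unfolding P_def ..
  also have "\<dots> = (cmod d)\<^sup>2 / P"
    using P by (simp add: power2_eq_square)
  finally show ?eq
    unfolding P_def d_def .
  have "complex_of_real ((cmod (u1 * cnj v1 + u2 * cnj v2))\<^sup>2 + (cmod d)\<^sup>2) =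
      of_real (((cmod u1)\<^sup>2 + (cmod u2)\<^sup>2) * P)"
    unfolding of_real_add of_real_mult complex_norm_square PC d_def by (simp add: algebra_simps)
  hence "(cmod (u1 * cnj v1 + u2 * cnj v2))\<^sup>2 \<le> ((cmod u1)\<^sup>2 + (cmod u2)\<^sup>2) * P"
    unfolding of_real_eq_iff by (metis add.commute le_add_same_cancel1 zero_le_power2 add_le_same_cancel1 le_add_same_cancel2)
  moreover have "(cmod l)\<^sup>2 = (cmod (u1 * cnj v1 + u2 * cnj v2))\<^sup>2 / P\<^sup>2"
    using P unfolding l_def P_def[symmetric] by (simp add: norm_divide power_divide)
  ultimately have "(cmod l)\<^sup>2 \<le> ((cmod u1)\<^sup>2 + (cmod u2)\<^sup>2) * P / P\<^sup>2"
    by (simp add: divide_right_mono)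
  thus ?le
    using P unfolding P_def[symmetric] by (simp add: power2_eq_square)
qed

lemma power2_norm_add_le: "(norm (x + y))\<^sup>2 \<le> 2 * (norm x)\<^sup>2 + 2 * (norm y)\<^sup>2"
  for x y :: "'a::real_normed_vector"
proof -
  have "(norm (x + y))\<^sup>2 \<le> (norm x + norm y)\<^sup>2"
    by (rule power_mono[OF norm_triangle_ineq]) simp
  also have "\<dots> \<le> 2 * (norm x)\<^sup>2 + 2 * (norm y)\<^sup>2"
    using sum_squares_bound[of "norm x" "norm y"] by (simp add: power2_sum)
  finally show ?thesis .
qed

text \<open>Completing the square in c: S W = V W - |X|^2 + |c W - X|^2. Hence closeness of v to any
  multiple of w bounds the angle between them. Multiplying through by W covers w = 0.\<close>

lemma norm_inner_ge_of_close:
  fixes v w :: "'a \<Rightarrow> complex" and c :: complex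
  assumes "(\<Sum>j\<in>I. (cmod (v j - c * w j))\<^sup>2) \<le> (1 - \<theta>) * (\<Sum>j\<in>I. (cmod (v j))\<^sup>2)"
  shows "\<theta> * (\<Sum>j\<in>I. (cmod (w j))\<^sup>2) * (\<Sum>j\<in>I. (cmod (v j))\<^sup>2) \<le> (cmod (\<Sum>j\<in>I. v j * cnj (w j)))\<^sup>2"
proof -
  define V W X where "V = (\<Sum>j\<in>I. (cmod (v j))\<^sup>2)" and "W = (\<Sum>j\<in>I. (cmod (w j))\<^sup>2)"
    and "X = (\<Sum>j\<in>I. v j * cnj (w j))"
  define S where "S = (\<Sum>j\<in>I. (cmod (v j - c * w j))\<^sup>2)"
  have V: "complex_of_real V = (\<Sum>j\<in>I. v j * cnj (v j))" and W: "complex_of_real W = (\<Sum>j\<in>I. w j * cnj (w j))"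
    unfolding V_def W_def of_real_sum complex_norm_square by simp_all
  have X': "cnj X = (\<Sum>j\<in>I. w j * cnj (v j))"
    unfolding X_def by (simp add: mult.commute)
  have S: "complex_of_real S = V + c * cnj c * W - c * cnj X - cnj c * X"
    unfolding S_def of_real_sum complex_norm_square V W X' unfolding X_def
    by (simp add: sum_distrib_left sum.distrib sum_subtractf algebra_simps)
  have "complex_of_real (S * W) = of_real (V * W - (cmod X)\<^sup>2 + (cmod (c * of_real W - X))\<^sup>2)"
    unfolding of_real_mult of_real_add of_real_diff complex_norm_square S by (simp add: algebra_simps)
  hence "S * W = V * W - (cmod X)\<^sup>2 + (cmod (c * of_real W - X))\<^sup>2"
    unfolding of_real_eq_iff .
  moreover have "S * W \<le> (1 - \<theta>) * V * W"
    using assms by (intro mult_right_mono) (auto simp: S_def V_def W_def sum_nonneg)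
  ultimately have "V * W - (cmod X)\<^sup>2 \<le> (1 - \<theta>) * V * W"
    by (smt (verit) zero_le_power2)
  thus ?thesis
    unfolding V_def[symmetric] W_def[symmetric] X_def[symmetric] by (simp add: algebra_simps)
qed

lemma norm_sum_of_real_power2:
  "(cmod (\<Sum>j\<in>I. c j * of_real (y j)))\<^sup>2 = (\<Sum>j\<in>I. Re (c j) * y j)\<^sup>2 + (\<Sum>j\<in>I. Im (c j) * y j)\<^sup>2"
  by (simp add: cmod_power2)

section \<open>Orthonormality, the recurrence and the Christoffel-Darboux formula on the
  line\<close>

locale oprl =
  fixes \<mu> :: "real measure" and p :: "nat \<Rightarrow> real poly" and a b :: "nat \<Rightarrow> real"
  assumes orth: "OPRL \<mu> p" and rec: "OPRL_recurrence p a b"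
begin

definition f :: "nat \<Rightarrow> complex poly" where "f j = map_poly complex_of_real (p j)"

abbreviation F :: "nat \<Rightarrow> complex \<Rightarrow> complex" where "F j z \<equiv> poly (f j) z"

lemma F_cnj: "F j (cnj z) = cnj (F j z)"
  unfolding f_def by (rule poly_of_real_poly_cnj)

lemma F_of_real: "F j (of_real x) = of_real (poly (p j) x)"
  unfolding f_def by (rule poly_of_real_poly)

lemma a_pos: "a n > 0"
  using rec by (simp add: OPRL_recurrence_def)

lemma degree_p: "degree (p j) = j" and lead_coeff_p: "lead_coeff (p j) > 0"
  using orth unfolding OPRL_def by blast+

lemma integrable_poly: "integrable \<mu> (poly q)"
proof -
  have pow: "integrable \<mu> (\<lambda>x. x ^ k)" for k
    using orth unfolding OPRL_def by blast
  have "integrable \<mu> (\<lambda>x. \<Sum>i\<le>degree q. coeff q i * x ^ i)"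
    by (intro Bochner_Integration.integrable_sum integrable_mult_right pow)
  thus ?thesis
    by (simp add: poly_altdef[abs_def])
qed

lemma integrable_polyI: "(\<And>x. g x = poly q x) \<Longrightarrow> integrable \<mu> g"
  using integrable_poly[of q] by presburger

lemma orthonormal: "(\<integral>x. poly (p m) x * poly (p k) x \<partial>\<mu>) = (if m = k then 1 else 0)"
  using orth unfolding OPRL_def by blast

lemma integral_poly_square_sum:
  "(\<integral>x. (\<Sum>j\<in>I. r j * poly (p j) x)\<^sup>2 \<partial>\<mu>) = (\<Sum>j\<in>I. (r j)\<^sup>2)" if "finite I"
proof -
  have int: "integrable \<mu> (\<lambda>x. poly (p i) x * poly (p j) x)" for i j
    by (rule integrable_polyI[of _ "p i * p j"]) simp
  have "(\<integral>x. (\<Sum>j\<in>I. r j * poly (p j) x)\<^sup>2 \<partial>\<mu>) =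
        (\<integral>x. (\<Sum>i\<in>I. \<Sum>j\<in>I. r i * r j * (poly (p i) x * poly (p j) x)) \<partial>\<mu>)"
    by (simp add: power2_eq_square sum_product mult_ac)
  also have "\<dots> = (\<Sum>i\<in>I. \<Sum>j\<in>I. r i * r j * (if i = j then 1 else 0))"
    by (simp add: Bochner_Integration.integral_sum int orthonormal)
  also have "\<dots> = (\<Sum>j\<in>I. (r j)\<^sup>2)"
    using that by (intro sum.cong) (auto simp: power2_eq_square if_distrib[of "\<lambda>x. _ * x"] cong: if_cong)
  finally show ?thesis .
qed

lemma integrable_norm_sum: "integrable \<mu> (\<lambda>x. (cmod (\<Sum>j\<in>I. c j * F j (of_real x)))\<^sup>2)"
  unfolding F_of_real norm_sum_of_real_power2
  by (rule integrable_polyI[of _ "(\<Sum>j\<in>I. smult (Re (c j)) (p j))\<^sup>2 + (\<Sum>j\<in>I. smult (Im (c j)) (p j))\<^sup>2"])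
     (simp add: poly_sum)

text \<open>The polynomials are real at real points, so the squared modulus splits into the squares
  of two real combinations, with the real and the imaginary parts of \<open>c\<close> as
  coefficients.\<close>

lemma parseval:
  assumes "finite I"
  shows "(\<integral>x. (cmod (\<Sum>j\<in>I. c j * F j (of_real x)))\<^sup>2 \<partial>\<mu>) = (\<Sum>j\<in>I. (cmod (c j))\<^sup>2)"
proof -
  have int: "integrable \<mu> (\<lambda>x. (\<Sum>j\<in>I. r j * poly (p j) x)\<^sup>2)" for r
    by (rule integrable_polyI[of _ "(\<Sum>j\<in>I. smult (r j) (p j))\<^sup>2"]) (simp add: poly_sum)
  show ?thesis
    unfolding F_of_real norm_sum_of_real_power2
    using assms by (simp add: int integral_poly_square_sum cmod_power2 sum.distrib)
qed

lemma recurrence: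
  fixes z :: complex
  shows   "z * F (Suc n) z = a (Suc n) * F (Suc (Suc n)) z + b (Suc n) * F (Suc n) z + a n * F n z"
proof -
  have "[:0, 1:] * p (Suc n) =
      smult (a (Suc n)) (p (Suc (Suc n))) + smult (b (Suc n)) (p (Suc n)) + smult (a n) (p n)"
    using rec unfolding OPRL_recurrence_def by simp
  hence "pCons 0 (p (Suc n)) =
      smult (a (Suc n)) (p (Suc (Suc n))) + smult (b (Suc n)) (p (Suc n)) + smult (a n) (p n)"
    by simp
  from arg_cong[OF this, of "\<lambda>q. poly (map_poly complex_of_real q) z"] show ?thesis
    unfolding map_poly_of_real_add map_poly_of_real_smult f_def by (simp add: map_poly_pCons)
qed

text \<open>The relation for \<open>n = 0\<close> is not part of the recurrence hypothesis; the coefficient of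
  \<open>p 1\<close> in it is identified by orthogonality.\<close>

lemma recurrence_0: "\<exists>\<beta>. \<forall>z :: complex. z * F 0 z = a 0 * F 1 z + \<beta> * F 0 z"
proof -
  obtain c where c: "p 0 = [:c:]"
    using degree_p[of 0] degree_eq_zeroE by blast
  have c0: "c > 0"
    using lead_coeff_p[of 0] c by simp
  define d e where "d = coeff (p 1) 1" and "e = coeff (p 1) 0"
  have p1: "p 1 = [:e, d:]"
  proof (rule poly_eqI)
    fix n show "coeff (p 1) n = coeff [:e, d:] n"
    proof (cases n)
      case (Suc m)
      thus ?thesis
        using degree_p[of 1] coeff_eq_0[of "p 1" n] by (cases m) (auto simp: d_def)
    qed (simp add: e_def)
  qed
  have d0: "d > 0"
    using lead_coeff_p[of 1] degree_p[of 1] by (simp add: d_def)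
  \<comment> \<open>Comparing coefficients in x p_0 = \<gamma> p_1 + \<beta> p_0 forces both
    values.\<close>
  define \<gamma> where "\<gamma> = c / d"
  define \<beta> where "\<beta> = - \<gamma> * e / c"
  have int: "integrable \<mu> (\<lambda>x. poly (p i) x * poly (p j) x)" for i j
    by (rule integrable_polyI[of _ "p i * p j"]) simp
  have rec0: "[:0, 1:] * p 0 = smult \<gamma> (p 1) + smult \<beta> (p 0)"
    using c0 d0 by (simp add: c p1[unfolded One_nat_def] \<gamma>_def \<beta>_def)
  have rec1: "[:0, 1:] * p 1 = smult (a 1) (p 2) + smult (b 1) (p 1) + smult (a 0) (p 0)"
    using rec unfolding OPRL_recurrence_def by (metis One_nat_def add_Suc_shift diff_Suc_1 le_refl one_add_one plus_1_eq_Suc)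
  have eq0: "x * poly (p 0) x = \<gamma> * poly (p 1) x + \<beta> * poly (p 0) x" for x
    using arg_cong[OF rec0, of "\<lambda>q. poly q x"] by simp
  have eq1: "x * poly (p 1) x = a 1 * poly (p 2) x + b 1 * poly (p 1) x + a 0 * poly (p 0) x" for x
    using arg_cong[OF rec1, of "\<lambda>q. poly q x"] by simp
  \<comment> \<open>The integral of x p_0 p_1 is \<gamma> when x p_0 is expanded and
    \<open>a 0\<close> when x p_1 is expanded by the recurrence at index 1.\<close>
  have "(\<integral>x. x * poly (p 0) x * poly (p 1) x \<partial>\<mu>) =
      (\<integral>x. \<gamma> * (poly (p 1) x * poly (p 1) x) + \<beta> * (poly (p 0) x * poly (p 1) x) \<partial>\<mu>)"
    unfolding eq0 by (simp add: algebra_simps)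
  also have "\<dots> = \<gamma>"
    using int by (simp add: orthonormal)
  finally have "\<gamma> = (\<integral>x. (x * poly (p 1) x) * poly (p 0) x \<partial>\<mu>)"
    by (simp add: mult_ac)
  also have "\<dots> = (\<integral>x. a 1 * (poly (p 2) x * poly (p 0) x) + b 1 * (poly (p 1) x * poly (p 0) x)
      + a 0 * (poly (p 0) x * poly (p 0) x) \<partial>\<mu>)"
    unfolding eq1 by (simp add: algebra_simps)
  also have "\<dots> = a 0"
    using int by (simp add: orthonormal)
  finally have "\<gamma> = a 0" .
  hence eq: "pCons 0 (p 0) = smult (a 0) (p 1) + smult \<beta> (p 0)"
    using rec0 by simp
  have "z * F 0 z = a 0 * F 1 z + \<beta> * F 0 z" for z :: complex
    using arg_cong[OF eq, of "\<lambda>q. poly (map_poly complex_of_real q) z"]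
    unfolding map_poly_of_real_add map_poly_of_real_smult f_def by (simp add: map_poly_pCons)
  thus ?thesis by blast
qed

text \<open>Stated bilinearly, without conjugation: u = cnj w gives the kernel \<open>K00\<close>,
  while the angle estimate uses the same identity at u = w and at real points.\<close>

lemma christoffel_darboux:
  fixes z u :: complex
  shows   "(z - u) * (\<Sum>j\<le>n. F j z * F j u) = a n * (F (Suc n) z * F n u - F n z * F (Suc n) u)"
proof (induction n)
  case 0
  obtain \<beta> where "\<And>z :: complex. z * F 0 z = a 0 * F 1 z + \<beta> * F 0 z"
    using recurrence_0 by blast
  hence \<beta>: "a 0 * F 1 z = (z - \<beta>) * F 0 z" for z :: complex
    by (simp add: algebra_simps)
  have "a 0 * (F 1 z * F 0 u - F 0 z * F 1 u) = (a 0 * F 1 z) * F 0 u - F 0 z * (a 0 * F 1 u)"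
    by (simp add: algebra_simps)
  also have "\<dots> = (z - u) * (F 0 z * F 0 u)"
    unfolding \<beta> by (simp add: algebra_simps)
  finally show ?case by simp
next
  case (Suc n)
  have r: "a (Suc n) * F (Suc (Suc n)) z = (z - b (Suc n)) * F (Suc n) z - a n * F n z" for z :: complex
    using recurrence[of z n] by (simp add: algebra_simps)
  have "a (Suc n) * (F (Suc (Suc n)) z * F (Suc n) u - F (Suc n) z * F (Suc (Suc n)) u) =
      (a (Suc n) * F (Suc (Suc n)) z) * F (Suc n) u - F (Suc n) z * (a (Suc n) * F (Suc (Suc n)) u)"
    by (simp add: algebra_simps)
  also have "\<dots> = (z - u) * (F (Suc n) z * F (Suc n) u) + a n * (F (Suc n) z * F n u - F n z * F (Suc n) u)"
    by (simp only: r[of z] r[of u]) (simp add: algebra_simps)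
  also have "\<dots> = (z - u) * (\<Sum>j\<le>Suc n. F j z * F j u)"
    unfolding Suc.IH[symmetric] by (simp add: algebra_simps)
  finally show ?case ..
qed

section \<open>Multiplication by x - z and the angle between kernel vectors\<close>

lemma K00_eq: "K00 f n z w = (\<Sum>j\<le>n. F j z * F j (cnj w))"
  unfolding K00_def F_cnj ..

lemma Re_K00_eq: "Re (K00 f n z z) = (\<Sum>j\<le>n. (cmod (F j z))\<^sup>2)"
  by (simp add: K00_diag)

lemma norm_F_le: "j \<le> n \<Longrightarrow> (cmod (F j z))\<^sup>2 \<le> Re (K00 f n z z)"
  unfolding Re_K00_eq by (rule member_le_sum) auto

lemma K00_pos: "Re (K00 f n z z) > 0"
proof -
  obtain c where c: "p 0 = [:c:]"
    using degree_p[of 0] degree_eq_zeroE by blast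
  have "c > 0"
    using lead_coeff_p[of 0] c by simp
  hence "0 < (cmod (F 0 z))\<^sup>2"
    by (simp add: f_def c map_poly_pCons)
  also have "\<dots> \<le> Re (K00 f n z z)"
    by (rule norm_F_le) simp
  finally show ?thesis .
qed

lemma norm_sum_F_le: "(cmod (\<Sum>j\<le>n. F j z * F j w))\<^sup>2 \<le> Re (K00 f n z z) * Re (K00 f n w w)"
proof -
  have "Re (K00 f n (cnj w) (cnj w)) = Re (K00 f n w w)"
    unfolding Re_K00_eq F_cnj by simp
  thus ?thesis
    using norm_K00_le[of f n z "cnj w"] by (simp add: K00_eq)
qed

text \<open>Parseval translates the bound |x - z| \<ge> d, valid almost everywhere because almost
  every point is in the support, into an inequality between coefficient vectors.\<close>

lemma multiplication_lower_bound:
  assumes d: "\<And>x. x \<in> topological_support \<mu> \<Longrightarrow> d \<le> cmod (of_real x - z)" "0 \<le> d"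
    and I: "finite I" "finite J"
    and eq: "\<And>x. (of_real x - z) * (\<Sum>j\<in>I. c j * F j (of_real x)) = (\<Sum>j\<in>J. e j * F j (of_real x))"
  shows "d\<^sup>2 * (\<Sum>j\<in>I. (cmod (c j))\<^sup>2) \<le> (\<Sum>j\<in>J. (cmod (e j))\<^sup>2)"
proof -
  have "d\<^sup>2 * (\<Sum>j\<in>I. (cmod (c j))\<^sup>2) = (\<integral>x. d\<^sup>2 * (cmod (\<Sum>j\<in>I. c j * F j (of_real x)))\<^sup>2 \<partial>\<mu>)"
    using I by (simp add: parseval)
  also have "\<dots> \<le> (\<integral>x. (cmod (\<Sum>j\<in>J. e j * F j (of_real x)))\<^sup>2 \<partial>\<mu>)"
  proof (rule integral_mono_AE)
    show "integrable \<mu> (\<lambda>x. d\<^sup>2 * (cmod (\<Sum>j\<in>I. c j * F j (of_real x)))\<^sup>2)"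
      "integrable \<mu> (\<lambda>x. (cmod (\<Sum>j\<in>J. e j * F j (of_real x)))\<^sup>2)"
      by (intro integrable_mult_right integrable_norm_sum)+
    have "sets \<mu> = sets borel"
      using orth unfolding OPRL_def by blast
    hence "AE x in \<mu>. x \<in> topological_support \<mu>"
      by (rule AE_topological_support)
    thus "AE x in \<mu>. d\<^sup>2 * (cmod (\<Sum>j\<in>I. c j * F j (of_real x)))\<^sup>2
        \<le> (cmod (\<Sum>j\<in>J. e j * F j (of_real x)))\<^sup>2"
    proof eventually_elim
      case (elim x)
      show ?case
        unfolding eq[symmetric] norm_mult power_mult_distrib
        using d elim by (intro mult_right_mono power_mono) auto
    qed
  qed
  also have "\<dots> = (\<Sum>j\<in>J. (cmod (e j))\<^sup>2)"
    using I by (rule_tac parseval)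
  finally show ?thesis .
qed

text \<open>Off the support, multiplication by \<open>x - z\<close> is bounded below on \<open>L\<^sup>2(\<mu>)\<close>. It sends the kernel
  \<open>K(x, z)\<close>, for real \<open>x\<close>, to a combination of \<open>p n\<close> and \<open>p (Suc n)\<close> only.\<close>

lemma kernel_vector_bound:
  assumes d: "\<And>x. x \<in> topological_support \<mu> \<Longrightarrow> d \<le> cmod (of_real x - z)" "0 \<le> d"
  shows "d\<^sup>2 * (\<Sum>j\<le>n. (cmod (F j z - l * F j w))\<^sup>2) \<le>
     2 * (cmod l)\<^sup>2 * (cmod (z - w))\<^sup>2 * Re (K00 f n w w)
     + 2 * (a n)\<^sup>2 * ((cmod (F n z - l * F n w))\<^sup>2 + (cmod (F (Suc n) z - l * F (Suc n) w))\<^sup>2)"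
proof -
  \<comment> \<open>Applying x - z to K(x, z) - l K(x, w), where K(x, u) is the sum of F_j(u)
    F_j(x), leaves l (z - w) K(x, w), with coefficients \<open>X\<close>, and the
    Christoffel-Darboux boundary terms, whose coefficients \<open>Y\<close> sit at n and n + 1
    only.\<close>
  define X where "X = (\<lambda>j. if j \<le> n then l * (z - w) * F j w else 0)"
  define Y where "Y = (\<lambda>j. if j \<le> n then (if j = n then - (a n * (F (Suc n) z - l * F (Suc n) w)) else 0)
                      else a n * (F n z - l * F n w))"
  have "d\<^sup>2 * (\<Sum>j\<le>n. (cmod (F j z - l * F j w))\<^sup>2) \<le> (\<Sum>j\<le>Suc n. (cmod (X j + Y j))\<^sup>2)"
  proof (rule multiplication_lower_bound[OF d])
    fix x :: real
    let ?x = "complex_of_real x"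
    have cd: "(?x - u) * (\<Sum>j\<le>n. F j u * F j ?x) = a n * (F (Suc n) ?x * F n u - F n ?x * F (Suc n) u)" for u :: complex
      using christoffel_darboux[of ?x u n] by (simp add: mult.commute)
    have "(?x - z) * (\<Sum>j\<le>n. (F j z - l * F j w) * F j ?x) =
        (?x - z) * (\<Sum>j\<le>n. F j z * F j ?x) - l * ((?x - w) * (\<Sum>j\<le>n. F j w * F j ?x))
        + l * (z - w) * (\<Sum>j\<le>n. F j w * F j ?x)"
      by (simp add: sum_subtractf sum_distrib_left algebra_simps)
    also have "\<dots> = l * (z - w) * (\<Sum>j\<le>n. F j w * F j ?x)
        - a n * (F (Suc n) z - l * F (Suc n) w) * F n ?x + a n * (F n z - l * F n w) * F (Suc n) ?x"
      unfolding cd by (simp add: algebra_simps)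
    also have "l * (z - w) * (\<Sum>j\<le>n. F j w * F j ?x) = (\<Sum>j\<le>Suc n. X j * F j ?x)"
      unfolding X_def by (simp add: sum_distrib_left mult.assoc)
    also have "- (a n * (F (Suc n) z - l * F (Suc n) w)) * F n ?x = (\<Sum>j\<le>n. Y j * F j ?x)"
    proof -
      have "(\<Sum>j\<le>n. Y j * F j ?x) = (\<Sum>j\<le>n. if j = n then - (a n * (F (Suc n) z - l * F (Suc n) w)) * F n ?x else 0)"
        by (intro sum.cong) (auto simp: Y_def)
      thus ?thesis by simp
    qed
    hence "(\<Sum>j\<le>Suc n. X j * F j ?x) - a n * (F (Suc n) z - l * F (Suc n) w) * F n ?x
          + a n * (F n z - l * F n w) * F (Suc n) ?x = (\<Sum>j\<le>Suc n. X j * F j ?x) + (\<Sum>j\<le>Suc n. Y j * F j ?x)"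
      by (simp add: Y_def)
    finally show "(?x - z) * (\<Sum>j\<le>n. (F j z - l * F j w) * F j ?x) = (\<Sum>j\<le>Suc n. (X j + Y j) * F j ?x)"
      by (simp add: sum.distrib algebra_simps)
  qed auto
  also have "\<dots> \<le> (\<Sum>j\<le>Suc n. 2 * (cmod (X j))\<^sup>2 + 2 * (cmod (Y j))\<^sup>2)"
    by (intro sum_mono power2_norm_add_le)
  also have "\<dots> = 2 * (\<Sum>j\<le>Suc n. (cmod (X j))\<^sup>2) + 2 * (\<Sum>j\<le>Suc n. (cmod (Y j))\<^sup>2)"
    by (simp add: sum.distrib sum_distrib_left)
  also have "(\<Sum>j\<le>Suc n. (cmod (X j))\<^sup>2) = (cmod l)\<^sup>2 * (cmod (z - w))\<^sup>2 * Re (K00 f n w w)"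
    by (simp add: X_def Re_K00_eq norm_mult power_mult_distrib sum_distrib_left)
  also have "(\<Sum>j\<le>Suc n. (cmod (Y j))\<^sup>2) =
      (a n)\<^sup>2 * ((cmod (F n z - l * F n w))\<^sup>2 + (cmod (F (Suc n) z - l * F (Suc n) w))\<^sup>2)"
  proof -
    have "(\<Sum>j\<le>n. (cmod (Y j))\<^sup>2) = (\<Sum>j\<le>n. if j = n then (cmod (a n * (F (Suc n) z - l * F (Suc n) w)))\<^sup>2 else 0)"
      by (intro sum.cong) (auto simp: Y_def simp del: of_real_mult)
    also have "\<dots> = (cmod (a n * (F (Suc n) z - l * F (Suc n) w)))\<^sup>2"
      by simp
    finally have "(\<Sum>j\<le>n. (cmod (Y j))\<^sup>2) = (cmod (a n * (F (Suc n) z - l * F (Suc n) w)))\<^sup>2" .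
    moreover have "Y (Suc n) = a n * (F n z - l * F n w)"
      by (simp add: Y_def)
    ultimately show ?thesis
      by (simp add: norm_mult power_mult_distrib distrib_left)
  qed
  finally show ?thesis
    by (simp add: algebra_simps)
qed

text \<open>The multiple \<open>l\<close> of the kernel vector at \<open>w\<close> is chosen by least squares from the last two entries;
  by Christoffel--Darboux the remaining defect is \<open>z - w\<close> times a bounded quantity.\<close>

lemma kernel_angle_bound:
  assumes d: "0 < d" "\<And>x. x \<in> topological_support \<mu> \<Longrightarrow> d \<le> cmod (of_real x - z)"
      "\<And>x. x \<in> topological_support \<mu> \<Longrightarrow> d \<le> cmod (of_real x - w)"
    and A: "\<And>k. a k \<le> A" "\<And>k. \<bar>b k\<bar> \<le> A" and Z: "cmod z \<le> Z"
    and close: "8 * (2 * (Z + A)\<^sup>2 + 4 * A\<^sup>2) * (cmod (z - w))\<^sup>2 \<le> d ^ 4"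
  shows "1 / 2 * Re (K00 f (Suc n) w w) * Re (K00 f (Suc n) z z) \<le> (cmod (K00 f (Suc n) z w))\<^sup>2"
proof -
  \<comment> \<open>At an index of at least 1 the recurrence expresses \<open>F (Suc m)\<close> by
    \<open>F m\<close> and \<open>F n\<close>, both of which occur in the kernel of order
    \<open>m\<close>.\<close>
  define m where "m = Suc n"
  define kz kw where "kz = Re (K00 f m z z)" and "kw = Re (K00 f m w w)"
  define pz pw where "pz = (cmod (F m z))\<^sup>2 + (cmod (F (Suc m) z))\<^sup>2"
    and "pw = (cmod (F m w))\<^sup>2 + (cmod (F (Suc m) w))\<^sup>2"
  define \<delta> where "\<delta> = (cmod (z - w))\<^sup>2"
  have k: "kz > 0" "kw > 0"
    by (simp_all add: kz_def kw_def K00_pos)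
  have am: "0 < a m" "(a m)\<^sup>2 \<le> A\<^sup>2" "a k \<le> A" for k
    using a_pos[of m] A by (auto intro: power_mono less_imp_le)
  have A0: "A > 0"
    using a_pos[of 0] A(1)[of 0] by linarith
  \<comment> \<open>The case l = 0: the entries at m and m + 1 carry a fixed share of the whole
    kernel vector, even if one of them vanishes.\<close>
  have kw_le: "d\<^sup>2 * kw \<le> 2 * (a m)\<^sup>2 * pw"
    using kernel_vector_bound[where d = d and z = w and n = m and l = 0 and w = w] d by (simp add: kw_def Re_K00_eq pw_def)
  have pw0: "pw > 0"
  proof -
    have "0 < d\<^sup>2 * kw"
      using d k by simp
    hence "0 < 2 * (a m)\<^sup>2 * pw"
      using kw_le by linarith
    thus ?thesis
      by (simp add: zero_less_mult_iff pw_def not_less)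
  qed
  have kw_pw: "kw / pw \<le> 2 * (a m)\<^sup>2 / d\<^sup>2"
    using kw_le pw0 d by (simp add: field_simps)
  \<comment> \<open>The recurrence for a_m F_{m+1} contributes 2 (Z + A)^2 + 2 A^2, and a_m F_m
    contributes another A^2.\<close>
  define B where "B = 2 * (Z + A)\<^sup>2 + 3 * A\<^sup>2"
  have pz_le: "(a m)\<^sup>2 * pz \<le> B * kz"
  proof -
    have Fm: "(cmod (F m z))\<^sup>2 \<le> kz" and Fn: "(cmod (F n z))\<^sup>2 \<le> kz"
      unfolding kz_def by (rule norm_F_le, simp add: m_def)+
    have "a m * F (Suc m) z = (z - b m) * F m z + - (a n * F n z)"
      using recurrence[of z n] by (simp add: m_def algebra_simps)
    hence "(cmod (a m * F (Suc m) z))\<^sup>2 \<le> 2 * (cmod ((z - b m) * F m z))\<^sup>2 + 2 * (cmod (- (a n * F n z)))\<^sup>2"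
      using power2_norm_add_le by metis
    also have "\<dots> = 2 * (cmod (z - b m))\<^sup>2 * (cmod (F m z))\<^sup>2 + 2 * (a n)\<^sup>2 * (cmod (F n z))\<^sup>2"
      by (simp add: norm_mult power_mult_distrib)
    also have "\<dots> \<le> 2 * (Z + A)\<^sup>2 * kz + 2 * A\<^sup>2 * kz"
    proof -
      have "cmod (z - b m) \<le> Z + A"
        using norm_triangle_ineq4[of z "of_real (b m)"] Z A(2)[of m] by simp
      moreover have "0 \<le> a n" "a n \<le> A"
        using a_pos[of n] A by (auto intro: less_imp_le)
      ultimately show ?thesis
        by (intro add_mono mult_mono power_mono Fm Fn mult_nonneg_nonneg) (auto intro: order_trans[OF norm_ge_zero])
    qed
    finally have "(cmod (a m * F (Suc m) z))\<^sup>2 \<le> 2 * (Z + A)\<^sup>2 * kz + 2 * A\<^sup>2 * kz" .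
    moreover have "(a m)\<^sup>2 * (cmod (F m z))\<^sup>2 \<le> A\<^sup>2 * kz"
      using am Fm by (intro mult_mono) auto
    ultimately show ?thesis
      unfolding pz_def B_def by (simp add: norm_mult power_mult_distrib algebra_simps)
  qed
  define l where "l = (F m z * cnj (F m w) + F (Suc m) z * cnj (F (Suc m) w)) / of_real pw"
  define D where "D = F m z * F (Suc m) w - F (Suc m) z * F m w"
  have l1: "(cmod (F m z - l * F m w))\<^sup>2 + (cmod (F (Suc m) z - l * F (Suc m) w))\<^sup>2 = (cmod D)\<^sup>2 / pw"
    unfolding l_def pw_def D_def by (rule lagrange_identity_complex) (use pw0 in \<open>simp only: pw_def\<close>)
  have l2: "(cmod l)\<^sup>2 \<le> pz / pw"
    unfolding l_def pw_def pz_def by (rule lagrange_identity_complex) (use pw0 in \<open>simp only: pw_def\<close>)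
  \<comment> \<open>By Christoffel-Darboux the determinant of the two pairs of entries carries the
    factor z - w, so the least squares residual is small when z is near w.\<close>
  have aD: "(a m)\<^sup>2 * (cmod D)\<^sup>2 \<le> \<delta> * (kz * kw)"
  proof -
    have "a m * D = - ((z - w) * (\<Sum>j\<le>m. F j z * F j w))"
      unfolding christoffel_darboux D_def by (simp add: algebra_simps)
    hence "cmod (a m * D) = cmod ((z - w) * (\<Sum>j\<le>m. F j z * F j w))"
      by simp
    hence "(a m)\<^sup>2 * (cmod D)\<^sup>2 = \<delta> * (cmod (\<Sum>j\<le>m. F j z * F j w))\<^sup>2"
      unfolding \<delta>_def norm_mult norm_of_real using am(1) by (simp flip: power_mult_distrib)
    also have "\<dots> \<le> \<delta> * (kz * kw)"
      unfolding kz_def kw_def \<delta>_def by (intro mult_left_mono norm_sum_F_le) auto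
    finally show ?thesis .
  qed
  define Q where "Q = (\<Sum>j\<le>m. (cmod (F j z - l * F j w))\<^sup>2)"
  have \<delta>0: "\<delta> \<ge> 0"
    by (simp add: \<delta>_def)
  have "d\<^sup>2 * Q \<le> 2 * (cmod l)\<^sup>2 * \<delta> * kw + 2 * (a m)\<^sup>2 * ((cmod D)\<^sup>2 / pw)"
    using kernel_vector_bound[where d = d and z = z and n = m and l = l and w = w] d unfolding Q_def l1 \<delta>_def kw_def by simp
  also have "2 * (a m)\<^sup>2 * ((cmod D)\<^sup>2 / pw) = 2 * ((a m)\<^sup>2 * (cmod D)\<^sup>2) / pw"
    by simp
  also have "\<dots> \<le> 2 * (\<delta> * (kz * kw)) / pw"
    using aD pw0 by (intro divide_right_mono mult_left_mono) auto
  also have "\<dots> = 2 * \<delta> * kz * (kw / pw)"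
    by simp
  also have "2 * (cmod l)\<^sup>2 * \<delta> * kw \<le> 2 * (pz / pw) * \<delta> * kw"
    using l2 \<delta>0 k by (intro mult_right_mono mult_left_mono) auto
  also have "2 * (pz / pw) * \<delta> * kw = 2 * \<delta> * pz * (kw / pw)"
    by simp
  also have "2 * \<delta> * pz * (kw / pw) + 2 * \<delta> * kz * (kw / pw) = 2 * \<delta> * (pz + kz) * (kw / pw)"
    by (simp only: distrib_left distrib_right)
  also have "\<dots> \<le> 2 * \<delta> * (pz + kz) * (2 * (a m)\<^sup>2 / d\<^sup>2)"
    using \<delta>0 k kw_pw by (intro mult_left_mono) (auto simp: pz_def)
  also have "\<dots> = 4 * \<delta> * ((a m)\<^sup>2 * pz + (a m)\<^sup>2 * kz) / d\<^sup>2"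
    by (simp add: algebra_simps)
  also have "\<dots> \<le> 4 * \<delta> * (B * kz + A\<^sup>2 * kz) / d\<^sup>2"
    using pz_le am k \<delta>0 by (intro divide_right_mono mult_left_mono add_mono mult_right_mono) auto
  \<comment> \<open>As B + A^2 = 2 (Z + A)^2 + 4 A^2, this is the quantity bounded by d^4 in
    \<open>close\<close>; the constant 8 there is what makes the residual at most half of
    \<open>kz\<close>.\<close>
  also have "\<dots> = (8 * (B + A\<^sup>2) * \<delta>) * kz / (2 * d\<^sup>2)"
    using d by (simp add: field_simps)
  also have "\<dots> \<le> d ^ 4 * kz / (2 * d\<^sup>2)"
    using close k d unfolding B_def \<delta>_def by (intro divide_right_mono mult_right_mono) (auto simp: algebra_simps)
  also have "\<dots> = d\<^sup>2 * ((1 - 1 / 2) * kz)"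
    using d by (simp add: power2_eq_square power4_eq_xxxx)
  finally have "Q \<le> (1 - 1 / 2) * kz"
    using d by simp
  hence "Q \<le> (1 - 1 / 2) * (\<Sum>j\<le>m. (cmod (F j z))\<^sup>2)"
    by (simp only: kz_def Re_K00_eq)
  thus ?thesis
    unfolding m_def[symmetric] Re_K00_eq Q_def unfolding K00_def
    by (rule norm_inner_ge_of_close)
qed

section \<open>Nonreal points: ratios of consecutive polynomials and the pointwise limit\<close>

definition R :: "complex \<Rightarrow> nat \<Rightarrow> complex" where
  "R z n = a n * F (Suc n) z / F n z"

definition W :: "complex \<Rightarrow> nat \<Rightarrow> complex" where
  "W z n = poly (pderiv (f (Suc n)) * f n - f (Suc n) * pderiv (f n)) z"

text \<open>The z-derivative of \<open>R\<close> by the quotient rule, with \<open>W\<close> the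
  Wronskian of consecutive polynomials.\<close>

definition R' :: "complex \<Rightarrow> nat \<Rightarrow> complex" where
  "R' z n = a n * W z n / (F n z)\<^sup>2"

lemma CD:
  "(0 + 1 * z + (- 1) * cnj w + 0 * z * cnj w) * K00 f n z w =
     poly (smult (a n) (f (Suc n))) z * cnj (F n w) - poly (smult (a n) (f n)) z * cnj (F (Suc n) w)"
  using christoffel_darboux[of z "cnj w" n] by (simp add: K00_eq F_cnj algebra_simps)

text \<open>The Christoffel-Darboux formula at w = z. It excludes nonreal zeros, and it shows that
  Im R has the sign of Im z and modulus at least |Im z|, since |F_n|^2 is one term of the
  kernel.\<close>

lemma Im_mult_K00:
  "Im z * Re (K00 f n z z) = a n * Im (F (Suc n) z * cnj (F n z))"
proof -
  define k where "k = Re (K00 f n z z)"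
  have k: "K00 f n z z = of_real k"
    by (simp add: k_def of_real_Re_K00)
  have "(z - cnj z) * of_real k = a n * (F (Suc n) z * cnj (F n z) - F n z * cnj (F (Suc n) z))"
    using CD[of z z n] unfolding k by (simp add: algebra_simps)
  from arg_cong[OF this, of Im] have "2 * (Im z * k) = 2 * (a n * Im (F (Suc n) z * cnj (F n z)))"
    by (simp add: algebra_simps)
  thus ?thesis
    unfolding k_def by simp
qed

lemma F_nonzero: "Im z \<noteq> 0 \<Longrightarrow> F n z \<noteq> 0"
  using Im_mult_K00[of z n] K00_pos[of n z] by auto

lemma Im_R: "Im z \<noteq> 0 \<Longrightarrow> Im (R z n) = Im z * Re (K00 f n z z) / (cmod (F n z))\<^sup>2"
proof -
  have "R z n = of_real (a n / (cmod (F n z))\<^sup>2) * (F (Suc n) z * cnj (F n z))"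
    unfolding R_def by (subst complex_div_cnj) simp
  moreover have Im_mult_real: "Im (of_real t * w) = t * Im w" for t w
    by simp
  ultimately have "Im (R z n) = a n / (cmod (F n z))\<^sup>2 * Im (F (Suc n) z * cnj (F n z))"
    by (simp only: Im_mult_real)
  thus ?thesis
    by (simp add: Im_mult_K00)
qed

text \<open>On the diagonal the prefactor z - cnj w is 2 i Im z, with square -4 (Im z)^2, and the
  correction term of the Gram identity is 1. Dividing by |F_n|^4 turns the Wronskian into
  \<open>R'\<close> and the kernel into Im R / Im z.\<close>

lemma intensity_eq:
  assumes z: "Im z \<noteq> 0"
  shows "intensity f n z = 1 / (4 * pi * (Im z)\<^sup>2) - (cmod (R' z n))\<^sup>2 / (4 * pi * (Im (R z n))\<^sup>2)"
proof -
  define k where "k = Re (K00 f n z z)"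
  define G where "G = Re (K11 f n z z) * Re (K00 f n z z) - (cmod (K01 f n z z))\<^sup>2"
  define y where "y = Im z"
  have k0: "k > 0" unfolding k_def by (rule K00_pos)
  have D: "0 + 1 * z + - 1 * cnj z + 0 * z * cnj z = 2 * \<i> * of_real y"
    by (simp add: y_def complex_eq_iff)
  have W1: "poly (pderiv (smult (a n) (f (Suc n))) * smult (a n) (f n)
        - smult (a n) (f (Suc n)) * pderiv (smult (a n) (f n))) z = (of_real (a n))\<^sup>2 * W z n"
    by (simp add: W_def pderiv_smult power2_eq_square algebra_simps)
  have W2: "poly (f n * pderiv (f (Suc n)) - pderiv (f n) * f (Suc n)) z = W z n"
    by (simp add: W_def algebra_simps)
  have "(2 * \<i> * of_real y)\<^sup>2 * (K11 f n z z * K00 f n z z - of_real ((cmod (K01 f n z z))\<^sup>2)) + (K00 f n z z)\<^sup>2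
      = (of_real (a n))\<^sup>2 * W z n * cnj (W z n)"
    using gram_determinant_of_CD[OF CD[where n = n], of z] unfolding D W1 W2 by simp
  hence "complex_of_real (- 4 * y\<^sup>2 * G + k\<^sup>2) = complex_of_real ((a n)\<^sup>2 * (cmod (W z n))\<^sup>2)"
    unfolding G_def k_def of_real_add of_real_diff of_real_mult of_real_Re_K11 of_real_Re_K00 complex_norm_square
    unfolding of_real_power of_real_Re_K00
    by (simp add: power_mult_distrib algebra_simps)
  hence G: "G = (k\<^sup>2 - (a n)\<^sup>2 * (cmod (W z n))\<^sup>2) / (4 * y\<^sup>2)"
    using z unfolding of_real_eq_iff y_def by (simp add: field_simps)
  define t where "t = (cmod (F n z))\<^sup>2"
  have t: "t > 0"
    using F_nonzero[OF z, of n] by (simp add: t_def)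
  have R'_eq: "(cmod (R' z n))\<^sup>2 = (a n)\<^sup>2 * (cmod (W z n))\<^sup>2 / t\<^sup>2"
    unfolding R'_def t_def by (simp add: norm_divide norm_mult norm_power power_divide power_mult_distrib)
  have R_eq: "Im (R z n) = y * k / t"
    using Im_R[OF z] by (simp add: y_def k_def t_def)
  have y0: "y \<noteq> 0"
    using z by (simp add: y_def)
  show ?thesis
    unfolding intensity_def G_def[symmetric] R'_eq R_eq y_def[symmetric]
    unfolding k_def[symmetric] G
    using k0 t y0 by (simp add: field_simps)
qed

lemma R_Suc:
  assumes z: "Im z \<noteq> 0"
  shows "R z (Suc n) = z - of_real (b (Suc n)) - (of_real (a n))\<^sup>2 / R z n"
proof -
  have "a n \<noteq> 0"
    using a_pos[of n] by simp
  moreover have "a (Suc n) * F (Suc (Suc n)) z = (z - of_real (b (Suc n))) * F (Suc n) z - of_real (a n) * F n z"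
    using recurrence[of z n] by (simp add: algebra_simps)
  ultimately show ?thesis
    unfolding R_def using F_nonzero[OF z, of n] F_nonzero[OF z, of "Suc n"]
    by (simp add: field_simps power2_eq_square)
qed

lemma R'_Suc:
  assumes z: "Im z \<noteq> 0"
  shows "R' z (Suc n) = 1 + (of_real (a n))\<^sup>2 * R' z n / (R z n)\<^sup>2"
proof -
  let ?P = "F n z" and ?Q = "F (Suc n) z" and ?P' = "poly (pderiv (f n)) z"
    and ?Q' = "poly (pderiv (f (Suc n))) z"
  have a0: "a n \<noteq> 0"
    using a_pos[of n] by simp
  have r: "a (Suc n) * F (Suc (Suc n)) w = (w - of_real (b (Suc n))) * F (Suc n) w - of_real (a n) * F n w" for w :: complex
    using recurrence[of w n] by (simp add: algebra_simps)
  have r': "a (Suc n) * poly (pderiv (f (Suc (Suc n)))) z =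
      ?Q + (z - of_real (b (Suc n))) * ?Q' - of_real (a n) * ?P'"
  proof (rule DERIV_unique)
    show "((\<lambda>w. a (Suc n) * F (Suc (Suc n)) w) has_field_derivative
        a (Suc n) * poly (pderiv (f (Suc (Suc n)))) z) (at z)"
      by (intro DERIV_cmult poly_DERIV)
    show "((\<lambda>w. a (Suc n) * F (Suc (Suc n)) w) has_field_derivative
        ?Q + (z - of_real (b (Suc n))) * ?Q' - of_real (a n) * ?P') (at z)"
      unfolding r by (auto intro!: derivative_eq_intros poly_DERIV)
  qed
  have "a (Suc n) * W z (Suc n) = (a (Suc n) * poly (pderiv (f (Suc (Suc n)))) z) * ?Q
      - (a (Suc n) * F (Suc (Suc n)) z) * ?Q'"
    by (simp add: W_def algebra_simps)
  also have "\<dots> = ?Q\<^sup>2 + of_real (a n) * W z n"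
    unfolding r r' by (simp add: W_def power2_eq_square algebra_simps)
  finally show ?thesis
    unfolding R'_def R_def using F_nonzero[OF z, of n] F_nonzero[OF z, of "Suc n"] a0
    by (simp add: field_simps power2_eq_square)
qed

lemma intensity_tendsto:
  assumes z: "Im z \<noteq> 0" and lim: "a \<longlonglongrightarrow> a0" "b \<longlonglongrightarrow> b0"
    and a0: "a0 \<ge> 0" and S: "sqrt_branch a0 b0 S"
  shows "(\<lambda>n. intensity f n z) \<longlonglongrightarrow> OPRL_limit_density a0 b0 S z"
proof -
  define \<Phi> \<Psi> where "\<Phi> = (z - of_real b0 + S z) / 2" and "\<Psi> = (z - of_real b0 - S z) / 2"
  have z_seg: "z \<notin> closed_segment (complex_of_real (b0 - 2 * a0)) (of_real (b0 + 2 * a0))"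
    using z unfolding closed_segment_of_real by auto
  have S2: "(S z)\<^sup>2 = (z - of_real b0)\<^sup>2 - 4 * (of_real a0)\<^sup>2"
    using S z_seg unfolding sqrt_branch_def by blast
  have sum: "\<Phi> + \<Psi> = z - of_real b0"
    by (simp add: \<Phi>_def \<Psi>_def field_simps)
  have prod: "\<Phi> * \<Psi> = of_real (a0\<^sup>2)"
    using S2 unfolding \<Phi>_def \<Psi>_def by (simp add: power2_eq_square algebra_simps)
  have dom: "cmod \<Psi> < cmod \<Phi>"
    using sqrt_branch_dominant[OF S a0 z_seg] by (simp add: \<Phi>_def \<Psi>_def norm_divide)
  have k_ge: "1 \<le> Re (K00 f n z z) / (cmod (F n z))\<^sup>2" for n
    using norm_F_le[of n n z] F_nonzero[OF z, of n] by (simp add: le_divide_eq)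
  have Im_R_ge: "\<bar>Im z\<bar> \<le> \<bar>Im (R z n)\<bar>" for n
  proof -
    have "\<bar>Im (R z n)\<bar> = \<bar>Im z\<bar> * (Re (K00 f n z z) / (cmod (F n z))\<^sup>2)"
      using Im_R[OF z, of n] K00_pos[of n z] by (simp add: abs_mult)
    moreover have "\<bar>Im z\<bar> * 1 \<le> \<bar>Im z\<bar> * (Re (K00 f n z z) / (cmod (F n z))\<^sup>2)"
      using k_ge by (intro mult_left_mono) auto
    ultimately show ?thesis by simp
  qed
  have R: "R z \<longlonglongrightarrow> \<Phi>"
  proof (rule continued_fraction_tendsto[OF R_Suc[OF z] _ Im_R_ge lim sum prod dom])
    fix n
    have "Im (R z n) * Im z = (Im z)\<^sup>2 * (Re (K00 f n z z) / (cmod (F n z))\<^sup>2)"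
      unfolding Im_R[OF z] by (simp add: power2_eq_square)
    also have "\<dots> > 0"
      using z k_ge[of n] by (intro mult_pos_pos) auto
    finally show "Im (R z n) * Im z > 0" .
  qed
  have R': "R' z \<longlonglongrightarrow> \<Phi> / (\<Phi> - \<Psi>)"
    by (rule continued_fraction_deriv_tendsto[OF R'_Suc[OF z] lim(1) R prod dom])
  \<comment> \<open>The lower bound on |Im R| passes to the limit, so the denominator with Im \<Phi>
    does not vanish.\<close>
  have "(\<lambda>n. \<bar>Im (R z n)\<bar>) \<longlonglongrightarrow> \<bar>Im \<Phi>\<bar>"
    by (intro tendsto_intros R)
  hence "\<bar>Im z\<bar> \<le> \<bar>Im \<Phi>\<bar>"
    by (rule LIMSEQ_le_const) (use Im_R_ge in auto)
  hence Im\<Phi>: "Im \<Phi> \<noteq> 0"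
    using z by auto
  have "(\<lambda>n. 1 / (4 * pi * (Im z)\<^sup>2) - (cmod (R' z n))\<^sup>2 / (4 * pi * (Im (R z n))\<^sup>2)) \<longlonglongrightarrow>
      1 / (4 * pi * (Im z)\<^sup>2) - (cmod (\<Phi> / (\<Phi> - \<Psi>)))\<^sup>2 / (4 * pi * (Im \<Phi>)\<^sup>2)"
    by (intro tendsto_intros R R') (use Im\<Phi> in auto)
  also have "1 / (4 * pi * (Im z)\<^sup>2) - (cmod (\<Phi> / (\<Phi> - \<Psi>)))\<^sup>2 / (4 * pi * (Im \<Phi>)\<^sup>2) =
      OPRL_limit_density a0 b0 S z"
  proof -
    have \<Phi>\<Psi>: "\<Phi> - \<Psi> = S z"
      by (simp add: \<Phi>_def \<Psi>_def field_simps)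
    have norm_S: "(cmod (S z))\<^sup>2 = cmod ((z - of_real b0)\<^sup>2 - 4 * (of_real a0)\<^sup>2)"
      by (simp add: S2[symmetric] norm_power)
    have norm_\<Phi>: "(cmod \<Phi>)\<^sup>2 = (cmod (z - of_real b0 + S z))\<^sup>2 / 4"
      by (simp add: \<Phi>_def norm_divide power_divide)
    have Im_\<Phi>: "Im \<Phi> = Im (z + S z) / 2"
      by (simp add: \<Phi>_def)
    show ?thesis
      unfolding OPRL_limit_density_def norm_divide power_divide \<Phi>\<Psi> norm_S norm_\<Phi> Im_\<Phi>
      by (simp add: power_divide)
  qed
  finally show ?thesis
    by (simp add: intensity_eq[OF z])
qed

lemma intensity_equilipschitz:
  assumes lim: "a \<longlonglongrightarrow> a0" "b \<longlonglongrightarrow> b0"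
    and x: "x \<in> - complex_of_real ` topological_support \<mu>"
  shows "\<exists>r>0. \<exists>M. ball x r \<subseteq> - complex_of_real ` topological_support \<mu> \<and>
      (\<forall>\<^sub>F n in sequentially. \<forall>y\<in>ball x r. \<forall>z\<in>ball x r.
         \<bar>intensity f n y - intensity f n z\<bar> \<le> M * dist y z)"
proof -
  obtain A1 where A1: "\<And>n. norm (a n) \<le> A1"
    using convergent_imp_Bseq[OF convergentI[OF lim(1)]] unfolding Bseq_def by blast
  obtain A2 where A2: "\<And>n. norm (b n) \<le> A2"
    using convergent_imp_Bseq[OF convergentI[OF lim(2)]] unfolding Bseq_def by blast
  define A where "A = max A1 A2"
  have A: "a k \<le> A" "\<bar>b k\<bar> \<le> A" for k
    using A1[of k] A2[of k] by (auto simp: A_def)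
  have "open (- complex_of_real ` topological_support \<mu>)"
    using closed_topological_support by (intro open_Compl closed_injective_linear_image bounded_linear.linear[OF bounded_linear_of_real] inj_of_real)
  \<comment> \<open>The doubled radius leaves distance at least \<open>d\<close> to the support from
    every point of \<open>ball x d\<close>.\<close>
  then obtain d where d: "d > 0" "ball x (2 * d) \<subseteq> - complex_of_real ` topological_support \<mu>"
    using x unfolding open_contains_ball by (metis field_sum_of_halves half_gt_zero mult_2)
  have dist_supp: "d \<le> cmod (of_real t - w)" if t: "t \<in> topological_support \<mu>" and w: "w \<in> ball x d" for t w
  proof (rule ccontr)
    assume "\<not> ?thesis"
    hence "dist w (of_real t) < d"
      by (simp add: dist_norm norm_minus_commute)
    hence "of_real t \<in> ball x (2 * d)"
      using w dist_triangle[of x "of_real t" w] by simp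
    thus False
      using d(2) t by auto
  qed
  define Z where "Z = cmod x + d"
  define B where "B = 8 * (2 * (Z + A)\<^sup>2 + 4 * A\<^sup>2)"
  have B: "B \<ge> 0"
    by (simp add: B_def)
  \<comment> \<open>Chosen so that sqrt B |w - x| \<le> d^2 on the ball, which squares to the
    closeness hypothesis of \<open>kernel_angle_bound\<close>. The summand 1 covers a vanishing
    square root.\<close>
  define r where "r = min d (d\<^sup>2 / (sqrt B + 1))"
  have r: "r > 0" "r \<le> d" "r \<le> d\<^sup>2 / (sqrt B + 1)"
    using d B by (auto simp: r_def add_nonneg_pos)
  obtain M where M: "\<And>f n y z. (\<forall>z\<in>ball x r. Re (K00 f n z z) > 0 \<and>
             1 / 2 * Re (K00 f n x x) * Re (K00 f n z z) \<le> (cmod (K00 f n z x))\<^sup>2) \<Longrightarrow>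
           y \<in> ball x (r / 4) \<Longrightarrow> z \<in> ball x (r / 4) \<Longrightarrow>
              \<bar>intensity f n y - intensity f n z\<bar> \<le> M * dist y z"
    using intensity_lipschitz[OF r(1), of "1 / 2" x, OF half_gt_zero[OF zero_less_one]] by blast
  \<comment> \<open>The angle bound concerns kernels of order \<open>Suc n\<close>, hence the
    restriction to n \<ge> 1 and a Lipschitz estimate that holds eventually.\<close>
  have "\<bar>intensity f n y - intensity f n z\<bar> \<le> M * dist y z"
    if n: "n \<ge> 1" and yz: "y \<in> ball x (r / 4)" "z \<in> ball x (r / 4)" for n y z
  proof (rule M[OF ballI yz])
    fix w assume w: "w \<in> ball x r"
    obtain m where m: "n = Suc m"
      using n by (cases n) auto
    have "1 / 2 * Re (K00 f n x x) * Re (K00 f n w w) \<le> (cmod (K00 f n w x))\<^sup>2"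
      unfolding m
    proof (rule kernel_angle_bound[OF d(1) dist_supp dist_supp A])
      show "w \<in> ball x d" "x \<in> ball x d"
        using w r d by auto
      have "cmod w \<le> cmod x + dist x w"
        using norm_triangle_ineq2[of w x] by (simp add: dist_norm norm_minus_commute)
      thus "cmod w \<le> Z"
        using w r by (simp add: Z_def)
      have wx: "cmod (w - x) \<le> r"
        using w by (simp add: dist_norm norm_minus_commute)
      have "sqrt B * cmod (w - x) \<le> (sqrt B + 1) * (d\<^sup>2 / (sqrt B + 1))"
        using wx r B by (intro mult_mono) auto
      also have "\<dots> = d\<^sup>2"
        using add_nonneg_pos[OF real_sqrt_ge_zero[OF B] zero_less_one] by simp
      finally have "(sqrt B * cmod (w - x))\<^sup>2 \<le> (d\<^sup>2)\<^sup>2"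
        using B by (intro power_mono) auto
      thus "8 * (2 * (Z + A)\<^sup>2 + 4 * A\<^sup>2) * (cmod (w - x))\<^sup>2 \<le> d ^ 4"
        unfolding B_def[symmetric] using B by (simp add: power_mult_distrib)
    qed
    thus "Re (K00 f n w w) > 0 \<and> 1 / 2 * Re (K00 f n x x) * Re (K00 f n w w) \<le> (cmod (K00 f n w x))\<^sup>2"
      using K00_pos by blast
  qed
  hence "\<forall>\<^sub>F n in sequentially. \<forall>y\<in>ball x (r / 4). \<forall>z\<in>ball x (r / 4).
         \<bar>intensity f n y - intensity f n z\<bar> \<le> M * dist y z"
    unfolding eventually_sequentially by blast
  moreover have "ball x (r / 4) \<subseteq> - complex_of_real ` topological_support \<mu>"
    using d(2) r by (intro order_trans[OF _ d(2)] subset_ball) auto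
  ultimately show ?thesis
    using r(1) by (intro exI[of _ "r / 4"] conjI exI[of _ M]) auto
qed

end

lemma nonreal_in_ball:
  assumes "0 < r" shows "\<exists>z\<in>ball x r. z \<in> {z. Im z \<noteq> 0}"
proof (cases "Im x = 0")
  case True
  thus ?thesis
    using assms by (intro bexI[of _ "x + of_real (r / 2) * \<i>"]) (auto simp: dist_norm norm_mult)
qed (use assms in force)

text \<open>Nonreal points are dense and off the support, and the limit formula holds at each of
  them. The continuous function \<open>L\<close> is therefore the continuous extension of the
  formula to the real points off the support.\<close>

lemma OPRL_intensity_limit:
  assumes "OPRL \<mu> p" "OPRL_recurrence p a b" "a \<longlonglongrightarrow> a0" "b \<longlonglongrightarrow> b0" "a0 \<ge> 0" "sqrt_branch a0 b0 S"
  shows "\<exists>L. continuous_on (- complex_of_real ` topological_support \<mu>) L \<and>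
             (\<forall>z. Im z \<noteq> 0 \<longrightarrow> L z = OPRL_limit_density a0 b0 S z) \<and>
             locally_uniform_limit (- complex_of_real ` topological_support \<mu>)
               (intensity (\<lambda>j. map_poly complex_of_real (p j))) L"
proof -
  interpret oprl \<mu> p a b
    by unfold_locales fact+
  have f_eq: "f = (\<lambda>j. map_poly complex_of_real (p j))"
    by (simp add: fun_eq_iff f_def)
  have "\<exists>L. continuous_on (- complex_of_real ` topological_support \<mu>) L \<and>
      (\<forall>z\<in>{z. Im z \<noteq> 0} \<inter> - complex_of_real ` topological_support \<mu>. L z = OPRL_limit_density a0 b0 S z) \<and>
      locally_uniform_limit (- complex_of_real ` topological_support \<mu>) (intensity f) L"
    by (rule locally_uniform_limit_of_equilipschitz)
       (use intensity_equilipschitz[OF assms(3,4)] nonreal_in_ball intensity_tendsto[OF _ assms(3-6)] in auto)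
  moreover have "z \<in> - complex_of_real ` topological_support \<mu>" if "Im z \<noteq> 0" for z
    using that by auto
  ultimately show ?thesis
    unfolding f_eq by blast
qed

theorem corollary2:
  fixes \<Omega> :: "'w measure" and \<eta> :: "nat \<Rightarrow> 'w \<Rightarrow> complex"
    and f :: "nat \<Rightarrow> complex poly" and P :: "nat \<Rightarrow> 'w \<Rightarrow> complex poly"
  assumes "iid_std_complex_gaussian \<Omega> \<eta>"
    and "P = random_poly \<eta> f"
  shows
    "(\<forall>(\<mu> :: real measure) p an bn a b S.
        OPRL \<mu> p \<and> f = (\<lambda>j. map_poly complex_of_real (p j)) \<and>
        OPRL_recurrence p an bn \<and> an \<longlonglongrightarrow> a \<and> bn \<longlonglongrightarrow> b \<and> a \<ge> 0 \<and> sqrt_branch a b S \<longrightarrow>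
        (\<exists>L. continuous_on (- complex_of_real ` topological_support \<mu>) L \<and>
             (\<forall>z. Im z \<noteq> 0 \<longrightarrow> L z = OPRL_limit_density a b S z) \<and>
             locally_uniform_limit (- complex_of_real ` topological_support \<mu>) (intensity f) L))
     \<and>
     (\<forall>(\<mu> :: complex measure) \<alpha>.
        OPUC \<mu> f \<and> OPUC_recurrence f \<alpha> \<and> \<alpha> \<longlonglongrightarrow> 0 \<and>
        (\<forall>j. \<alpha> j \<in> complex_of_real ` {-1<..<1}) \<longrightarrow>
        locally_uniform_limit (- sphere 0 1) (intensity f) (\<lambda>z. 1 / (pi * (1 - (cmod z)\<^sup>2)\<^sup>2)))"
  using OPRL_intensity_limit OPUC_intensity_limit by auto

end
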